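(* Let $a$ and $b$ be positive integers, $\lambda=\gcd(a,b)$, $c=a/\lambda$ and $d=b/\lambda$. Then $$\lim_{X\to\infty}\frac{1}{X^{3/2}}\int_{1}^X \Delta(x/a)\Delta(x/b)\,dx=\frac{\tau(cd)}{6\pi^2\sqrt{\lambda}\,cd}\,\frac{\zeta(3/2)^4}{\zeta(3)}\prod_{p^k\|cd}\frac{1-\frac{k-1}{(k+1)p^{3/2}}}{1+1/p^{3/2}}.$$ Furthermore, when $\theta>0$ is irrational, $$\lim_{X\to\infty}\frac{1}{X^{3/2}}\int_{1}^X \Delta(x)\Delta(\theta x)\,dx=0.$$
   Context: $\tau(n)$ is the number of positive divisors of $n$, $\zeta$ is the Riemann zeta function, and $\Delta(x)$ is defined for $x>0$ by $\sum_{n\leq x}\tau(n)=x\log x+(2\gamma-1)x+\Delta(x)$, where $\gamma$ is Euler's constant. The product runs over the primes $p$ dividing $cd$, with $k$ the exponent such that $p^k\| cd$ (i.e. $p^k\mid cd$, $p^{k+1}\nmid cd$). *)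

theory Defs
  imports "HOL-Analysis.Analysis" "HOL-Computational_Algebra.Primes"
begin

definition divisor_tau :: "nat \<Rightarrow> nat" where
  "divisor_tau n = card {d. d dvd n}"

(* The Dirichlet series; it represents the Riemann zeta function only for s > 1. *)
definition zeta_real :: "real \<Rightarrow> real" where
  "zeta_real s = (\<Sum>n. 1 / real (Suc n) powr s)"

(* The error term in the Dirichlet divisor problem, meaningful for x > 0. *)
definition Delta :: "real \<Rightarrow> real" where
  "Delta x = (\<Sum>n | 1 \<le> n \<and> real n \<le> x. real (divisor_tau n))
     - (x * ln x + (2 * euler_mascheroni - 1) * x)"

end

(*
  The logarithmic mean sum_{n <= x} tau(n) ln (x/n) is the integral of floor(u) floor(x/u) du/u. Replacing both
  floors by sawtooth functions and these by their Fourier series turns it into elementary terms plus an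
  absolutely convergent series of the integrals of sin (z e^y) sin (z e^-y) over the real line,
  z = 2 pi sqrt (n x); the substitution q = sinh (y/2) identifies the latter, up to O(z^(-3/2)), with a constant
  times z^(-1/2) cos (2 z + phi), by the Fresnel integral. The phase phi itself never matters.

  Since the summatory function of tau is monotone, Delta lies, up to small errors, between short increments of
  this mean. The increments are averages of the sine sum
  x^(1/4) sum_{n <= N} tau(n) n^(-3/4) sin (4 pi sqrt (n x) + phi), and an elementary mean value estimate shows
  that the terms with n > K contribute to the mean square only O(sum_{n > K} tau(n)^2 n^(-3/2)).
  So the correlations of Delta are limits of correlations of finite sine sums, in which only equal frequencies
  m/a = n/b survive. For irrational theta there are none; otherwise (m, n) = (c k, d k), and the resulting
  series of tau(c k) tau(d k) k^(-3/2) is computed by adding to cd one prime power at a time.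
*)

theory Submission
  imports Defs "HOL-Real_Asymp.Real_Asymp"
begin

section \<open>Fresnel integrals\<close>

text \<open>The detour through the logarithmic mean is forced by convergence: the Voronoi series of
  \<open>Delta\<close> has coefficients \<open>tau(n) n^(-3/4)\<close> and is not absolutely
  convergent, while one integration against dt/t lowers them to \<open>tau(n) n^(-5/4)\<close>,
  which permits rearrangement, truncation and majorants uniform in x. The price is the return to
  \<open>Delta\<close> by differencing over windows of length H. On [X, 2X] the choice H = X^(1/8)
  keeps every error pointwise at X^(1/8) up to a logarithm, below the true size X^(1/4) of
  \<open>Delta\<close>.

  The window argument is too lossy to reproduce the exact mean square of the terms n > K, hence the
  arbitrary looking factor 360. This is harmless: the factor multiplies a tail that tends to 0 with
  K, and the terms n <= K are split off before the lossy step, up to a Lipschitz error, so they keep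
  their exact constant.

  The phase is irrelevant because both factors of a correlation carry the same one: it cancels in
  the difference of the two arguments, and only that difference can be free of oscillation.\<close>

lemma norm_integral_decreasing_weight_le:
  fixes f :: "real \<Rightarrow> complex" and w w' :: "real \<Rightarrow> real"
  assumes ab: "a \<le> b" and f: "continuous_on {a..b} f"
    and w: "\<And>x. x \<in> {a..b} \<Longrightarrow> (w has_real_derivative w' x) (at x)"
    and w': "continuous_on {a..b} w'" "\<And>x. x \<in> {a..b} \<Longrightarrow> w' x \<le> 0"
    and wb: "w b \<ge> 0"
    and M: "\<And>q. q \<in> {a..b} \<Longrightarrow> norm (integral {a..q} f) \<le> M"
  shows "norm (integral {a..b} (\<lambda>x. of_real (w x) * f x)) \<le> M * w a"
proof -
  define F where "F = (\<lambda>q. integral {a..q} f)"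
  have F: "(F has_vector_derivative f x) (at x within {a..b})" if "x \<in> {a..b}" for x
    unfolding F_def using integral_has_vector_derivative[OF f that] .
  have cF: "continuous_on {a..b} F"
    using F by (meson continuous_on_eq_continuous_within has_vector_derivative_continuous)
  have w_vec: "((\<lambda>x. complex_of_real (w x)) has_vector_derivative of_real (w' x)) (at x within {a..b})"
    if "x \<in> {a..b}" for x
    by (intro has_vector_derivative_of_real has_field_derivative_at_within[OF w[OF that]])
  \<comment> \<open>Integration by parts with the primitive \<open>F\<close> of \<open>f\<close>,
    which vanishes at \<open>a\<close>. The boundary term costs \<open>M * w b\<close> and the
    monotone weight costs \<open>M\<close> times its variation \<open>w a - w b\<close>; together
    \<open>M * w a\<close>.\<close>
  have "((\<lambda>x. of_real (w x) * f x + of_real (w' x) * F x) has_integral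
          (of_real (w b) * F b - of_real (w a) * F a)) {a..b}"
    by (intro fundamental_theorem_of_calculus ab has_vector_derivative_mult w_vec F)
  moreover have "F a = 0" by (simp add: F_def)
  ultimately have 1: "((\<lambda>x. of_real (w x) * f x + of_real (w' x) * F x) has_integral
          (of_real (w b) * F b)) {a..b}" by simp
  have i2: "(\<lambda>x. of_real (w' x) * F x) integrable_on {a..b}"
    by (intro integrable_continuous_real continuous_intros w' cF)
  from has_integral_diff[OF 1 integrable_integral[OF i2]]
  have 3: "integral {a..b} (\<lambda>x. of_real (w x) * f x) =
      of_real (w b) * F b - integral {a..b} (\<lambda>x. of_real (w' x) * F x)"
    by (simp add: integral_unique)
  have ftc: "(w' has_integral (w b - w a)) {a..b}"
    by (intro fundamental_theorem_of_calculus ab)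
      (use w in \<open>meson has_field_derivative_at_within has_real_derivative_iff_has_vector_derivative\<close>)
  have "norm (integral {a..b} (\<lambda>x. of_real (w' x) * F x)) \<le> integral {a..b} (\<lambda>x. - M * w' x)"
  proof (rule integral_norm_bound_integral)
    show "(\<lambda>x. - M * w' x) integrable_on {a..b}"
      by (intro integrable_continuous_real continuous_intros w')
    fix x assume x: "x \<in> {a..b}"
    have "norm (of_real (w' x) * F x) = - w' x * norm (F x)"
      using w'(2)[OF x] by (simp add: norm_mult)
    also have "\<dots> \<le> - w' x * M"
      using w'(2)[OF x] M[OF x] unfolding F_def by (intro mult_left_mono) auto
    finally show "norm (of_real (w' x) * F x) \<le> - M * w' x" by (simp add: mult.commute)
  qed (use i2 in auto)
  also have "\<dots> = - M * (w b - w a)"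
    by (rule integral_unique) (rule has_integral_mult_right[OF ftc])
  finally have 4: "norm (integral {a..b} (\<lambda>x. of_real (w' x) * F x)) \<le> M * (w a - w b)"
    by (simp add: algebra_simps)
  have "norm (of_real (w b) * F b) \<le> w b * M"
    using wb M[of b] ab unfolding F_def norm_mult by (auto intro!: mult_left_mono)
  then show ?thesis
    unfolding 3 using 4 norm_triangle_ineq4[of "of_real (w b) * F b"
        "integral {a..b} (\<lambda>x. of_real (w' x) * F x)"]
    by (simp add: algebra_simps)
qed

text \<open>The integrand is \<open>1 / (2 * l * q)\<close>, a decreasing weight, times the
  derivative of \<open>- \<i> * cis (l * q\<^sup>2)\<close>, whose increments have norm at most
  2.\<close>

lemma norm_integral_cis_square_tail:
  fixes l a b :: real
  assumes "l > 0" "0 < a" "a \<le> b"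
  shows "norm (integral {a..b} (\<lambda>q. cis (l * q\<^sup>2))) \<le> 1 / (l * a)"
proof -
  define f where "f = (\<lambda>q. complex_of_real (2 * l * q) * cis (l * q\<^sup>2))"
  have cf: "continuous_on S f" for S
    unfolding f_def cis_conv_exp by (intro continuous_intros)
  have F: "((\<lambda>q. - \<i> * cis (l * q\<^sup>2)) has_vector_derivative f q) (at q within S)" for q S
  proof -
    have "((\<lambda>q. - \<i> * exp (\<i> * of_real l * q\<^sup>2)) has_field_derivative
            2 * of_real l * q * exp (\<i> * of_real l * q\<^sup>2)) (at q within T)" for q :: complex and T
      by (rule derivative_eq_intros refl | simp add: algebra_simps power2_eq_square)+
    from has_vector_derivative_real_field[OF this[where q = "of_real q"]]
    show ?thesis
      by (simp add: f_def cis_conv_exp mult_ac)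
  qed
  have M: "norm (integral {a..q} f) \<le> 2" if "q \<in> {a..b}" for q
  proof -
    have "(f has_integral (- \<i> * cis (l * q\<^sup>2) - - \<i> * cis (l * a\<^sup>2))) {a..q}"
      by (intro fundamental_theorem_of_calculus F) (use that in auto)
    then have "integral {a..q} f = - \<i> * cis (l * q\<^sup>2) - - \<i> * cis (l * a\<^sup>2)"
      by (simp add: integral_unique)
    then show ?thesis
      using norm_triangle_ineq4[of "- \<i> * cis (l * q\<^sup>2)" "- \<i> * cis (l * a\<^sup>2)"]
      by (simp add: norm_mult)
  qed
  have "norm (integral {a..b} (\<lambda>x. of_real (1 / (2 * l * x)) * f x)) \<le> 2 * (1 / (2 * l * a))"
  proof (rule norm_integral_decreasing_weight_le[where w' = "\<lambda>x. - 1 / (2 * l * x\<^sup>2)"])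
    show "((\<lambda>x. 1 / (2 * l * x)) has_real_derivative - 1 / (2 * l * x\<^sup>2)) (at x)" if "x \<in> {a..b}" for x
      using that assms by (auto intro!: derivative_eq_intros simp: field_simps power2_eq_square)
    show "continuous_on {a..b} (\<lambda>x. - 1 / (2 * l * x\<^sup>2))"
      using assms by (auto intro!: continuous_intros)
  qed (use assms M cf in auto)
  also have "integral {a..b} (\<lambda>x. of_real (1 / (2 * l * x)) * f x) = integral {a..b} (\<lambda>q. cis (l * q\<^sup>2))"
    by (rule integral_cong) (use assms in \<open>auto simp: f_def\<close>)
  finally show ?thesis by (simp add: mult.commute)
qed

lemma continuous_on_cis_square [continuous_intros]:
  "continuous_on S (\<lambda>q::real. cis (l * q\<^sup>2))"
  by (simp add: cis_conv_exp) (intro continuous_intros)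

text \<open>Splitting at \<open>1 / sqrt l\<close> balances the two available bounds: below this
  point the length of the interval, above it the tail estimate, each at most
  \<open>1 / sqrt l\<close>. The result is uniform in the interval, so it can serve as the bound
  \<open>M\<close> for weighted integrals.\<close>

lemma norm_integral_cis_square:
  fixes l a b :: real
  assumes l: "l > 0" and a: "0 \<le> a"
  shows "norm (integral {a..b} (\<lambda>q. cis (l * q\<^sup>2))) \<le> 2 / sqrt l"
proof -
  define c where "c = 1 / sqrt l"
  have c: "c > 0" using l by (simp add: c_def)
  have lc: "1 / (l * c) = c" using l by (simp add: c_def real_div_sqrt)
  have int: "(\<lambda>q::real. cis (l * q\<^sup>2)) integrable_on {x..y}" for x y
    by (intro integrable_continuous_real continuous_intros)
  have triv: "norm (integral {x..y} (\<lambda>q. cis (l * q\<^sup>2))) \<le> y - x" if "x \<le> y" for x y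
    using integral_bound[of x y "\<lambda>q. cis (l * q\<^sup>2)" 1] that
    by (auto intro: continuous_intros)
  have tail: "norm (integral {x..y} (\<lambda>q. cis (l * q\<^sup>2))) \<le> c" if "c \<le> x" "x \<le> y" for x y
  proof -
    have "norm (integral {x..y} (\<lambda>q. cis (l * q\<^sup>2))) \<le> 1 / (l * x)"
      using norm_integral_cis_square_tail[of l x y] that l c by simp
    also have "\<dots> \<le> 1 / (l * c)" using that l c by (intro divide_left_mono mult_left_mono) auto
    finally show ?thesis using lc by simp
  qed
  have "norm (integral {a..b} (\<lambda>q. cis (l * q\<^sup>2))) \<le> c + c"
  proof (cases "a \<le> b")
    case ab: True
    consider "b \<le> c" | "c \<le> a" | "a < c" "c < b" by linarith
    then show ?thesis
    proof cases
      case 1 then show ?thesis using triv[OF ab] a c by linarith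
    next
      case 2 then show ?thesis using tail[OF _ ab] c by fastforce
    next
      case 3
      have "integral {a..c} (\<lambda>q. cis (l * q\<^sup>2)) + integral {c..b} (\<lambda>q. cis (l * q\<^sup>2))
           = integral {a..b} (\<lambda>q. cis (l * q\<^sup>2))"
        using 3 by (intro Henstock_Kurzweil_Integration.integral_combine int) auto
      then show ?thesis using triv[of a c] tail[of c b] 3 a
        by (smt (verit) norm_triangle_ineq)
    qed
  qed (use c in auto)
  then show ?thesis by (simp add: c_def)
qed

lemma convergent_at_top_Cauchy:
  fixes F :: "real \<Rightarrow> 'a::banach"
  assumes "\<And>e. e > 0 \<Longrightarrow> \<exists>P. \<forall>x\<ge>P. \<forall>y\<ge>x. norm (F y - F x) < e"
  shows "\<exists>L. (F \<longlongrightarrow> L) at_top"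
proof -
  have "convergent (\<lambda>n. F (real n))"
    unfolding Cauchy_convergent_iff[symmetric] Cauchy_iff
  proof (intro allI impI)
    fix e :: real assume "e > 0"
    then obtain P where P: "\<And>x y. x \<ge> P \<Longrightarrow> y \<ge> x \<Longrightarrow> norm (F y - F x) < e"
      using assms by blast
    obtain M where M: "real M \<ge> P" using real_arch_simple by blast
    show "\<exists>M. \<forall>m\<ge>M. \<forall>n\<ge>M. norm (F (real m) - F (real n)) < e"
    proof (intro exI allI impI)
      fix m n assume "M \<le> m" "M \<le> n"
      then show "norm (F (real m) - F (real n)) < e"
        using P[of "real m" "real n"] P[of "real n" "real m"] M
        by (cases "m \<le> n") (auto simp: norm_minus_commute)
    qed
  qed
  then obtain L where L: "(\<lambda>n. F (real n)) \<longlonglongrightarrow> L" by (auto simp: convergent_def)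
  have "(F \<longlongrightarrow> L) at_top"
  proof (rule tendstoI)
    fix e :: real assume e: "e > 0"
    then obtain P where P: "\<And>x y. x \<ge> P \<Longrightarrow> y \<ge> x \<Longrightarrow> norm (F y - F x) < e/2"
      using assms[of "e/2"] by auto
    have "eventually (\<lambda>n. dist (F (real n)) L < e/2) sequentially"
      using tendstoD[OF L, of "e/2"] e by simp
    then obtain N where N: "\<And>n. n \<ge> N \<Longrightarrow> dist (F (real n)) L < e/2"
      by (auto simp: eventually_sequentially)
    show "eventually (\<lambda>x. dist (F x) L < e) at_top"
      using eventually_ge_at_top[of P]
    proof eventually_elim
      case (elim x)
      obtain n where n: "real n \<ge> max x (real N)" using real_arch_simple by blast
      have "norm (F (real n) - F x) < e/2" using P[OF elim] n by auto
      moreover have "dist (F (real n)) L < e/2" using N n by auto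
      ultimately show ?case
        using dist_triangle[of "F x" L "F (real n)"] by (simp add: dist_norm norm_minus_commute)
    qed
  qed
  then show ?thesis by blast
qed

lemma Fresnel_limit_exists:
  "\<exists>L. ((\<lambda>Q. integral {0..Q} (\<lambda>q. cis (q\<^sup>2))) \<longlongrightarrow> L) at_top"
proof (rule convergent_at_top_Cauchy)
  fix e :: real assume e: "e > 0"
  have c: "continuous_on S (\<lambda>q::real. cis (q\<^sup>2))" for S
    using continuous_on_cis_square[of S 1] by simp
  show "\<exists>P. \<forall>x\<ge>P. \<forall>y\<ge>x. norm (integral {0..y} (\<lambda>q. cis (q\<^sup>2)) - integral {0..x} (\<lambda>q. cis (q\<^sup>2))) < e"
  proof (intro exI[of _ "2/e"] allI impI)
    fix x y assume xy: "2/e \<le> x" "x \<le> y"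
    have x: "x > 0" using xy e by (smt (verit) divide_pos_pos)
    have "integral {0..x} (\<lambda>q. cis (q\<^sup>2)) + integral {x..y} (\<lambda>q. cis (q\<^sup>2)) = integral {0..y} (\<lambda>q. cis (q\<^sup>2))"
      using x xy by (intro Henstock_Kurzweil_Integration.integral_combine integrable_continuous_real c) auto
    then have "norm (integral {0..y} (\<lambda>q. cis (q\<^sup>2)) - integral {0..x} (\<lambda>q. cis (q\<^sup>2)))
        = norm (integral {x..y} (\<lambda>q. cis (q\<^sup>2)))" by (metis add_diff_cancel_left')
    also have "\<dots> \<le> 1 / x" using norm_integral_cis_square_tail[of 1 x y] x xy by simp
    also have "\<dots> < e" using xy x e by (simp add: field_simps)
    finally show "norm (integral {0..y} (\<lambda>q. cis (q\<^sup>2)) - integral {0..x} (\<lambda>q. cis (q\<^sup>2))) < e" .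
  qed
qed


lemma continuous_on_cis_square' [continuous_intros]:
  "continuous_on S (\<lambda>q::real. cis (q\<^sup>2))"
  using continuous_on_cis_square[of S 1] by simp

lemma integral_scale_from_0:
  fixes f :: "real \<Rightarrow> complex"
  assumes "c > 0" "continuous_on UNIV f"
  shows "integral {0..Q} (\<lambda>q. f (c * q)) = integral {0..c * Q} f /\<^sub>R c"
proof -
  have "(f has_integral integral {0..c * Q} f) (cbox 0 (c * Q))"
    using assms by (auto intro!: integrable_integral integrable_continuous_real
        intro: continuous_on_subset)
  from has_integral_affinity'[OF this assms(1), of 0] show ?thesis
    using assms(1) by (simp add: integral_unique mult.assoc[symmetric])
qed

lemma cis_mult_Suc_arg: "cis (a * (1 + b)) = cis a * cis (a * b)"
  by (simp add: cis_mult distrib_left)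

text \<open>The classical proof of the Gaussian integral, with an imaginary exponent. For
  \<open>G t\<close> the integral up to t and \<open>J t\<close> the integral of
  \<open>cis (t\<^sup>2 * (1 + s\<^sup>2)) / (1 + s\<^sup>2)\<close> over [0, 1], rescaling
  \<open>G t = t * U t\<close> to a fixed interval shows that \<open>G t * G t + \<i> * J t\<close>
  has derivative 0. Hence the square of \<open>G T\<close> is \<open>\<i> * (J 0 - J T)\<close>,
  where \<open>J 0\<close> is arctan 1 and \<open>J T\<close> decays.\<close>

lemma Fresnel_square_identity:
  fixes T :: real
  assumes T: "T > 0"
  shows "norm ((integral {0..T} (\<lambda>q. cis (q\<^sup>2)))\<^sup>2 - \<i> * of_real (pi / 4)) \<le> 2 / T"
proof -
  define G where "G = (\<lambda>t. integral {0..t} (\<lambda>q. cis (q\<^sup>2)))"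
  define J where "J = (\<lambda>t. integral {0..1} (\<lambda>s::real. cis (t\<^sup>2 * (1 + s\<^sup>2)) /\<^sub>R (1 + s\<^sup>2)))"
  define U where "U = (\<lambda>t::real. integral {0..1} (\<lambda>s. cis (t\<^sup>2 * s\<^sup>2)))"
  have G_U: "G t = of_real t * U t" if "t \<ge> 0" for t
  proof (cases "t = 0")
    case False
    have "U t = integral {0..1} (\<lambda>s. (\<lambda>q. cis (q\<^sup>2)) (t * s))"
      by (simp add: U_def power_mult_distrib)
    also have "\<dots> = G t /\<^sub>R t"
      unfolding G_def using that False
      by (subst integral_scale_from_0) (auto intro: continuous_intros)
    finally show ?thesis using False by (simp add: scaleR_conv_of_real)
  qed (simp add: G_def)
  have dG: "(G has_vector_derivative cis (t\<^sup>2)) (at t within {0..T})" if "t \<in> {0..T}" for t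
    unfolding G_def by (intro integral_has_vector_derivative continuous_intros that)
  have dJ: "(J has_vector_derivative (2 * of_real t * \<i> * cis (t\<^sup>2) * U t)) (at t within {0..T})"
    if t: "t \<in> {0..T}" for t
  proof -
    have pos: "1 + s\<^sup>2 \<noteq> (0::real)" for s :: real by (smt (verit) zero_le_power2)
    have "((\<lambda>t. integral (cbox 0 1) (\<lambda>s::real. cis (t\<^sup>2 * (1 + s\<^sup>2)) /\<^sub>R (1 + s\<^sup>2)))
        has_vector_derivative integral (cbox 0 1) (\<lambda>s. 2 * of_real t * \<i> * cis (t\<^sup>2 * (1 + s\<^sup>2))))
        (at t within {0..T})"
    proof (rule leibniz_rule_vector_derivative[where U = "{0..T}"
          and f = "\<lambda>t s. cis (t\<^sup>2 * (1 + s\<^sup>2)) /\<^sub>R (1 + s\<^sup>2)"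
          and fx = "\<lambda>t s. 2 * of_real t * \<i> * cis (t\<^sup>2 * (1 + s\<^sup>2))"])
      fix x s :: real
      have "((\<lambda>q. exp (\<i> * (q\<^sup>2 * of_real (1 + s\<^sup>2))) / of_real (1 + s\<^sup>2)) has_field_derivative
            2 * q * \<i> * exp (\<i> * (q\<^sup>2 * of_real (1 + s\<^sup>2)))) (at q within S)" for q :: complex and S
      proof -
        define c :: complex where "c = of_real (1 + s\<^sup>2)"
        have "c \<noteq> 0" unfolding c_def of_real_eq_0_iff by (rule pos)
        then show ?thesis unfolding c_def[symmetric]
          by (auto intro!: derivative_eq_intros simp: field_simps)
      qed
      from has_vector_derivative_real_field[OF this[of "of_real x" UNIV], of "{0..T}"]
      show "((\<lambda>x. cis (x\<^sup>2 * (1 + s\<^sup>2)) /\<^sub>R (1 + s\<^sup>2)) has_vector_derivative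
             2 * of_real x * \<i> * cis (x\<^sup>2 * (1 + s\<^sup>2))) (at x within {0..T})"
        by (simp add: cis_conv_exp scaleR_conv_of_real field_simps)
    next
      show "(\<lambda>s. cis (x\<^sup>2 * (1 + s\<^sup>2)) /\<^sub>R (1 + s\<^sup>2)) integrable_on cbox 0 1" for x :: real
        using pos by (auto intro!: integrable_continuous_real continuous_intros simp: cis_conv_exp)
      show "continuous_on ({0..T} \<times> cbox 0 1) (\<lambda>(x, s). 2 * of_real x * \<i> * cis (x\<^sup>2 * (1 + s\<^sup>2)))"
        unfolding cis_conv_exp split_beta by (intro continuous_intros)
    qed (use t in auto)
    moreover have "(\<lambda>s. 2 * of_real t * \<i> * cis (t\<^sup>2 * (1 + s\<^sup>2))) =
        (\<lambda>s. (2 * of_real t * \<i> * cis (t\<^sup>2)) * cis (t\<^sup>2 * s\<^sup>2))"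
      by (simp add: fun_eq_iff cis_mult_Suc_arg mult.assoc)
    ultimately show ?thesis by (simp add: J_def U_def)
  qed
  have "((\<lambda>t. G t * G t + \<i> * J t) has_vector_derivative 0) (at t within {0..T})" if t: "t \<in> {0..T}" for t
  proof -
    have "((\<lambda>t. G t * G t + \<i> * J t) has_vector_derivative
        (G t * cis (t\<^sup>2) + cis (t\<^sup>2) * G t) + \<i> * (2 * of_real t * \<i> * cis (t\<^sup>2) * U t)) (at t within {0..T})"
      by (intro has_vector_derivative_add has_vector_derivative_mult has_vector_derivative_mult_right dG dJ t)
    also have "(G t * cis (t\<^sup>2) + cis (t\<^sup>2) * G t) + \<i> * (2 * of_real t * \<i> * cis (t\<^sup>2) * U t) = 0"
      using G_U[of t] t by (simp add: algebra_simps)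
    finally show ?thesis .
  qed
  then have "((\<lambda>t. 0) has_integral ((G T * G T + \<i> * J T) - (G 0 * G 0 + \<i> * J 0))) {0..T}"
    by (intro fundamental_theorem_of_calculus) (use T in auto)
  then have 1: "G T * G T + \<i> * J T = \<i> * J 0"
    by (simp add: G_def)
  have "((\<lambda>s::real. complex_of_real (1 / (1 + s\<^sup>2))) has_integral (of_real (arctan 1) - of_real (arctan 0))) {0..1}"
  proof (intro fundamental_theorem_of_calculus)
    fix x :: real
    have "(arctan has_real_derivative 1 / (1 + x\<^sup>2)) (at x within {0..1})"
      by (auto intro!: derivative_eq_intros simp: field_simps)
    from has_vector_derivative_of_real[OF this]
    show "((\<lambda>x. complex_of_real (arctan x)) has_vector_derivative of_real (1 / (1 + x\<^sup>2))) (at x within {0..1})" .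
  qed simp
  then have "integral {0..1} (\<lambda>s::real. complex_of_real (1 / (1 + s\<^sup>2))) = of_real (pi / 4)"
    by (simp add: integral_unique arctan_one)
  moreover have "J 0 = integral {0..1} (\<lambda>s::real. complex_of_real (1 / (1 + s\<^sup>2)))"
    unfolding J_def by (intro integral_cong) (simp add: scaleR_conv_of_real divide_inverse)
  ultimately have J0: "J 0 = of_real (pi / 4)" by simp
  \<comment> \<open>After \<open>cis (T\<^sup>2)\<close> is taken out, a Fresnel integrand of
    frequency \<open>T\<^sup>2\<close> remains, against the decreasing weight
    \<open>1 / (1 + s\<^sup>2)\<close>.\<close>
  have "norm (J T) \<le> 2 / T"
  proof -
    have "norm (integral {0..1} (\<lambda>s. of_real (1 / (1 + s\<^sup>2)) * cis (T\<^sup>2 * s\<^sup>2))) \<le> 2 / T * (1 / (1 + 0\<^sup>2))"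
    proof (rule norm_integral_decreasing_weight_le[where w = "\<lambda>s. 1 / (1 + s\<^sup>2)"
          and w' = "\<lambda>s. - 2 * s / (1 + s\<^sup>2)\<^sup>2" and f = "\<lambda>s. cis (T\<^sup>2 * s\<^sup>2)"])
      have pos: "1 + x\<^sup>2 \<noteq> (0::real)" for x :: real by (smt (verit) zero_le_power2)
      show "((\<lambda>s. 1 / (1 + s\<^sup>2)) has_real_derivative - 2 * x / (1 + x\<^sup>2)\<^sup>2) (at x)" for x :: real
        using pos by (auto intro!: derivative_eq_intros simp: power2_eq_square)
      show "continuous_on {0..1} (\<lambda>s::real. - 2 * s / (1 + s\<^sup>2)\<^sup>2)"
        using pos by (auto intro!: continuous_intros)
      show "norm (integral {0..q} (\<lambda>s. cis (T\<^sup>2 * s\<^sup>2))) \<le> 2 / T" if "q \<in> {0..1}" for q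
        using norm_integral_cis_square[of "T\<^sup>2" 0 q] T by simp
    qed (auto intro: continuous_intros)
    moreover have "J T = cis (T\<^sup>2) * integral {0..1} (\<lambda>s. of_real (1 / (1 + s\<^sup>2)) * cis (T\<^sup>2 * s\<^sup>2))"
      unfolding J_def integral_mult_right[symmetric]
      by (intro integral_cong) (simp add: cis_mult_Suc_arg scaleR_conv_of_real divide_inverse mult_ac)
    ultimately show ?thesis by (simp add: norm_mult)
  qed
  moreover have "(integral {0..T} (\<lambda>q. cis (q\<^sup>2)))\<^sup>2 - \<i> * of_real (pi / 4) = - (\<i> * J T)"
    using 1 J0 unfolding G_def power2_eq_square by (simp add: algebra_simps)
  ultimately show ?thesis by (simp add: norm_mult)
qed

text \<open>Only the square of the limit is known from the identity, so only its modulus is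
  computed; \<open>\<phi>\<close> is an unspecified argument of the limit.\<close>

lemma Fresnel_limit:
  "\<exists>\<phi>. ((\<lambda>Q. integral {0..Q} (\<lambda>q. cis (q\<^sup>2))) \<longlongrightarrow> of_real (sqrt pi / 2) * cis \<phi>) at_top"
proof -
  obtain L where L: "((\<lambda>Q. integral {0..Q} (\<lambda>q. cis (q\<^sup>2))) \<longlongrightarrow> L) at_top"
    using Fresnel_limit_exists by blast
  have "((\<lambda>T. 2 / T) \<longlongrightarrow> (0::real)) at_top" by real_asymp
  then have "((\<lambda>T. (integral {0..T} (\<lambda>q. cis (q\<^sup>2)))\<^sup>2 - \<i> * of_real (pi / 4)) \<longlongrightarrow> 0) at_top"
    by (rule Lim_null_comparison[rotated])
      (use Fresnel_square_identity in \<open>auto intro!: eventually_mono[OF eventually_gt_at_top[of 0]]\<close>)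
  moreover have "((\<lambda>T. (integral {0..T} (\<lambda>q. cis (q\<^sup>2)))\<^sup>2 - \<i> * of_real (pi / 4)) \<longlongrightarrow>
      L\<^sup>2 - \<i> * of_real (pi / 4)) at_top"
    by (intro tendsto_intros L)
  ultimately have "L\<^sup>2 - \<i> * of_real (pi / 4) = 0"
    using tendsto_unique trivial_limit_at_top_linorder by blast
  then have "L\<^sup>2 = \<i> * of_real (pi / 4)" by (simp only: right_minus_eq)
  then have "norm (L\<^sup>2) = norm (\<i> * complex_of_real (pi / 4))" by (rule arg_cong)
  then have "norm (L\<^sup>2) = pi / 4" by (simp add: norm_mult)
  then have "norm L = sqrt pi / 2"
    using real_sqrt_unique[of "norm L" "pi / 4"] by (simp add: norm_power real_sqrt_divide)
  moreover have "L = of_real (norm L) * cis (Arg L)"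
    using rcis_cmod_Arg[of L] by (simp add: rcis_def)
  ultimately have "L = of_real (sqrt pi / 2) * cis (Arg L)" by metis
  then show ?thesis using L by metis
qed

section \<open>The kernel of the Voronoi series\<close>

lemma has_derivative_inverse_sqrt_1_plus_square:
  fixes q :: real
  shows "((\<lambda>q. 1 / sqrt (1 + q\<^sup>2)) has_real_derivative - (q / (sqrt (1 + q\<^sup>2)) ^ 3)) (at q within S)"
proof -
  have pos: "1 + q\<^sup>2 > (0::real)" by (smt (verit) zero_le_power2)
  have "(sqrt (1 + q\<^sup>2)) ^ 3 = (1 + q\<^sup>2) * sqrt (1 + q\<^sup>2)"
    using pos by (simp add: power3_eq_cube)
  then show ?thesis using pos
    by (auto intro!: derivative_eq_intros simp: field_simps)
qed

lemma sqrt_1_plus_square_pos [simp]: "sqrt (1 + q\<^sup>2) > 0" "1 + q\<^sup>2 \<noteq> (0::real)" "0 < 1 + q\<^sup>2"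
  by (smt (verit) zero_le_power2 real_sqrt_gt_0_iff)+

lemma sqrt_1_plus_square_ge: "1 \<le> sqrt (1 + q\<^sup>2)" "q \<le> sqrt (1 + q\<^sup>2)"
  by (auto intro: real_le_rsqrt)

text \<open>The image of the integral of \<open>cis (z * cosh y)\<close> under q = sinh (y/2), apart
  from the factor \<open>2 * cis z\<close>: there cosh y = 1 + 2 q^2 and dy = 2 dq / sqrt (1 +
  q^2).\<close>

definition fresnel_kernel_integral :: "real \<Rightarrow> real \<Rightarrow> complex" where
  "fresnel_kernel_integral z Q = integral {0..Q} (\<lambda>q. of_real (1 / sqrt (1 + q\<^sup>2)) * cis (2 * z * q\<^sup>2))"

lemma fresnel_kernel_tail:
  assumes z: "z > 0" and "0 \<le> a" "a \<le> b"
  shows "norm (integral {a..b} (\<lambda>q. of_real (1 / sqrt (1 + q\<^sup>2)) * cis (2 * z * q\<^sup>2)))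
    \<le> 2 / sqrt (2 * z) * (1 / sqrt (1 + a\<^sup>2))"
proof (rule norm_integral_decreasing_weight_le[where f = "\<lambda>q. cis (2 * z * q\<^sup>2)"
      and w = "\<lambda>q. 1 / sqrt (1 + q\<^sup>2)" and w' = "\<lambda>q. - (q / (sqrt (1 + q\<^sup>2)) ^ 3)"])
  show "continuous_on {a..b} (\<lambda>q. - (q / (sqrt (1 + q\<^sup>2)) ^ 3))"
    using sqrt_1_plus_square_pos(1) by (auto intro!: continuous_intros simp: less_imp_neq[symmetric])
  show "- (x / sqrt (1 + x\<^sup>2) ^ 3) \<le> 0" if "x \<in> {a..b}" for x
    using that assms by simp
  show "norm (integral {a..q} (\<lambda>q. cis (2 * z * q\<^sup>2))) \<le> 2 / sqrt (2 * z)" if "q \<in> {a..b}" for q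
    using norm_integral_cis_square[of "2 * z" a q] assms by simp
qed (use assms in \<open>auto intro!: has_derivative_inverse_sqrt_1_plus_square continuous_intros\<close>)

lemma continuous_on_fresnel_kernel:
  "continuous_on S (\<lambda>q. of_real (1 / sqrt (1 + q\<^sup>2)) * cis (2 * z * q\<^sup>2))"
  by (intro continuous_intros) auto

lemma fresnel_kernel_limit_exists:
  assumes z: "z > 0"
  shows "\<exists>L. (fresnel_kernel_integral z \<longlongrightarrow> L) at_top"
proof (rule convergent_at_top_Cauchy)
  fix e :: real assume e: "e > 0"
  define C where "C = 2 / sqrt (2 * z)"
  have C: "C > 0" using z by (simp add: C_def)
  show "\<exists>P. \<forall>x\<ge>P. \<forall>y\<ge>x. norm (fresnel_kernel_integral z y - fresnel_kernel_integral z x) < e"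
  proof (intro exI[of _ "C / e + 1"] allI impI)
    fix x y assume xy: "C / e + 1 \<le> x" "x \<le> y"
    have x: "x > 0" using xy e C by (smt (verit) divide_pos_pos)
    let ?f = "\<lambda>q. of_real (1 / sqrt (1 + q\<^sup>2)) * cis (2 * z * q\<^sup>2)"
    have eq: "integral {0..y} ?f = integral {0..x} ?f + integral {x..y} ?f"
      using x xy by (intro Henstock_Kurzweil_Integration.integral_combine[symmetric]
          integrable_continuous_real continuous_on_fresnel_kernel) auto
    have "norm (fresnel_kernel_integral z y - fresnel_kernel_integral z x) = norm (integral {x..y} ?f)"
      unfolding fresnel_kernel_integral_def eq add_diff_cancel_left' ..
    also have "\<dots> \<le> C * (1 / sqrt (1 + x\<^sup>2))"
      unfolding C_def using fresnel_kernel_tail[OF z, of x y] x xy by simp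
    also have "\<dots> \<le> C * (1 / x)"
      using sqrt_1_plus_square_ge[of x] x C by (intro mult_left_mono divide_left_mono mult_pos_pos) auto
    also have "\<dots> < e" using xy x e C by (simp add: field_simps)
    finally show "norm (fresnel_kernel_integral z y - fresnel_kernel_integral z x) < e" .
  qed
qed

text \<open>With \<open>s = sqrt (1 + q\<^sup>2)\<close> and \<open>k = (1/s - 1)/q\<close>, the derivative of \<open>k\<close> splits into the two
  monotone pieces \<open>1/(s(1+s))\<close> and \<open>1/s\<^sup>3\<close>, each of which costs only a factor \<open>O(1/sqrt z)\<close>.\<close>

lemma fresnel_kernel_approx:
  assumes z: "z > 0" and Q: "Q \<ge> 0"
  shows "norm (fresnel_kernel_integral z Q - integral {0..Q} (\<lambda>q. cis (2 * z * q\<^sup>2)))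
    \<le> 1 / (4 * z) * (1 / (1 + Q) + 3 / sqrt (2 * z))"
proof -
  let ?s = "\<lambda>q::real. sqrt (1 + q\<^sup>2)"
  let ?e = "\<lambda>q. cis (2 * z * q\<^sup>2)"
  define k where "k = (\<lambda>q. - q / (?s q + (?s q)\<^sup>2))"
  define w1 where "w1 = (\<lambda>q. 1 / (?s q * (1 + ?s q)))"
  define w2 where "w2 = (\<lambda>q. 1 / (?s q) ^ 3)"
  note [simp] = less_imp_neq[OF sqrt_1_plus_square_pos(1), symmetric]
  have [simp]: "1 + ?s q \<noteq> 0" "1 + ?s q > 0" for q using sqrt_1_plus_square_pos(1)[of q] by linarith+
  have ds: "(?s has_real_derivative q / ?s q) (at q within S)" for q S
    by (auto intro!: derivative_eq_intros simp: divide_simps) (smt (verit) zero_le_power2)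
  have s2: "(?s q)\<^sup>2 = 1 + q\<^sup>2" for q by simp
  have dk: "(k has_real_derivative (w1 q - w2 q)) (at q within S)" for q S
  proof -
    define s where "s = ?s q"
    have s: "s > 0" by (simp add: s_def)
    have q: "q * q = s * s - 1" unfolding s_def using s2[of q] by (simp add: power2_eq_square)
    have nz: "s + s\<^sup>2 \<noteq> 0" using s by (smt (verit) zero_less_power)
    have nz': "1 + s \<noteq> 0" using s by simp
    have "(k has_real_derivative ((-1) * (s + s\<^sup>2) - (- q) * (q / s + 2 * s * (q / s))) / (s + s\<^sup>2)\<^sup>2) (at q within S)"
    proof -
      have "((\<lambda>q. ?s q + (?s q)\<^sup>2) has_real_derivative (q / s + 2 * s * (q / s))) (at q within S)"
        unfolding s_def by (rule derivative_eq_intros ds refl | simp)+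
      from DERIV_divide[OF DERIV_minus[OF DERIV_ident] this nz[unfolded s_def]]
      show ?thesis unfolding k_def by (simp add: s_def power2_eq_square)
    qed
    also have "((-1) * (s + s\<^sup>2) - (- q) * (q / s + 2 * s * (q / s))) = - (s + s\<^sup>2) + (q * q) * (1 / s + 2)"
      using s by (simp add: field_simps)
    also have "(- (s + s\<^sup>2) + (q * q) * (1 / s + 2)) / (s + s\<^sup>2)\<^sup>2 = 1 / (s * (1 + s)) - 1 / s ^ 3"
      unfolding q using s nz nz' by (simp add: divide_simps) (simp add: algebra_simps power2_eq_square power3_eq_cube)
    finally show ?thesis by (simp add: w1_def w2_def s_def)
  qed
  have kq: "k q * q = 1 / ?s q - 1" for q
  proof -
    define s where "s = ?s q"
    have s: "s > 0" by (simp add: s_def)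
    have q: "q * q = (s - 1) * (1 + s)"
      using s2[of q] unfolding s_def[symmetric] by (simp add: algebra_simps power2_eq_square)
    have "k q * q = - ((q * q) / (s * (1 + s)))"
      unfolding k_def s_def by (simp add: algebra_simps power2_eq_square)
    also have "\<dots> = - ((s - 1) / s)" unfolding q using s by simp
    also have "\<dots> = 1 / s - 1" using s by (simp add: diff_divide_distrib)
    finally show ?thesis by (simp add: s_def)
  qed
  have ck: "continuous_on {0..Q} w1" "continuous_on {0..Q} w2"
    unfolding w1_def w2_def by (auto intro!: continuous_intros)
  \<comment> \<open>Because \<open>k q * q = 1 / ?s q - 1\<close>, differentiating the exponential
    here yields exactly the integrand of the difference \<open>D\<close> to be estimated, multiplied
    by \<open>4 * \<i> * z\<close>. The division by \<open>4 * z\<close> at the end is the gain over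
    the trivial estimate.\<close>
  have "((\<lambda>q. of_real (k q) * ?e q) has_vector_derivative
      of_real (k q) * (4 * \<i> * of_real z * of_real q * ?e q) + of_real (w1 q - w2 q) * ?e q) (at q within S)" for q S
  proof (intro has_vector_derivative_mult has_vector_derivative_of_real dk)
    have "((\<lambda>q. exp (\<i> * of_real (2 * z) * q\<^sup>2)) has_field_derivative
            4 * \<i> * of_real z * q * exp (\<i> * of_real (2 * z) * q\<^sup>2)) (at q within T)" for q :: complex and T
      by (rule derivative_eq_intros refl | simp add: algebra_simps power2_eq_square)+
    from has_vector_derivative_real_field[OF this[of "of_real q" UNIV], of S]
    show "(?e has_vector_derivative 4 * \<i> * of_real z * of_real q * ?e q) (at q within S)"
      by (simp add: cis_conv_exp mult_ac)
  qed
  then have "((\<lambda>q. of_real (k q) * (4 * \<i> * of_real z * of_real q * ?e q) + of_real (w1 q - w2 q) * ?e q)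
      has_integral (of_real (k Q) * ?e Q - of_real (k 0) * ?e 0)) {0..Q}"
    using Q by (intro fundamental_theorem_of_calculus) auto
  moreover have "of_real (k q) * (4 * \<i> * of_real z * of_real q * ?e q) + of_real (w1 q - w2 q) * ?e q =
      4 * \<i> * of_real z * (of_real (1 / ?s q) * ?e q - ?e q) + (of_real (w1 q) * ?e q - of_real (w2 q) * ?e q)" for q
  proof -
    have "of_real (k q) * (4 * \<i> * of_real z * of_real q * ?e q) = 4 * \<i> * of_real z * (of_real (k q * q) * ?e q)"
      by (simp add: mult_ac)
    then show ?thesis unfolding kq by (simp add: algebra_simps)
  qed
  ultimately have hi: "((\<lambda>q. 4 * \<i> * of_real z * (of_real (1 / ?s q) * ?e q - ?e q) +
      (of_real (w1 q) * ?e q - of_real (w2 q) * ?e q)) has_integral (of_real (k Q) * ?e Q)) {0..Q}"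
    by (simp add: k_def)
  define I1 where "I1 = integral {0..Q} (\<lambda>q. of_real (w1 q) * ?e q)"
  define I2 where "I2 = integral {0..Q} (\<lambda>q. of_real (w2 q) * ?e q)"
  define D where "D = fresnel_kernel_integral z Q - integral {0..Q} (\<lambda>q. cis (2 * z * q\<^sup>2))"
  have i: "(\<lambda>q. of_real (w1 q) * ?e q) integrable_on {0..Q}" "(\<lambda>q. of_real (w2 q) * ?e q) integrable_on {0..Q}"
    "?e integrable_on {0..Q}" "(\<lambda>q. of_real (1 / ?s q) * ?e q) integrable_on {0..Q}"
    by (auto intro!: integrable_continuous_real continuous_intros ck)
  have hj: "((\<lambda>q. 4 * \<i> * of_real z * (of_real (1 / ?s q) * ?e q - ?e q) +
      (of_real (w1 q) * ?e q - of_real (w2 q) * ?e q)) has_integral (4 * \<i> * of_real z * D + (I1 - I2))) {0..Q}"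
    unfolding D_def I1_def I2_def fresnel_kernel_integral_def
    by (intro has_integral_add has_integral_mult_right has_integral_diff integrable_integral i)
  have eq: "4 * \<i> * of_real z * D = of_real (k Q) * ?e Q - (I1 - I2)"
    unfolding eq_diff_eq by (rule has_integral_unique[OF hj hi])
  have smono: "?s x \<ge> 1" for x by (rule sqrt_1_plus_square_ge)
  have M: "norm (integral {0..q} ?e) \<le> 2 / sqrt (2 * z)" for q
    using norm_integral_cis_square[of "2 * z" 0 q] z by simp
  have I1: "norm I1 \<le> 2 / sqrt (2 * z) * w1 0" unfolding I1_def
  proof (rule norm_integral_decreasing_weight_le[where
        w' = "\<lambda>q. - (q / ?s q * (1 + ?s q) + q / ?s q * ?s q) / (?s q * (1 + ?s q))\<^sup>2"])
    show "(w1 has_real_derivative - (x / ?s x * (1 + ?s x) + x / ?s x * ?s x) / (?s x * (1 + ?s x))\<^sup>2) (at x)" for x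
    proof -
      have "((\<lambda>x. ?s x * (1 + ?s x)) has_real_derivative (x / ?s x * (1 + ?s x) + x / ?s x * ?s x)) (at x)"
        by (rule derivative_eq_intros ds refl | simp)+
      moreover have "?s x * (1 + ?s x) \<noteq> 0" by simp
      ultimately show ?thesis
        using DERIV_divide[OF DERIV_const, of "\<lambda>x. ?s x * (1 + ?s x)" "x / ?s x * (1 + ?s x) + x / ?s x * ?s x" x UNIV 1]
        by (simp add: w1_def power2_eq_square)
    qed
    show "- (x / ?s x * (1 + ?s x) + x / ?s x * ?s x) / (?s x * (1 + ?s x))\<^sup>2 \<le> 0" if "x \<in> {0..Q}" for x
    proof -
      have "0 \<le> x / ?s x * (1 + ?s x) + x / ?s x * ?s x"
        using that smono[of x] by (intro add_nonneg_nonneg mult_nonneg_nonneg divide_nonneg_nonneg) auto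
      then show ?thesis by (intro divide_nonpos_nonneg) (simp_all only: neg_le_0_iff_le zero_le_power2)
    qed
    show "w1 Q \<ge> 0" using smono[of Q] by (simp add: w1_def)
  qed (use M Q in \<open>auto intro!: continuous_intros\<close>)
  have I2: "norm I2 \<le> 2 / sqrt (2 * z) * w2 0" unfolding I2_def
  proof (rule norm_integral_decreasing_weight_le[where
        w' = "\<lambda>q. - (3 * (?s q)\<^sup>2 * (q / ?s q)) / (?s q ^ 3)\<^sup>2"])
    show "(w2 has_real_derivative - (3 * (?s x)\<^sup>2 * (x / ?s x)) / (?s x ^ 3)\<^sup>2) (at x)" for x
    proof -
      have "((\<lambda>x. ?s x ^ 3) has_real_derivative 3 * (?s x)\<^sup>2 * (x / ?s x)) (at x)"
        using DERIV_power[OF ds[of x UNIV], of 3] by (simp add: mult_ac)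
      moreover have "?s x ^ 3 \<noteq> 0" by simp
      ultimately show ?thesis
        using DERIV_divide[OF DERIV_const, of "\<lambda>x. ?s x ^ 3" "3 * (?s x)\<^sup>2 * (x / ?s x)" x UNIV 1]
        by (simp add: w2_def power2_eq_square)
    qed
    show "- (3 * (?s x)\<^sup>2 * (x / ?s x)) / (?s x ^ 3)\<^sup>2 \<le> 0" if "x \<in> {0..Q}" for x
    proof -
      have "0 \<le> 3 * (?s x)\<^sup>2 * (x / ?s x)"
        using that smono[of x] by (intro mult_nonneg_nonneg divide_nonneg_nonneg) auto
      then show ?thesis by (intro divide_nonpos_nonneg) (simp_all only: neg_le_0_iff_le zero_le_power2)
    qed
    show "w2 Q \<ge> 0" using smono[of Q] by (simp add: w2_def)
  qed (use M Q in \<open>auto intro!: continuous_intros\<close>)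
  have kQ: "norm (of_real (k Q) * ?e Q) \<le> 1 / (1 + Q)"
  proof -
    have "\<bar>k Q\<bar> = Q / (?s Q * (1 + ?s Q))"
      using Q smono[of Q] by (simp add: k_def abs_divide power2_eq_square algebra_simps)
    also have "\<dots> \<le> ?s Q / (?s Q * (1 + ?s Q))"
      using sqrt_1_plus_square_ge[of Q] by (intro divide_right_mono) auto
    also have "\<dots> = 1 / (1 + ?s Q)" by simp
    also have "\<dots> \<le> 1 / (1 + Q)" using Q sqrt_1_plus_square_ge[of Q] by (intro divide_left_mono) auto
    finally show ?thesis by (simp add: norm_mult)
  qed
  have "4 * z * norm D = norm (4 * \<i> * of_real z * D)" using z by (simp add: norm_mult)
  also have "\<dots> \<le> 1 / (1 + Q) + (2 / sqrt (2 * z) * w1 0 + 2 / sqrt (2 * z) * w2 0)"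
    unfolding eq using kQ I1 I2 by (smt (verit) norm_triangle_ineq4)
  also have "\<dots> = 1 / (1 + Q) + 3 / sqrt (2 * z)" by (simp add: w1_def w2_def)
  finally have "norm D \<le> (1 / (1 + Q) + 3 / sqrt (2 * z)) / (4 * z)"
    using z by (subst pos_le_divide_eq) (auto simp: mult_ac)
  then show ?thesis unfolding D_def by simp
qed


section \<open>Oscillatory integrals with phases z cosh y and z sinh y\<close>

lemma Re_integral_real:
  fixes f :: "real \<Rightarrow> complex"
  shows "f integrable_on S \<Longrightarrow> Re (integral S f) = integral S (\<lambda>x. Re (f x))"
  using has_integral_Re[OF integrable_integral] by (metis integral_unique)

lemma integral_cos_cosh_eq:
  fixes z Y :: real
  assumes Y: "Y \<ge> 0"
  shows "integral {0..Y} (\<lambda>y. cos (z * cosh y)) = Re (2 * cis z * fresnel_kernel_integral z (sinh (Y / 2)))"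
proof -
  define h where "h = (\<lambda>q. 2 * (cis z * (of_real (1 / sqrt (1 + q\<^sup>2)) * cis (2 * z * q\<^sup>2))))"
  have ch: "continuous_on S h" for S
    unfolding h_def by (intro continuous_intros) auto
  have "((\<lambda>y. (cosh (y / 2) / 2) *\<^sub>R h (sinh (y / 2))) has_integral integral {sinh (0 / 2)..sinh (Y / 2)} h) {0..Y}"
  proof (rule has_integral_substitution[where c = 0 and d = "sinh (Y / 2)"])
    show "(\<lambda>y. sinh (y / 2)) ` {0..Y} \<subseteq> {0..sinh (Y / 2)}"
      using Y by auto
  qed (use Y in \<open>auto intro!: ch derivative_eq_intros\<close>)
  then have 1: "((\<lambda>y. (cosh (y / 2) / 2) *\<^sub>R h (sinh (y / 2))) has_integral integral {0..sinh (Y / 2)} h) {0..Y}"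
    by simp
  have 2: "(cosh (y / 2) / 2) *\<^sub>R h (sinh (y / 2)) = cis (z * cosh y)" for y
  proof -
    have "cosh (y / 2) ^ 2 = 1 + sinh (y / 2) ^ 2" by (simp add: cosh_square_eq)
    then have s: "sqrt (1 + sinh (y / 2) ^ 2) = cosh (y / 2)"
      using real_sqrt_unique[of "cosh (y / 2)" "1 + sinh (y / 2) ^ 2"] by simp
    have "cosh y = 1 + 2 * sinh (y / 2) ^ 2"
      using cosh_double[of "y / 2"] by (simp add: cosh_square_eq)
    then have "cis (z * cosh y) = cis z * cis (2 * z * sinh (y / 2) ^ 2)"
      by (simp add: cis_mult algebra_simps)
    then show ?thesis by (simp add: h_def s scaleR_conv_of_real)
  qed
  have "integral {0..Y} (\<lambda>y. cis (z * cosh y)) = integral {0..sinh (Y / 2)} h"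
    using 1 unfolding 2 by (rule integral_unique)
  also have "\<dots> = 2 * cis z * fresnel_kernel_integral z (sinh (Y / 2))"
    unfolding h_def fresnel_kernel_integral_def integral_mult_right mult.assoc ..
  finally have 3: "integral {0..Y} (\<lambda>y. cis (z * cosh y)) = 2 * cis z * fresnel_kernel_integral z (sinh (Y / 2))" .
  have "(\<lambda>y. cis (z * cosh y)) integrable_on {0..Y}" using 1 unfolding 2 by (rule has_integral_integrable)
  from Re_integral_real[OF this] show ?thesis unfolding 3 by simp
qed

text \<open>The phase z sinh y has no stationary point, so two integrations by parts, each dividing
  by z cosh y, gain two powers of z. The first boundary term vanishes at 0 and dies as Y grows; the
  5 is 1 from the second boundary term and 4 from the last integral, which is compared with the
  derivative of tanh.\<close>

lemma integral_cos_sinh_bound: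
  fixes z Y :: real
  assumes z: "z > 0" and Y: "Y \<ge> 0"
  shows "\<bar>integral {0..Y} (\<lambda>y. cos (z * sinh y))\<bar> \<le> 1 / (z * cosh Y) + 5 / z\<^sup>2"
proof -
  have c0: "cosh y \<noteq> 0" "cosh y > 0" for y :: real
    using cosh_real_pos[of y] by auto
  define A where "A = (\<lambda>y. sin (z * sinh y) * sinh y / (cosh y)\<^sup>2)"
  define B where "B = (\<lambda>y. cos (z * sinh y) * (1 / (cosh y)\<^sup>2 - 3 * (sinh y)\<^sup>2 / (cosh y) ^ 4))"
  have cont: "continuous_on S (\<lambda>y. cos (z * sinh y))" "continuous_on S A" "continuous_on S B" for S
    unfolding A_def B_def using c0 by (auto intro!: continuous_intros)
  note int = cont[THEN integrable_continuous_real]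
  have "((\<lambda>y. cos (z * sinh y) - A y / z) has_integral
     (sin (z * sinh Y) / (z * cosh Y) - sin (z * sinh 0) / (z * cosh 0))) {0..Y}"
  proof (intro fundamental_theorem_of_calculus Y)
    fix y
    have "((\<lambda>y. sin (z * sinh y) / (z * cosh y)) has_real_derivative (cos (z * sinh y) - A y / z)) (at y within {0..Y})"
      unfolding A_def using c0[of y] z
      by (auto intro!: derivative_eq_intros simp: divide_simps power2_eq_square) (simp add: algebra_simps)
    then show "((\<lambda>y. sin (z * sinh y) / (z * cosh y)) has_vector_derivative (cos (z * sinh y) - A y / z)) (at y within {0..Y})"
      by (simp add: has_real_derivative_iff_has_vector_derivative)
  qed
  then have h1: "((\<lambda>y. cos (z * sinh y) - A y / z) has_integral sin (z * sinh Y) / (z * cosh Y)) {0..Y}"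
    by simp
  have h2: "((\<lambda>y. cos (z * sinh y) - A y / z) has_integral
      (integral {0..Y} (\<lambda>y. cos (z * sinh y)) - integral {0..Y} A / z)) {0..Y}"
    by (intro has_integral_diff has_integral_divide integrable_integral int)
  from has_integral_unique[OF h1 h2] have 1: "integral {0..Y} (\<lambda>y. cos (z * sinh y)) =
      sin (z * sinh Y) / (z * cosh Y) + integral {0..Y} A / z"
    by linarith
  have "((\<lambda>y. A y - B y / z) has_integral
     (- cos (z * sinh Y) * sinh Y / (z * cosh Y ^ 3) - (- cos (z * sinh 0) * sinh 0 / (z * cosh 0 ^ 3)))) {0..Y}"
  proof (intro fundamental_theorem_of_calculus Y)
    fix y
    have "((\<lambda>y. - cos (z * sinh y) * sinh y / (z * cosh y ^ 3)) has_real_derivative (A y - B y / z)) (at y within {0..Y})"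
      unfolding A_def B_def using c0[of y] z
      by (auto intro!: derivative_eq_intros simp: divide_simps)
        (simp add: algebra_simps eval_nat_numeral)
    then show "((\<lambda>y. - cos (z * sinh y) * sinh y / (z * cosh y ^ 3)) has_vector_derivative (A y - B y / z)) (at y within {0..Y})"
      by (simp add: has_real_derivative_iff_has_vector_derivative)
  qed
  then have h3: "((\<lambda>y. A y - B y / z) has_integral (- cos (z * sinh Y) * sinh Y / (z * cosh Y ^ 3))) {0..Y}"
    by simp
  have h4: "((\<lambda>y. A y - B y / z) has_integral (integral {0..Y} A - integral {0..Y} B / z)) {0..Y}"
    by (intro has_integral_diff has_integral_divide integrable_integral int)
  from has_integral_unique[OF h3 h4] have 2: "integral {0..Y} A =
      - cos (z * sinh Y) * sinh Y / (z * cosh Y ^ 3) + integral {0..Y} B / z"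
    by linarith
  have tanh: "((\<lambda>y. 1 / (cosh y)\<^sup>2) has_integral (tanh Y - tanh 0)) {0..Y}"
  proof (intro fundamental_theorem_of_calculus Y)
    fix y :: real
    have "1 - tanh y ^ 2 = 1 / (cosh y)\<^sup>2"
      using c0[of y] cosh_square_eq[of y] by (simp add: tanh_def power_divide field_simps)
    then have "(tanh has_real_derivative 1 / (cosh y)\<^sup>2) (at y within {0..Y})"
      using c0[of y] by (auto intro!: derivative_eq_intros)
    then show "(tanh has_vector_derivative 1 / (cosh y)\<^sup>2) (at y within {0..Y})"
      by (simp add: has_real_derivative_iff_has_vector_derivative)
  qed
  have sc: "\<bar>sinh y\<bar> \<le> cosh y" for y :: real
    using cosh_square_eq[of y] c0[of y] by (simp add: abs_le_square_iff[of "sinh y" "cosh y", simplified])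
  have "norm (integral {0..Y} B) \<le> integral {0..Y} (\<lambda>y. 4 * (1 / (cosh y)\<^sup>2))"
  proof (rule integral_norm_bound_integral)
    show "(\<lambda>y. 4 * (1 / (cosh y)\<^sup>2)) integrable_on {0..Y}"
      using has_integral_mult_right[OF tanh] by (rule has_integral_integrable)
    fix y :: real
    have "(sinh y)\<^sup>2 / (cosh y)^4 \<le> (cosh y)\<^sup>2 / (cosh y) ^ 4"
      using sc[of y] c0[of y] by (intro divide_right_mono) (auto simp: abs_le_square_iff[symmetric])
    also have "\<dots> = 1 / (cosh y)\<^sup>2" using c0[of y] by (simp add: field_simps flip: power_add)
    finally have "(sinh y)\<^sup>2 / (cosh y)^4 \<le> 1 / (cosh y)\<^sup>2" .
    moreover have "(sinh y)\<^sup>2 / (cosh y)^4 \<ge> 0" by simp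
    moreover have "3 * (sinh y)\<^sup>2 / (cosh y) ^ 4 = 3 * ((sinh y)\<^sup>2 / (cosh y) ^ 4)" by simp
    ultimately have *: "\<bar>1 / (cosh y)\<^sup>2 - 3 * (sinh y)\<^sup>2 / (cosh y) ^ 4\<bar> \<le> 4 * (1 / (cosh y)\<^sup>2)"
      unfolding abs_le_iff by linarith
    have "norm (B y) = \<bar>cos (z * sinh y)\<bar> * \<bar>1 / (cosh y)\<^sup>2 - 3 * (sinh y)\<^sup>2 / (cosh y) ^ 4\<bar>"
      unfolding B_def real_norm_def abs_mult ..
    also have "\<dots> \<le> 1 * (4 * (1 / (cosh y)\<^sup>2))"
      using * by (intro mult_mono) auto
    finally show "norm (B y) \<le> 4 * (1 / (cosh y)\<^sup>2)" by simp
  qed (use int in auto)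
  also have "\<dots> = 4 * (tanh Y - tanh 0)"
    by (rule integral_unique, rule has_integral_mult_right[OF tanh])
  also have "\<dots> \<le> 4" using tanh_real_lt_1[of Y] by simp
  finally have B: "\<bar>integral {0..Y} B\<bar> \<le> 4" by simp
  have c1: "cosh Y \<ge> 1" by (rule cosh_real_ge_1)
  have "\<bar>- cos (z * sinh Y) * sinh Y / (z * cosh Y ^ 3)\<bar> = \<bar>cos (z * sinh Y)\<bar> * (\<bar>sinh Y\<bar> / (z * cosh Y ^ 3))"
    using z c0[of Y] by (simp add: abs_mult)
  also have "\<dots> \<le> 1 * (cosh Y / (z * cosh Y ^ 1))"
  proof (intro mult_mono)
    show "\<bar>sinh Y\<bar> / (z * cosh Y ^ 3) \<le> cosh Y / (z * cosh Y ^ 1)"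
      using sc[of Y] c0[of Y] z c1 by (intro frac_le mult_left_mono power_increasing mult_pos_pos) auto
  qed (use z c0 in auto)
  also have "\<dots> = 1 / z" using c0[of Y] by simp
  finally have B1: "\<bar>- cos (z * sinh Y) * sinh Y / (z * cosh Y ^ 3)\<bar> \<le> 1 / z" .
  have B2: "\<bar>integral {0..Y} B / z\<bar> \<le> 4 / z"
    using z B by (simp add: abs_divide divide_right_mono)
  have "\<bar>integral {0..Y} A\<bar> \<le> 1 / z + 4 / z"
    unfolding 2 by (rule order_trans[OF abs_triangle_ineq add_mono[OF B1 B2]])
  then have "\<bar>integral {0..Y} A / z\<bar> \<le> 5 / z\<^sup>2"
    using z by (simp add: field_simps power2_eq_square)
  moreover have "\<bar>sin (z * sinh Y) / (z * cosh Y)\<bar> \<le> 1 / (z * cosh Y)"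
    using z c0[of Y] by (simp add: abs_mult divide_right_mono)
  ultimately show ?thesis unfolding 1 by linarith
qed

lemma of_real_sinh_cosh:
  "complex_of_real (sinh y) = sinh (of_real y)" "complex_of_real (cosh y) = cosh (of_real y)"
  by (simp_all add: sinh_def cosh_def scaleR_conv_of_real exp_of_real[symmetric] exp_minus)

text \<open>One division by the derivative of the phase: \<open>cosh y * cis (z * sinh y)\<close>
  has primitives with increments bounded by \<open>2 / z\<close>, and \<open>1 / cosh y\<close> is
  decreasing. The decay in \<open>x\<close> is what proves convergence of the improper
  integral.\<close>

lemma integral_cos_sinh_tail_Cauchy:
  fixes z x Y :: real
  assumes z: "z > 0" and x: "0 \<le> x" "x \<le> Y"
  shows "\<bar>integral {x..Y} (\<lambda>y. cos (z * sinh y))\<bar> \<le> 2 / (z * cosh x)"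
proof -
  have c0: "cosh y \<noteq> 0" "cosh y > 0" for y :: real
    using cosh_real_pos[of y] by auto
  define f where "f = (\<lambda>y. complex_of_real (cosh y) * cis (z * sinh y))"
  have cf: "continuous_on S f" for S
    unfolding f_def cis_conv_exp by (intro continuous_intros)
  have M: "norm (integral {x..q} f) \<le> 2 / z" if "q \<in> {x..Y}" for q
  proof -
    have "((\<lambda>y. cis (z * sinh y) / (\<i> * of_real z)) has_vector_derivative f y) (at y within {x..q})" for y
    proof -
      have "((\<lambda>q. exp (\<i> * of_real z * sinh q) / (\<i> * of_real z)) has_field_derivative
              cosh q * exp (\<i> * of_real z * sinh q)) (at q within T)" for q :: complex and T
        using z by (auto intro!: derivative_eq_intros)
      from has_vector_derivative_real_field[OF this[of "of_real y" UNIV], of "{x..q}"]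
      show ?thesis
        by (simp add: f_def cis_conv_exp mult_ac of_real_sinh_cosh)
    qed
    then have "(f has_integral (cis (z * sinh q) / (\<i> * of_real z) - cis (z * sinh x) / (\<i> * of_real z))) {x..q}"
      using that by (intro fundamental_theorem_of_calculus) auto
    then have "integral {x..q} f = cis (z * sinh q) / (\<i> * of_real z) - cis (z * sinh x) / (\<i> * of_real z)"
      by (rule integral_unique)
    then have "norm (integral {x..q} f) \<le> norm (cis (z * sinh q) / (\<i> * of_real z)) + norm (cis (z * sinh x) / (\<i> * of_real z))"
      by (metis norm_triangle_ineq4)
    also have "\<dots> = 2 / z" using z by (simp add: norm_divide norm_mult)
    finally show ?thesis .
  qed
  have "norm (integral {x..Y} (\<lambda>y. of_real (1 / cosh y) * f y)) \<le> 2 / z * (1 / cosh x)"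
  proof (rule norm_integral_decreasing_weight_le[where w = "\<lambda>y. 1 / cosh y" and w' = "\<lambda>y. - (sinh y / (cosh y)\<^sup>2)"])
    show "((\<lambda>y. 1 / cosh y) has_real_derivative - (sinh u / (cosh u)\<^sup>2)) (at u)" for u
      using c0[of u] by (auto intro!: derivative_eq_intros simp: power2_eq_square)
    show "continuous_on {x..Y} (\<lambda>y. - (sinh y / (cosh y)\<^sup>2))"
      using c0 by (auto intro!: continuous_intros)
    show "- (sinh u / (cosh u)\<^sup>2) \<le> 0" if "u \<in> {x..Y}" for u
      using that x by simp
  qed (use x M cf in auto)
  moreover have "of_real (1 / cosh y) * f y = cis (z * sinh y)" for y
    using c0[of y] by (simp add: f_def)
  ultimately have 1: "norm (integral {x..Y} (\<lambda>y. cis (z * sinh y))) \<le> 2 / (z * cosh x)" by simp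
  have "(\<lambda>y. cis (z * sinh y)) integrable_on {x..Y}"
    unfolding cis_conv_exp by (intro integrable_continuous_real continuous_intros)
  from Re_integral_real[OF this] have "integral {x..Y} (\<lambda>y. cos (z * sinh y)) = Re (integral {x..Y} (\<lambda>y. cis (z * sinh y)))"
    by simp
  then show ?thesis using 1 abs_Re_le_cmod order_trans by metis
qed

section \<open>The kernel assembled from both hyperbolic phases\<close>

definition kernel_integrand :: "real \<Rightarrow> real \<Rightarrow> real" where
  "kernel_integrand z y = sin (z * exp y) * sin (z * exp (- y))"

definition half_kernel :: "real \<Rightarrow> real \<Rightarrow> real" where
  "half_kernel z Y = integral {0..Y} (kernel_integrand z)"

lemma continuous_on_kernel_integrand [continuous_intros]:
  "continuous_on S (kernel_integrand z)"
  unfolding kernel_integrand_def by (intro continuous_intros)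

lemma kernel_integrand_integrable: "kernel_integrand z integrable_on {a..b}"
  by (intro integrable_continuous_real continuous_intros)

text \<open>The product of sines is half of
  \<open>cos (2 * z * sinh y) - cos (2 * z * cosh y)\<close>. The sinh part has no stationary point
  and is negligible; the cosh part is stationary at y = 0 and carries the main term.\<close>

lemma half_kernel_eq:
  assumes "Y \<ge> 0"
  shows "half_kernel z Y = (integral {0..Y} (\<lambda>y. cos (2 * z * sinh y)) -
     Re (2 * cis (2 * z) * fresnel_kernel_integral (2 * z) (sinh (Y / 2)))) / 2"
proof -
  have "kernel_integrand z y = (cos (2 * z * sinh y) - cos (2 * z * cosh y)) / 2" for y
    by (simp add: kernel_integrand_def sin_times_sin sinh_def cosh_def algebra_simps)
  then have "half_kernel z Y = integral {0..Y} (\<lambda>y. (cos (2 * z * sinh y) - cos (2 * z * cosh y)) / 2)"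
    unfolding half_kernel_def by presburger
  also have "\<dots> = (integral {0..Y} (\<lambda>y. cos (2 * z * sinh y)) - integral {0..Y} (\<lambda>y. cos (2 * z * cosh y))) / 2"
    by (subst integral_divide, subst Henstock_Kurzweil_Integration.integral_diff)
      (auto intro!: integrable_continuous_real continuous_intros)
  finally show ?thesis using integral_cos_cosh_eq[OF assms, of "2 * z"] by simp
qed

lemma half_kernel_bound:
  assumes z: "z \<ge> 1" and Y: "Y \<ge> 0"
  shows "\<bar>half_kernel z Y\<bar> \<le> 2 / sqrt z"
proof -
  have "\<bar>Re (2 * cis (2 * z) * fresnel_kernel_integral (2 * z) (sinh (Y / 2)))\<bar> \<le> 2 * norm (fresnel_kernel_integral (2 * z) (sinh (Y / 2)))"
    using abs_Re_le_cmod[of "2 * cis (2 * z) * fresnel_kernel_integral (2 * z) (sinh (Y / 2))"] by (simp add: norm_mult)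
  also have "\<dots> \<le> 2 * (2 / sqrt (2 * (2 * z)))"
    using fresnel_kernel_tail[of "2 * z" 0 "sinh (Y / 2)"] z Y by (simp add: fresnel_kernel_integral_def)
  also have "sqrt (2 * (2 * z)) = 2 * sqrt z" using real_sqrt_mult[of 4 z] by simp
  finally have 1: "\<bar>Re (2 * cis (2 * z) * fresnel_kernel_integral (2 * z) (sinh (Y / 2)))\<bar> \<le> 2 / sqrt z" by simp
  have 2: "\<bar>integral {0..Y} (\<lambda>y. cos (2 * z * sinh y))\<bar> \<le> 1 / z"
    using integral_cos_sinh_tail_Cauchy[of "2 * z" 0 Y] z Y by simp
  have "sqrt z * 1 \<le> sqrt z * sqrt z" using z by (intro mult_left_mono) auto
  then have "sqrt z \<le> z" using z by simp
  then have "1 / z \<le> 1 / sqrt z" using z by (intro divide_left_mono) auto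
  then have 3: "1 / z \<le> 2 / sqrt z" using z by (smt (verit) divide_right_mono real_sqrt_ge_zero)
  show ?thesis unfolding half_kernel_eq[OF Y]
    using order_trans[OF abs_triangle_ineq4 add_mono[OF 2 1]] 3 by (simp add: abs_divide)
qed

lemma integral_kernel_integrand_neg: "integral {-Y..0} (kernel_integrand z) = half_kernel z Y"
proof -
  have "kernel_integrand z (- y) = kernel_integrand z y" for y
    by (simp add: kernel_integrand_def mult.commute)
  then show ?thesis
    using Henstock_Kurzweil_Integration.integral_reflect_real[of Y 0 "kernel_integrand z"] by (simp add: half_kernel_def)
qed

lemma kernel_integral_split:
  assumes "a \<le> 0" "0 \<le> b"
  shows "integral {a..b} (kernel_integrand z) = half_kernel z (- a) + half_kernel z b"
  using Henstock_Kurzweil_Integration.integral_combine[of a 0 b "kernel_integrand z"] assms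
    integral_kernel_integrand_neg[of "- a" z]
  by (simp add: kernel_integrand_integrable half_kernel_def)

text \<open>Uniformity in both endpoints is essential, since they will depend on the cutoff
  \<open>Z\<close> and on the two frequencies. The integrand is even, so every interval reduces to
  at most two values of \<open>half_kernel\<close>.\<close>

lemma kernel_integral_bound:
  assumes z: "z \<ge> 1"
  shows "\<bar>integral {a..b} (kernel_integrand z)\<bar> \<le> 4 / sqrt z"
proof (cases "a \<le> b")
  case ab: True
  consider "0 \<le> a" | "b \<le> 0" | "a \<le> 0" "0 \<le> b" by linarith
  then show ?thesis
  proof cases
    case 1
    then have "half_kernel z a + integral {a..b} (kernel_integrand z) = half_kernel z b"
      unfolding half_kernel_def using ab
      by (intro Henstock_Kurzweil_Integration.integral_combine kernel_integrand_integrable) auto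
    then show ?thesis using half_kernel_bound[OF z, of a] half_kernel_bound[OF z, of b] 1 ab by auto
  next
    case 2
    then have "integral {a..b} (kernel_integrand z) + half_kernel z (- b) = half_kernel z (- a)"
      unfolding integral_kernel_integrand_neg[symmetric] using ab
      by (simp, intro Henstock_Kurzweil_Integration.integral_combine kernel_integrand_integrable) auto
    then show ?thesis using half_kernel_bound[OF z, of "- a"] half_kernel_bound[OF z, of "- b"] 2 ab by auto
  next
    case 3
    then show ?thesis using kernel_integral_split[OF 3, of z] half_kernel_bound[OF z, of "- a"] half_kernel_bound[OF z, of b]
      by auto
  qed
qed (use z in auto)

text \<open>By evenness, twice the half-line limit is the integral over the whole real line.
  Existence of the limit for \<open>z \<ge> 1\<close> is part of
  \<open>half_kernel_asymptotic\<close>.\<close>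

definition kernel_limit :: "real \<Rightarrow> real" where
  "kernel_limit z = 2 * Lim at_top (half_kernel z)"

text \<open>The phase is chosen once for all \<open>z\<close>: it is the argument of the Fresnel
  limit plus pi, the shift absorbing the minus sign of the cosh part. With frequency
  \<open>w = 2 * z\<close> one has \<open>sqrt (2 * w) = 2 * sqrt z\<close>, which gives the
  amplitude. The error combines 5/(4 z^2) from the sinh part and 3/(8 z^(3/2)) from replacing the
  kernel weight by 1.\<close>

lemma half_kernel_asymptotic:
  "\<exists>\<phi>. \<forall>z\<ge>1. (half_kernel z \<longlongrightarrow> kernel_limit z / 2) at_top \<and>
     \<bar>kernel_limit z - sqrt pi / (2 * sqrt z) * cos (2 * z + \<phi>)\<bar> \<le> 2 / (z * sqrt z)"
proof -
  obtain \<phi>0 where Phi: "((\<lambda>Q. integral {0..Q} (\<lambda>q. cis (q\<^sup>2))) \<longlongrightarrow> of_real (sqrt pi / 2) * cis \<phi>0) at_top"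
    using Fresnel_limit by blast
  define \<Phi> where "\<Phi> = of_real (sqrt pi / 2) * cis \<phi>0"
  have "(half_kernel z \<longlongrightarrow> kernel_limit z / 2) at_top \<and>
     \<bar>kernel_limit z - sqrt pi / (2 * sqrt z) * cos (2 * z + (\<phi>0 + pi))\<bar> \<le> 2 / (z * sqrt z)" if z: "z \<ge> 1" for z
  proof -
    define w where "w = 2 * z"
    have w: "w > 0" using z by (simp add: w_def)
    define S where "S = (\<lambda>Y. integral {0..Y} (\<lambda>y. cos (w * sinh y)))"
    have sinh_top: "filterlim (\<lambda>Y. sinh (Y / 2)) at_top (at_top :: real filter)" by real_asymp
    obtain L where L: "(fresnel_kernel_integral w \<longlongrightarrow> L) at_top"
      using fresnel_kernel_limit_exists[OF w] by blast
    have "\<exists>s. (S \<longlongrightarrow> s) at_top"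
    proof (rule convergent_at_top_Cauchy)
      fix e :: real assume e: "e > 0"
      have "((\<lambda>x. 2 / (w * cosh x)) \<longlongrightarrow> 0) at_top" using w by real_asymp
      then have "eventually (\<lambda>x. 2 / (w * cosh x) < e) at_top"
        using e by (simp add: order_tendsto_iff)
      then obtain P where P: "\<And>x. x \<ge> P \<Longrightarrow> 2 / (w * cosh x) < e"
        by (auto simp: eventually_at_top_linorder)
      show "\<exists>P. \<forall>x\<ge>P. \<forall>y\<ge>x. norm (S y - S x) < e"
      proof (intro exI[of _ "max P 0"] allI impI)
        fix x y assume x: "max P 0 \<le> x" and y: "x \<le> y"
        have "S x + integral {x..y} (\<lambda>y. cos (w * sinh y)) = S y" unfolding S_def
          using x y by (intro Henstock_Kurzweil_Integration.integral_combine integrable_continuous_real continuous_intros) auto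
        moreover have "\<bar>integral {x..y} (\<lambda>y. cos (w * sinh y))\<bar> \<le> 2 / (w * cosh x)"
          using integral_cos_sinh_tail_Cauchy[OF w _ y] x by simp
        moreover have "2 / (w * cosh x) < e" using P x by simp
        ultimately show "norm (S y - S x) < e" by simp
      qed
    qed
    then obtain s where s: "(S \<longlongrightarrow> s) at_top" by blast
    have s_bound: "\<bar>s\<bar> \<le> 0 + 5 / w\<^sup>2"
    proof (rule tendsto_le[OF _ _ tendsto_rabs[OF s]])
      show "((\<lambda>Y. 1 / (w * cosh Y) + 5 / w\<^sup>2) \<longlongrightarrow> 0 + 5 / w\<^sup>2) at_top" using w by real_asymp
      show "eventually (\<lambda>Y. \<bar>S Y\<bar> \<le> 1 / (w * cosh Y) + 5 / w\<^sup>2) at_top"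
        using eventually_ge_at_top[of 0]
        by eventually_elim (use integral_cos_sinh_bound[OF w] in \<open>auto simp: S_def\<close>)
    qed simp
    have "((\<lambda>Q. integral {0..Q} (\<lambda>q. cis (2 * w * q\<^sup>2))) \<longlongrightarrow> \<Phi> /\<^sub>R sqrt (2 * w)) at_top"
    proof -
      have "integral {0..Q} (\<lambda>q. cis (2 * w * q\<^sup>2)) = integral {0..sqrt (2 * w) * Q} (\<lambda>q. cis (q\<^sup>2)) /\<^sub>R sqrt (2 * w)" for Q
        using integral_scale_from_0[of "sqrt (2 * w)" "\<lambda>q. cis (q\<^sup>2)" Q] w
        by (simp add: power_mult_distrib continuous_intros)
      moreover have "filterlim (\<lambda>Q. sqrt (2 * w) * Q) at_top at_top" using w
        by (intro filterlim_tendsto_pos_mult_at_top[OF tendsto_const]) (auto intro: filterlim_ident)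
      from filterlim_compose[OF Phi this] have "((\<lambda>Q. integral {0..sqrt (2 * w) * Q} (\<lambda>q. cis (q\<^sup>2)) /\<^sub>R sqrt (2 * w))
           \<longlongrightarrow> \<Phi> /\<^sub>R sqrt (2 * w)) at_top" unfolding \<Phi>_def by (intro tendsto_intros)
      ultimately show ?thesis by simp
    qed
    then have lim: "((\<lambda>Q. norm (fresnel_kernel_integral w Q - integral {0..Q} (\<lambda>q. cis (2 * w * q\<^sup>2))))
        \<longlongrightarrow> norm (L - \<Phi> /\<^sub>R sqrt (2 * w))) at_top"
      by (intro tendsto_intros L)
    have L_bound: "norm (L - \<Phi> /\<^sub>R sqrt (2 * w)) \<le> 1 / (4 * w) * (0 + 3 / sqrt (2 * w))"
    proof (rule tendsto_le[OF _ _ lim])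
      have "((\<lambda>Q. 1 / (1 + Q)) \<longlongrightarrow> (0::real)) at_top" by real_asymp
      then show "((\<lambda>Q. 1 / (4 * w) * (1 / (1 + Q) + 3 / sqrt (2 * w))) \<longlongrightarrow> 1 / (4 * w) * (0 + 3 / sqrt (2 * w))) at_top"
        by (intro tendsto_intros)
      show "eventually (\<lambda>Q. norm (fresnel_kernel_integral w Q - integral {0..Q} (\<lambda>q. cis (2 * w * q\<^sup>2)))
          \<le> 1 / (4 * w) * (1 / (1 + Q) + 3 / sqrt (2 * w))) at_top"
        using eventually_ge_at_top[of 0] by eventually_elim (use fresnel_kernel_approx[OF w] in auto)
    qed simp
    have "((\<lambda>Y. (S Y - Re (2 * cis w * fresnel_kernel_integral w (sinh (Y / 2)))) / 2)
        \<longlongrightarrow> (s - Re (2 * cis w * L)) / 2) at_top"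
      by (intro tendsto_intros s filterlim_compose[OF L sinh_top]) auto
    moreover have "eventually (\<lambda>Y. (S Y - Re (2 * cis w * fresnel_kernel_integral w (sinh (Y / 2)))) / 2 = half_kernel z Y) at_top"
      using eventually_ge_at_top[of 0] by eventually_elim (simp add: half_kernel_eq S_def w_def)
    ultimately have h: "(half_kernel z \<longlongrightarrow> (s - Re (2 * cis w * L)) / 2) at_top"
      by (rule Lim_transform_eventually)
    then have kl: "kernel_limit z = s - Re (2 * cis w * L)"
      unfolding kernel_limit_def by (simp add: tendsto_Lim)
    have sq: "sqrt (2 * w) = 2 * sqrt z"
      using real_sqrt_mult[of 4 z] by (simp add: w_def)
    have main: "Re (2 * cis w * (\<Phi> /\<^sub>R sqrt (2 * w))) = - (sqrt pi / (2 * sqrt z) * cos (2 * z + (\<phi>0 + pi)))"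
    proof -
      have c: "cis w * \<Phi> = of_real (sqrt pi / 2) * cis (w + \<phi>0)"
        by (simp add: \<Phi>_def cis_mult[symmetric])
      have "2 * cis w * (\<Phi> /\<^sub>R sqrt (2 * w)) = (2 / sqrt (2 * w)) *\<^sub>R (cis w * \<Phi>)"
        by (simp add: scaleR_conv_of_real divide_inverse mult_ac)
      then have "2 * cis w * (\<Phi> /\<^sub>R sqrt (2 * w)) = (2 / sqrt (2 * w)) *\<^sub>R (of_real (sqrt pi / 2) * cis (w + \<phi>0))"
        unfolding c .
      moreover have "cos (2 * z + (\<phi>0 + pi)) = - cos (w + \<phi>0)"
        using cos_periodic_pi[of "w + \<phi>0"] by (simp add: w_def add_ac)
      ultimately show ?thesis by (simp add: sq)
    qed
    have "\<bar>kernel_limit z - sqrt pi / (2 * sqrt z) * cos (2 * z + (\<phi>0 + pi))\<bar>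
        = \<bar>s - Re (2 * cis w * (L - \<Phi> /\<^sub>R sqrt (2 * w)))\<bar>"
      unfolding kl right_diff_distrib minus_complex.sel main by simp
    also have "\<dots> \<le> 5 / w\<^sup>2 + 2 * (1 / (4 * w) * (3 / sqrt (2 * w)))"
    proof -
      have "\<bar>Re (2 * cis w * (L - \<Phi> /\<^sub>R sqrt (2 * w)))\<bar> \<le> 2 * norm (L - \<Phi> /\<^sub>R sqrt (2 * w))"
        using abs_Re_le_cmod[of "2 * cis w * (L - \<Phi> /\<^sub>R sqrt (2 * w))"] by (simp add: norm_mult)
      also have "\<dots> \<le> 2 * (1 / (4 * w) * (3 / sqrt (2 * w)))" using L_bound by simp
      finally show ?thesis using order_trans[OF abs_triangle_ineq4 add_mono[OF s_bound]] by simp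
    qed
    also have "\<dots> = 5 / (4 * (z * z)) + 3 / (8 * (z * sqrt z))"
      unfolding sq by (simp add: w_def power2_eq_square)
    also have "\<dots> \<le> 5 / (4 * (z * sqrt z)) + 3 / (8 * (z * sqrt z))"
    proof -
      have "sqrt z * 1 \<le> sqrt z * sqrt z" using z by (intro mult_left_mono) auto
      then have "sqrt z \<le> z" using z by simp
      then show ?thesis using z by (intro add_right_mono divide_left_mono mult_left_mono mult_pos_pos) auto
    qed
    also have "\<dots> = (13 / 8) / (z * sqrt z)" by (simp add: field_simps)
    also have "\<dots> \<le> 2 / (z * sqrt z)" using z by (intro divide_right_mono) auto
    finally show ?thesis using h kl by simp
  qed
  then show ?thesis by blast
qed

lemma kernel_integral_tendsto:
  assumes z: "z \<ge> 1" and "filterlim a at_top F" "filterlim b at_top F"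
  shows "((\<lambda>i. integral {- a i..b i} (kernel_integrand z)) \<longlongrightarrow> kernel_limit z) F"
proof -
  have h: "(half_kernel z \<longlongrightarrow> kernel_limit z / 2) at_top"
    using half_kernel_asymptotic z by blast
  have "((\<lambda>i. half_kernel z (a i) + half_kernel z (b i)) \<longlongrightarrow> kernel_limit z / 2 + kernel_limit z / 2) F"
    by (intro tendsto_add filterlim_compose[OF h] assms)
  moreover have "eventually (\<lambda>i. half_kernel z (a i) + half_kernel z (b i) = integral {- a i..b i} (kernel_integrand z)) F"
    using assms(2,3)[unfolded filterlim_at_top, rule_format, of 0]
    by eventually_elim (simp add: kernel_integral_split)
  ultimately have "((\<lambda>i. integral {- a i..b i} (kernel_integrand z)) \<longlongrightarrow> kernel_limit z / 2 + kernel_limit z / 2) F"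
    by (rule Lim_transform_eventually)
  then show ?thesis by simp
qed

section \<open>Correlation of sawtooth functions\<close>

definition sawtooth :: "real \<Rightarrow> real" where
  "sawtooth u = frac u - 1 / 2"

text \<open>The Abel mean of the sawtooth Fourier series in closed form. The closed form gives at
  once a bound uniform in \<open>r\<close>, since the imaginary part of \<open>Ln\<close> lies in
  (-pi, pi]; the series alone would not.\<close>

definition abel_sawtooth :: "real \<Rightarrow> real \<Rightarrow> real" where
  "abel_sawtooth r u = Im (Ln (1 - of_real r * cis (2 * pi * u))) / pi"

text \<open>This is the imaginary part of the logarithmic series. The index starts at 0, where
  division by zero makes the term 0; the same convention is used in all later series over
  frequencies.\<close>

lemma abel_sawtooth_sums:
  assumes r: "0 \<le> r" "r < 1"
  shows "(\<lambda>n. - (r ^ n * sin (2 * pi * real n * u) / (pi * real n))) sums abel_sawtooth r u"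
proof -
  define z where "z = - (of_real r * cis (2 * pi * u))"
  have "norm z < 1" using r by (simp add: z_def norm_mult)
  from sums_divide[OF sums_Im[OF Ln_series'[OF this]], of pi]
  have "(\<lambda>n. Im (- ((- z) ^ n) / of_nat n) / pi) sums abel_sawtooth r u"
    by (simp add: abel_sawtooth_def z_def)
  moreover have "Im (- ((- z) ^ n) / of_nat n) / pi = - (r ^ n * sin (2 * pi * real n * u) / (pi * real n))" for n
  proof -
    have "(- z) ^ n = (of_real r * cis (2 * pi * u)) ^ n" by (simp add: z_def)
    also have "\<dots> = of_real (r ^ n) * cis (real n * (2 * pi * u))"
      using Complex.DeMoivre[of "2 * pi * u" n] by (simp only: power_mult_distrib of_real_power)
    finally have "(- z) ^ n = of_real (r ^ n) * cis (real n * (2 * pi * u))" .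
    then show ?thesis by (simp add: mult_ac)
  qed
  ultimately show ?thesis by (simp only:)
qed

lemma abs_abel_sawtooth_le: 
  assumes "0 \<le> r" "r < 1"
  shows "\<bar>abel_sawtooth r u\<bar> \<le> 1"
proof -
  have "norm (of_real r * cis (2 * pi * u)) < 1" using assms by (simp add: norm_mult)
  then have "1 - of_real r * cis (2 * pi * u) \<noteq> 0" by auto
  from mpi_less_Im_Ln[OF this] Im_Ln_le_pi[OF this] show ?thesis
    by (simp add: abel_sawtooth_def abs_le_iff field_simps)
qed

text \<open>With t the fractional part of \<open>u\<close>, \<open>1 - cis (2 * pi * t)\<close>
  equals 2 sin (pi t) > 0 times \<open>cis (pi * t - pi / 2)\<close>, and the last angle is
  \<open>pi * sawtooth u\<close>. The second conclusion supplies continuity of \<open>Ln\<close> at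
  this point when \<open>r\<close> tends to 1.\<close>

lemma Im_Ln_one_minus_cis:
  assumes u: "u \<notin> \<int>"
  shows "Im (Ln (1 - cis (2 * pi * u))) = pi * sawtooth u" "1 - cis (2 * pi * u) \<notin> \<real>\<^sub>\<le>\<^sub>0"
proof -
  define t where "t = frac u"
  have t: "0 < t" "t < 1" using u by (auto simp: t_def frac_lt_1 frac_gt_0_iff)
  have c: "cis (2 * pi * u) = cis (2 * pi * t)"
  proof -
    have "2 * pi * u = 2 * pi * t + 2 * pi * of_int \<lfloor>u\<rfloor>" by (simp add: t_def frac_def algebra_simps)
    then have "cis (2 * pi * u) = cis (2 * pi * t) * cis (2 * pi * of_int \<lfloor>u\<rfloor>)"
      by (simp only: cis_mult)
    then show ?thesis by (simp add: cis_multiple_2pi)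
  qed
  have s: "sin (pi * t) > 0" using t by (intro sin_gt_zero) auto
  have "1 - cis (2 * pi * t) = of_real (2 * sin (pi * t)) * cis (pi * t - pi / 2)"
  proof -
    have "cis (pi * t - pi / 2) = Complex (sin (pi * t)) (- cos (pi * t))"
      by (simp add: complex_eq_iff cos_diff sin_diff)
    moreover have "cos (2 * (pi * t)) = 1 - 2 * sin (pi * t) ^ 2" "sin (2 * (pi * t)) = 2 * sin (pi * t) * cos (pi * t)"
      by (simp_all add: cos_double_sin sin_double)
    ultimately show ?thesis
      by (simp add: complex_eq_iff mult.assoc power2_eq_square)
  qed
  also have "pi * t - pi / 2 = pi * sawtooth u" by (simp add: sawtooth_def t_def algebra_simps)
  finally have "1 - cis (2 * pi * t) = of_real (2 * sin (pi * t)) * exp (\<i> * of_real (pi * sawtooth u))"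
    by (simp only: cis_conv_exp)
  moreover have "- pi < pi * sawtooth u" "pi * sawtooth u \<le> pi"
  proof -
    have "pi * (- 1 / 2) \<le> pi * sawtooth u" "pi * sawtooth u \<le> pi * (1 / 2)"
      using t unfolding sawtooth_def t_def[symmetric] by (intro mult_left_mono; simp)+
    then show "- pi < pi * sawtooth u" "pi * sawtooth u \<le> pi" using pi_gt_zero by linarith+
  qed
  ultimately have "Arg (1 - cis (2 * pi * t)) = pi * sawtooth u"
    using s by (intro Arg_unique[where r = "2 * sin (pi * t)"]) simp_all
  moreover have ne: "Re (1 - cis (2 * pi * t)) > 0"
    using s cos_double_sin[of "pi * t"] by (simp add: mult.assoc)
  moreover have "1 - cis (2 * pi * t) \<noteq> 0"
  proof
    assume "1 - cis (2 * pi * t) = 0"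
    then show False using ne by simp
  qed
  ultimately show "Im (Ln (1 - cis (2 * pi * u))) = pi * sawtooth u"
    unfolding c by (metis Arg_eq_Im_Ln)
  show "1 - cis (2 * pi * u) \<notin> \<real>\<^sub>\<le>\<^sub>0"
    unfolding c using ne by (auto simp: complex_nonpos_Reals_iff)
qed

lemma abel_sawtooth_tendsto:
  assumes u: "u \<notin> \<int>" and r: "(r \<longlongrightarrow> 1) F"
  shows "((\<lambda>j. abel_sawtooth (r j) u) \<longlongrightarrow> sawtooth u) F"
proof -
  have "((\<lambda>j. Im (Ln (1 - of_real (r j) * cis (2 * pi * u))) / pi) \<longlongrightarrow>
      Im (Ln (1 - of_real 1 * cis (2 * pi * u))) / pi) F"
    using Im_Ln_one_minus_cis(2)[OF u] by (intro tendsto_intros r) auto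
  then show ?thesis
    unfolding abel_sawtooth_def using Im_Ln_one_minus_cis(1)[OF u] by simp
qed

lemma bounded_borel_imp_integrable_on:
  fixes f :: "real \<Rightarrow> real"
  assumes "f \<in> borel_measurable borel" "\<And>y. y \<in> {a..b} \<Longrightarrow> \<bar>f y\<bar> \<le> B"
  shows "f integrable_on {a..b}"
proof (rule measurable_bounded_by_integrable_imp_integrable)
  show "f \<in> borel_measurable (lebesgue_on {a..b})"
    using assms(1) by (intro measurable_restrict_space1 measurable_completion) simp
  show "(\<lambda>_. B) integrable_on {a..b}" by (rule integrable_const_ivl)
qed (use assms in auto)

lemma borel_measurable_sawtooth [measurable]: "sawtooth \<in> borel_measurable borel"
  unfolding sawtooth_def[abs_def] frac_def[abs_def] by measurable

lemma abs_sawtooth_le: "\<bar>sawtooth u\<bar> \<le> 1"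
  unfolding sawtooth_def abs_le_iff using frac_lt_1[of u] frac_ge_0[of u] by linarith

text \<open>The Fourier series converges only conditionally, so it is not integrated term by term
  directly. For radius below 1 a geometric majorant allows this; then the radius tends to 1 on both
  sides, by Tannery's theorem on the series (through the summability assumption) and by dominated
  convergence on the integral.\<close>

lemma integral_sawtooth_series:
  fixes h g :: "real \<Rightarrow> real"
  assumes h: "continuous_on UNIV h" and g: "g \<in> borel_measurable borel" "\<And>y. \<bar>g y\<bar> \<le> B"
    and neg: "negligible {y \<in> {a..b}. h y \<in> \<int>}"
    and sm: "summable (\<lambda>n. \<bar>integral {a..b} (\<lambda>y. sin (2 * pi * real n * h y) * g y)\<bar> / real n)"
  shows "integral {a..b} (\<lambda>y. sawtooth (h y) * g y) =
     - (\<Sum>n. integral {a..b} (\<lambda>y. sin (2 * pi * real n * h y) * g y) / (pi * real n))"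
proof -
  define s where "s = (\<lambda>n. integral {a..b} (\<lambda>y. sin (2 * pi * real n * h y) * g y))"
  define r where "r = (\<lambda>j. 1 - inverse (real (Suc j)))"
  have r: "0 \<le> r j" "r j < 1" for j by (auto simp: r_def field_simps)
  have rlim: "r \<longlonglongrightarrow> 1"
    unfolding r_def using tendsto_diff[OF tendsto_const LIMSEQ_inverse_real_of_nat, of 1] by simp
  have B: "B \<ge> 0" using g(2)[of 0] by linarith
  have [measurable]: "h \<in> borel_measurable borel" using h by (rule borel_measurable_continuous_onI)
  note [measurable] = g(1)
  have si: "(\<lambda>y. sin (2 * pi * real n * h y) * g y) integrable_on {a..b}" for n
  proof (rule bounded_borel_imp_integrable_on[where B = B])
    show "\<bar>sin (2 * pi * real n * h y) * g y\<bar> \<le> B" for y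
      using mult_mono[OF abs_sin_le_one g(2)[of y], of "2 * pi * real n * h y"] by (simp add: abs_mult)
  qed measurable
  have I: "(\<lambda>y. abel_sawtooth \<rho> (h y) * g y) integrable_on {a..b} \<and>
      (\<lambda>N. \<Sum>n<N. - (\<rho> ^ n * (s n / (pi * real n)))) \<longlonglongrightarrow> integral {a..b} (\<lambda>y. abel_sawtooth \<rho> (h y) * g y)"
    if \<rho>: "0 \<le> \<rho>" "\<rho> < 1" for \<rho>
  proof -
    define f where "f = (\<lambda>N y. (\<Sum>n<N. - (\<rho> ^ n * sin (2 * pi * real n * h y) / (pi * real n))) * g y)"
    have f_alt: "f N = (\<lambda>y. \<Sum>n<N. (- (\<rho> ^ n / (pi * real n))) * (sin (2 * pi * real n * h y) * g y))" for N
      unfolding f_def sum_distrib_right by (intro ext sum.cong refl) simp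
    have fi: "(f N has_integral (\<Sum>n<N. (- (\<rho> ^ n / (pi * real n))) * s n)) {a..b}" for N
      unfolding f_alt s_def by (intro has_integral_sum has_integral_mult_right integrable_integral si) auto
    have bound: "norm (f N y) \<le> (1 / (1 - \<rho>)) * B" for N y
    proof -
      have "\<bar>- (\<rho> ^ n * sin (2 * pi * real n * h y) / (pi * real n))\<bar> \<le> \<rho> ^ n" for n
      proof (cases "n = 0")
        case False
        have "1 \<le> pi * real n" using False pi_gt3 by (intro order_trans[OF _ mult_mono[of 1 pi 1 "real n"]]) auto
        then have "\<rho> ^ n * \<bar>sin (2 * pi * real n * h y)\<bar> / (pi * real n) \<le> \<rho> ^ n * 1 / 1"
          using \<rho> by (intro frac_le mult_left_mono) auto
        then show ?thesis using \<rho> by (simp add: abs_mult)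
      qed simp
      then have "\<bar>\<Sum>n<N. - (\<rho> ^ n * sin (2 * pi * real n * h y) / (pi * real n))\<bar> \<le> (\<Sum>n<N. \<rho> ^ n)"
        by (intro order_trans[OF sum_abs] sum_mono)
      also have "\<dots> \<le> (\<Sum>n. \<rho> ^ n)" using \<rho> by (intro sum_le_suminf summable_geometric) auto
      also have "\<dots> = 1 / (1 - \<rho>)" using \<rho> by (intro suminf_geometric) auto
      finally show ?thesis unfolding f_def real_norm_def abs_mult
        using g(2)[of y] \<rho> by (intro mult_mono) auto
    qed
    have conv: "(\<lambda>N. f N y) \<longlonglongrightarrow> abel_sawtooth \<rho> (h y) * g y" for y
      unfolding f_def using abel_sawtooth_sums[OF \<rho>, of "h y"] by (intro tendsto_mult_right) (simp add: sums_def)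
    have "(\<lambda>N. integral {a..b} (f N)) \<longlonglongrightarrow> integral {a..b} (\<lambda>y. abel_sawtooth \<rho> (h y) * g y)"
         "(\<lambda>y. abel_sawtooth \<rho> (h y) * g y) integrable_on {a..b}"
      using dominated_convergence[of f "{a..b}" "\<lambda>_. (1 / (1 - \<rho>)) * B" "\<lambda>y. abel_sawtooth \<rho> (h y) * g y"]
        has_integral_integrable[OF fi] bound conv by (auto simp: integrable_const_ivl)
    then show ?thesis using integral_unique[OF fi] by simp
  qed
  have eq1: "integral {a..b} (\<lambda>y. abel_sawtooth (r j) (h y) * g y) = (\<Sum>n. - (r j ^ n * (s n / (pi * real n))))" for j
    using I[OF r] by (intro sums_unique) (simp add: sums_def)
  have pin: "\<bar>s n\<bar> / (pi * real n) \<le> \<bar>s n\<bar> / (1 * real n)" for n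
    using pi_gt3 by (cases "n = 0") (auto intro!: divide_left_mono mult_right_mono)
  have smn: "summable (\<lambda>n. s n / (pi * real n))"
    by (rule summable_comparison_test'[OF sm[folded s_def], of 0])
      (use pin in \<open>simp_all add: s_def abs_mult\<close>)
  have "((\<lambda>j. \<Sum>n. - (r j ^ n * (s n / (pi * real n)))) \<longlongrightarrow> (\<Sum>n. - (1 * (s n / (pi * real n))))) sequentially"
  proof (rule tannerys_theorem[THEN conjunct2, THEN conjunct2])
    show "(\<lambda>j. - (r j ^ n * (s n / (pi * real n)))) \<longlonglongrightarrow> - (1 * (s n / (pi * real n)))" for n
      using tendsto_power[OF rlim, of n] by (intro tendsto_intros) auto
    show "summable (\<lambda>n. \<bar>s n\<bar> / real n)" using sm by (simp add: s_def)
    show "\<forall>\<^sub>F (n, j) in at_top \<times>\<^sub>F sequentially. norm (- (r j ^ n * (s n / (pi * real n)))) \<le> \<bar>s n\<bar> / real n"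
    proof (intro always_eventually allI, clarify)
      fix n j
      have "r j ^ n * (\<bar>s n\<bar> / (pi * real n)) \<le> 1 * (\<bar>s n\<bar> / (1 * real n))"
      proof (cases "n = 0")
        case False
        then show ?thesis using r[of j] pi_gt3
          by (intro mult_mono divide_left_mono mult_right_mono power_le_one) auto
      qed simp
      then show "norm (- (r j ^ n * (s n / (pi * real n)))) \<le> \<bar>s n\<bar> / real n"
        using r[of j] by (simp add: abs_mult)
    qed
  qed auto
  then have lim1: "(\<lambda>j. integral {a..b} (\<lambda>y. abel_sawtooth (r j) (h y) * g y)) \<longlonglongrightarrow> - (\<Sum>n. s n / (pi * real n))"
    unfolding eq1[symmetric]
    using smn by (simp add: suminf_minus)
  \<comment> \<open>At integers the Abel means are 0 while \<open>sawtooth\<close> is -1/2, so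
    pointwise convergence fails on this negligible set; both integrands are set to 0 there.\<close>
  define N where "N = {y \<in> {a..b}. h y \<in> \<int>}"
  define G where "G = (\<lambda>F y. if y \<in> N then 0 else F y :: real)"
  have spike: "integral {a..b} (G F) = integral {a..b} F" for F
    by (rule integral_spike[of N]) (use neg in \<open>auto simp: N_def G_def\<close>)
  have spike': "G F integrable_on {a..b}" if "F integrable_on {a..b}" for F
    by (rule integrable_spike[OF that, of N]) (use neg in \<open>auto simp: N_def G_def\<close>)
  have "(\<lambda>j. integral {a..b} (G (\<lambda>y. abel_sawtooth (r j) (h y) * g y))) \<longlonglongrightarrow>
      integral {a..b} (G (\<lambda>y. sawtooth (h y) * g y))"
  proof (rule dominated_convergence)
    show "G (\<lambda>y. abel_sawtooth (r j) (h y) * g y) integrable_on {a..b}" for j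
      using I[OF r] by (intro spike') auto
    show "(\<lambda>_. 1 * B) integrable_on {a..b}" by (rule integrable_const_ivl)
    show "norm (G (\<lambda>y. abel_sawtooth (r j) (h y) * g y) y) \<le> 1 * B" for j y
      using B mult_mono[OF abs_abel_sawtooth_le[OF r, of j "h y"] g(2)[of y]] by (simp add: G_def abs_mult)
    show "(\<lambda>j. G (\<lambda>y. abel_sawtooth (r j) (h y) * g y) y) \<longlonglongrightarrow> G (\<lambda>y. sawtooth (h y) * g y) y" if "y \<in> {a..b}" for y
      using that by (cases "y \<in> N") (auto simp: G_def N_def intro!: tendsto_mult_right abel_sawtooth_tendsto rlim)
  qed
  then have "(\<lambda>j. integral {a..b} (\<lambda>y. abel_sawtooth (r j) (h y) * g y)) \<longlonglongrightarrow> integral {a..b} (\<lambda>y. sawtooth (h y) * g y)"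
    unfolding spike .
  from LIMSEQ_unique[OF this lim1] show ?thesis by (simp add: s_def)
qed

section \<open>The logarithmic mean as an integral of two floor functions\<close>

definition log_divisor_sum :: "real \<Rightarrow> real" where
  "log_divisor_sum x = (\<Sum>n | 1 \<le> n \<and> real n \<le> x. real (divisor_tau n) * ln (x / real n))"

text \<open>In the variable u = exp y the measure is du/u and the range is [x/Z, Z], which is
  invariant under exchanging u and x/u. Hence both floors stay at most \<open>Z\<close> and become
  sums over 1..Z.\<close>

definition sawtooth_corr :: "nat \<Rightarrow> real \<Rightarrow> real" where
  "sawtooth_corr Z x = integral {ln (x / Z)..ln Z} (\<lambda>y. sawtooth (exp y) * sawtooth (x * exp (- y)))"

lemma floor_eq_sum_indicator:
  assumes "0 < u" "u \<le> real Z"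
  shows "of_int \<lfloor>u\<rfloor> = (\<Sum>m=1..Z. if real m \<le> u then 1 else (0::real))"
proof -
  have "(\<Sum>m=1..Z. if real m \<le> u then 1 else (0::real)) = (\<Sum>m\<in>{m\<in>{1..Z}. real m \<le> u}. 1)"
    by (rule sum.inter_filter[symmetric]) simp
  also have "{m\<in>{1..Z}. real m \<le> u} = {1..nat \<lfloor>u\<rfloor>}"
  proof -
    have 1: "real m \<le> u \<longleftrightarrow> m \<le> nat \<lfloor>u\<rfloor>" for m
      using assms le_floor_iff[of "int m" u] by (simp add: le_nat_iff)
    have 2: "nat \<lfloor>u\<rfloor> \<le> Z" using assms by linarith
    show ?thesis unfolding 1 using 2 by auto
  qed
  finally show ?thesis using assms by simp
qed

lemma has_integral_indicator_interval:
  fixes f :: "real \<Rightarrow> real"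
  assumes "(f has_integral I) {c..d}" "a \<le> c" "d \<le> b"
  shows "((\<lambda>y. if c \<le> y \<and> y \<le> d then f y else 0) has_integral I) {a..b}"
  using has_integral_restrict_closed_subinterval[of f I c d a b] assms by simp

text \<open>Since \<open>Z\<close> is at least \<open>x\<close>, the box {1..Z} x {1..Z} contains
  every pair with product at most \<open>x\<close>; such pairs with product k correspond to the
  divisors of k.\<close>

lemma sum_hyperbola_eq:
  assumes "real Z \<ge> x"
  shows "(\<Sum>m=1..Z. \<Sum>n=1..Z. if real (m * n) \<le> x then ln (x / real (m * n)) else 0) = log_divisor_sum x"
proof -
  define A where "A = {n. 1 \<le> n \<and> real n \<le> x}"
  have fA: "finite A" by (rule finite_subset[of _ "{..nat \<lfloor>x\<rfloor>}"]) (auto simp: A_def le_nat_floor)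
  have "(\<Sum>m=1..Z. \<Sum>n=1..Z. if real (m * n) \<le> x then ln (x / real (m * n)) else 0) =
     (\<Sum>(m,n)\<in>{1..Z}\<times>{1..Z}. if real (m * n) \<le> x then ln (x / real (m * n)) else 0)"
    by (rule sum.cartesian_product)
  also have "\<dots> = (\<Sum>p\<in>{1..Z}\<times>{1..Z}. if real (fst p * snd p) \<le> x then ln (x / real (fst p * snd p)) else 0)"
    by (simp add: case_prod_unfold)
  also have "\<dots> = (\<Sum>p\<in>{p\<in>{1..Z}\<times>{1..Z}. real (fst p * snd p) \<le> x}. ln (x / real (fst p * snd p)))"
    by (rule sum.inter_filter[symmetric]) simp
  also have "\<dots> = (\<Sum>(k, d)\<in>Sigma A (\<lambda>k. {d. d dvd k}). ln (x / real k))"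
  proof (rule sum.reindex_bij_witness[where i = "\<lambda>(k, d). (d, k div d)" and j = "\<lambda>(m, n). (m * n, m)"])
    fix p assume "p \<in> Sigma A (\<lambda>k. {d. d dvd k})"
    then obtain k d where p: "p = (k, d)" "k \<in> A" "d dvd k" by auto
    then obtain e where e: "k = d * e" by (auto elim: dvdE)
    have k: "1 \<le> k" "real k \<le> x" using p by (auto simp: A_def)
    then have kZ: "k \<le> Z" using assms by simp
    have de: "d \<noteq> 0" "e \<noteq> 0" using e k by auto
    then have "d \<le> k" "e \<le> k" using e by auto
    then have "d \<le> Z" "e \<le> Z" using kZ by auto
    then show "(case p of (k, d) \<Rightarrow> (d, k div d)) \<in> {p \<in> {1..Z} \<times> {1..Z}. real (fst p * snd p) \<le> x}"
      "(case case p of (k, d) \<Rightarrow> (d, k div d) of (m, n) \<Rightarrow> (m * n, m)) = p"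
      using p e de k kZ by auto
  qed (auto simp: A_def)
  also have "\<dots> = (\<Sum>k\<in>A. \<Sum>d | d dvd k. ln (x / real k))"
    using fA by (subst sum.Sigma) (auto simp: A_def)
  also have "\<dots> = log_divisor_sum x"
    by (simp add: log_divisor_sum_def A_def divisor_tau_def)
  finally show ?thesis .
qed

text \<open>Each sawtooth is a linear function minus a floor. The product of floors integrates to
  \<open>log_divisor_sum x\<close>, because the log-length of the set where u >= m and x/u >= n is
  ln (x / (m n)) when this is positive; the mixed products give harmonic sums. The last bracket
  depends on \<open>Z\<close> alone.\<close>

lemma sawtooth_corr_eq:
  assumes x: "1 \<le> x" "x \<le> real Z"
  shows "sawtooth_corr Z x = log_divisor_sum x - x * ln x - ln x / 4 + 2 * x - 2 * x * (harm Z - ln Z) + x / Z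
     + (ln Z / 2 - Z + (\<Sum>m=1..Z. ln (real Z / real m)))"
proof -
  have Z: "real Z > 0" "real Z \<ge> 1" using x by auto
  define a b where "a = ln (x / Z)" and "b = ln (real Z)"
  have "a \<le> 0" "0 \<le> b" using x Z by (auto simp: a_def b_def)
  then have ab: "a \<le> 0" "0 \<le> b" "a \<le> b" by auto
  have ea: "exp a = x / Z" "exp (- a) = Z / x" and eb: "exp b = Z" "exp (- b) = 1 / Z"
    using x Z by (auto simp: a_def b_def exp_minus field_simps)
  have ba: "b - a = 2 * ln Z - ln x" using x Z by (simp add: a_def b_def ln_div)
  define F where "F = (\<lambda>y. \<Sum>m=1..Z. if ln (real m) \<le> y \<and> y \<le> b then 1 else (0::real))"
  define G where "G = (\<lambda>y. \<Sum>n=1..Z. if a \<le> y \<and> y \<le> ln (x / n) then 1 else (0::real))"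
  have fl1: "of_int \<lfloor>exp y\<rfloor> = F y" if y: "y \<in> {a..b}" for y
  proof -
    have "exp y \<le> Z" using y eb by (metis atLeastAtMost_iff exp_le_cancel_iff)
    then have "of_int \<lfloor>exp y\<rfloor> = (\<Sum>m=1..Z. if real m \<le> exp y then 1 else (0::real))"
      by (intro floor_eq_sum_indicator) auto
    also have "\<dots> = F y" unfolding F_def
    proof (intro sum.cong refl)
      fix m assume "m \<in> {1..Z}"
      then have "real m \<le> exp y \<longleftrightarrow> ln (real m) \<le> ln (exp y)"
        by (subst ln_le_cancel_iff) auto
      then show "(if real m \<le> exp y then 1 else 0) = (if ln (real m) \<le> y \<and> y \<le> b then 1 else (0::real))"
        using y by simp
    qed
    finally show ?thesis .
  qed
  have fl2: "of_int \<lfloor>x * exp (- y)\<rfloor> = G y" if y: "y \<in> {a..b}" for y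
  proof -
    have "x * exp (- y) \<le> x * exp (- a)" using y x by (intro mult_left_mono) auto
    also have "\<dots> = Z" using ea x by simp
    finally have "of_int \<lfloor>x * exp (- y)\<rfloor> = (\<Sum>m=1..Z. if real m \<le> x * exp (- y) then 1 else (0::real))"
      using x by (intro floor_eq_sum_indicator) auto
    also have "\<dots> = G y" unfolding G_def
    proof (intro sum.cong refl)
      fix n assume n: "n \<in> {1..Z}"
      have "real n \<le> x * exp (- y) \<longleftrightarrow> exp y \<le> x / n" using n by (simp add: exp_minus field_simps)
      also have "\<dots> \<longleftrightarrow> y \<le> ln (x / n)" using n x by (subst ln_ge_iff) auto
      finally show "(if real n \<le> x * exp (- y) then 1 else 0) = (if a \<le> y \<and> y \<le> ln (x / n) then 1 else (0::real))"
        using y by auto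
    qed
    finally show ?thesis .
  qed
  have rng: "a \<le> ln (real m)" "ln (real m) \<le> b" "a \<le> ln (x / m)" "ln (x / m) \<le> b" if "m \<in> {1..Z}" for m
  proof -
    have m: "1 \<le> real m" "real m \<le> Z" using that by auto
    show "a \<le> ln (real m)" using ab m by (meson ln_ge_zero order_trans)
    show "ln (real m) \<le> b" using m by (simp add: b_def)
    show "a \<le> ln (x / m)" unfolding a_def using m x Z by (intro ln_mono divide_left_mono mult_pos_pos) auto
    have "x / m \<le> x / 1" using m x by (intro divide_left_mono) auto
    then show "ln (x / m) \<le> b" unfolding b_def using m x by (intro ln_mono) auto
  qed
  have fS: "(\<Sum>m=1..Z. ln (x / real m) - a) = (\<Sum>m=1..Z. ln (real Z / real m))"
    using x Z by (intro sum.cong refl) (auto simp: a_def ln_div)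
  have S: "(\<Sum>m=1..Z. b - ln (real m)) = (\<Sum>m=1..Z. ln (real Z / real m))"
    using x Z by (intro sum.cong refl) (auto simp: b_def ln_div)
  have harm: "(\<Sum>m=1..Z. x * (1 / m - 1 / Z)) = x * (harm Z - 1)"
    using Z by (simp add: harm_def sum_distrib_left[symmetric] sum_subtractf inverse_eq_divide)
  have harm': "(\<Sum>m=1..Z. x / m - x / Z) = x * (harm Z - 1)"
    unfolding harm[symmetric] by (intro sum.cong refl) (simp add: algebra_simps)
  \<comment> \<open>the four pieces of \<open>(u - 1/2 - floor u) (v - 1/2 - floor v)\<close> at \<open>u = exp y\<close>, \<open>v = x exp (- y)\<close>\<close>
  have I1: "((\<lambda>y. (exp y - 1 / 2) * (x * exp (- y) - 1 / 2)) has_integral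
     ((x + 1 / 4) * (2 * ln Z - ln x) - Z + x / Z)) {a..b}"
  proof -
    have "((\<lambda>y. x + 1 / 4 - exp y / 2 - x * exp (- y) / 2) has_integral
      (((x + 1 / 4) * b - exp b / 2 + x * exp (- b) / 2) - ((x + 1 / 4) * a - exp a / 2 + x * exp (- a) / 2))) {a..b}"
      by (intro fundamental_theorem_of_calculus ab(3))
        (auto intro!: derivative_eq_intros simp flip: has_real_derivative_iff_has_vector_derivative)
    moreover have "x + 1 / 4 - exp y / 2 - x * exp (- y) / 2 = (exp y - 1 / 2) * (x * exp (- y) - 1 / 2)" for y
      by (simp add: algebra_simps exp_minus)
    moreover have "((x + 1 / 4) * b - exp b / 2 + x * exp (- b) / 2) - ((x + 1 / 4) * a - exp a / 2 + x * exp (- a) / 2)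
       = (x + 1 / 4) * (b - a) - Z + x / Z"
      unfolding ea eb using x by (simp add: algebra_simps) (simp add: field_simps)
    ultimately show ?thesis by (simp add: ba)
  qed
  have I2: "((\<lambda>y. F y * (x * exp (- y) - 1 / 2)) has_integral (x * (harm Z - 1) - (\<Sum>m=1..Z. ln (real Z / real m)) / 2)) {a..b}"
  proof -
    have "((\<lambda>y. \<Sum>m=1..Z. if ln (real m) \<le> y \<and> y \<le> b then x * exp (- y) - 1 / 2 else 0) has_integral
       (\<Sum>m=1..Z. x * (1 / m - 1 / Z) - (b - ln (real m)) / 2)) {a..b}"
    proof (intro has_integral_sum has_integral_indicator_interval)
      fix m assume m: "m \<in> {1..Z}"
      have "((\<lambda>y. x * exp (- y) - 1 / 2) has_integral
         ((- x * exp (- b) - b / 2) - (- x * exp (- ln (real m)) - ln (real m) / 2))) {ln (real m)..b}"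
        by (intro fundamental_theorem_of_calculus rng m)
          (auto intro!: derivative_eq_intros simp flip: has_real_derivative_iff_has_vector_derivative)
      moreover have "exp (- ln (real m)) = 1 / m" using m by (simp add: exp_minus inverse_eq_divide)
      ultimately show "((\<lambda>y. x * exp (- y) - 1 / 2) has_integral x * (1 / m - 1 / Z) - (b - ln (real m)) / 2) {ln (real m)..b}"
        unfolding eb by (simp add: algebra_simps diff_divide_distrib)
    qed (use rng in auto)
    moreover have "(\<Sum>m=1..Z. if ln (real m) \<le> y \<and> y \<le> b then x * exp (- y) - 1 / 2 else 0) = F y * (x * exp (- y) - 1 / 2)" for y
      unfolding F_def sum_distrib_right by (intro sum.cong refl) auto
    moreover have "(\<Sum>m=1..Z. x * (1 / m - 1 / Z) - (b - ln (real m)) / 2) = x * (harm Z - 1) - (\<Sum>m=1..Z. ln (real Z / real m)) / 2"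
      unfolding sum_subtractf harm sum_divide_distrib[symmetric] S[unfolded sum_subtractf] ..
    ultimately show ?thesis by simp
  qed
  have I3: "((\<lambda>y. (exp y - 1 / 2) * G y) has_integral (x * (harm Z - 1) - (\<Sum>m=1..Z. ln (real Z / real m)) / 2)) {a..b}"
  proof -
    have "((\<lambda>y. \<Sum>n=1..Z. if a \<le> y \<and> y \<le> ln (x / n) then exp y - 1 / 2 else 0) has_integral
       (\<Sum>n=1..Z. (x / n - x / Z) - (ln (x / n) - a) / 2)) {a..b}"
    proof (intro has_integral_sum has_integral_indicator_interval)
      fix n assume n: "n \<in> {1..Z}"
      have "((\<lambda>y. exp y - 1 / 2) has_integral
         ((exp (ln (x / n)) - ln (x / n) / 2) - (exp a - a / 2))) {a..ln (x / n)}"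
        by (intro fundamental_theorem_of_calculus rng n)
          (auto intro!: derivative_eq_intros simp flip: has_real_derivative_iff_has_vector_derivative)
      moreover have "exp (ln (x / n)) = x / n" using n x by simp
      ultimately show "((\<lambda>y. exp y - 1 / 2) has_integral (x / n - x / Z) - (ln (x / n) - a) / 2) {a..ln (x / n)}"
        unfolding ea by (simp add: algebra_simps diff_divide_distrib)
    qed (use rng in auto)
    moreover have "(\<Sum>n=1..Z. if a \<le> y \<and> y \<le> ln (x / n) then exp y - 1 / 2 else 0) = (exp y - 1 / 2) * G y" for y
      unfolding G_def sum_distrib_left by (intro sum.cong refl) auto
    moreover have "(\<Sum>n=1..Z. (x / n - x / Z) - (ln (x / n) - a) / 2) = x * (harm Z - 1) - (\<Sum>m=1..Z. ln (real Z / real m)) / 2"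
      unfolding sum_subtractf[where f = "\<lambda>n. x / real n - x / real Z"] harm' sum_divide_distrib[symmetric] fS ..
    ultimately show ?thesis by simp
  qed
  have I4: "((\<lambda>y. F y * G y) has_integral log_divisor_sum x) {a..b}"
  proof -
    have "((\<lambda>y. \<Sum>m=1..Z. \<Sum>n=1..Z. if ln (real m) \<le> y \<and> y \<le> ln (x / n) then 1 else 0) has_integral
       (\<Sum>m=1..Z. \<Sum>n=1..Z. if real (m * n) \<le> x then ln (x / real (m * n)) else 0)) {a..b}"
    proof (intro has_integral_sum has_integral_indicator_interval)
      fix m n assume m: "m \<in> {1..Z}" and n: "n \<in> {1..Z}"
      have pos: "real m > 0" "real n > 0" using m n by auto
      have A: "ln (x / n) - ln (real m) = ln (x / real (m * n))"
        using pos x by (simp add: ln_div ln_mult)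
      have B: "ln (real m) \<le> ln (x / n) \<longleftrightarrow> real (m * n) \<le> x"
        using pos x by (simp add: field_simps)
      have "((\<lambda>y. 1) has_integral (if ln (real m) \<le> ln (x / n) then ln (x / n) - ln (real m) else 0)) {ln (real m)..ln (x / n)}"
        using has_integral_const_real[of "1::real" "ln (real m)" "ln (x / n)"] by (auto simp: content_real_if split: if_splits)
      then show "((\<lambda>y. 1) has_integral (if real (m * n) \<le> x then ln (x / real (m * n)) else 0)) {ln (real m)..ln (x / n)}"
        unfolding A B .
    qed (use rng in auto)
    moreover have "(\<Sum>m=1..Z. \<Sum>n=1..Z. if ln (real m) \<le> y \<and> y \<le> ln (x / n) then 1 else 0) = F y * G y" if "y \<in> {a..b}" for y
      unfolding F_def G_def sum_product using that by (intro sum.cong refl) auto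
    ultimately show ?thesis
      unfolding sum_hyperbola_eq[OF x(2)] by (subst has_integral_cong[symmetric]) auto
  qed
  have "((\<lambda>y. (exp y - 1 / 2) * (x * exp (- y) - 1 / 2) - F y * (x * exp (- y) - 1 / 2) - (exp y - 1 / 2) * G y + F y * G y)
     has_integral (((x + 1 / 4) * (2 * ln Z - ln x) - Z + x / Z) - (x * (harm Z - 1) - (\<Sum>m=1..Z. ln (real Z / real m)) / 2)
       - (x * (harm Z - 1) - (\<Sum>m=1..Z. ln (real Z / real m)) / 2) + log_divisor_sum x)) {a..b}"
    by (intro has_integral_add has_integral_diff I1 I2 I3 I4)
  moreover have "sawtooth (exp y) * sawtooth (x * exp (- y)) =
    (exp y - 1 / 2) * (x * exp (- y) - 1 / 2) - F y * (x * exp (- y) - 1 / 2) - (exp y - 1 / 2) * G y + F y * G y"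
    if "y \<in> {a..b}" for y
    unfolding sawtooth_def frac_def fl1[OF that] fl2[OF that] by (simp add: algebra_simps)
  ultimately have "((\<lambda>y. sawtooth (exp y) * sawtooth (x * exp (- y))) has_integral
     (((x + 1 / 4) * (2 * ln Z - ln x) - Z + x / Z) - (x * (harm Z - 1) - (\<Sum>m=1..Z. ln (real Z / real m)) / 2)
       - (x * (harm Z - 1) - (\<Sum>m=1..Z. ln (real Z / real m)) / 2) + log_divisor_sum x)) {a..b}"
    by (subst has_integral_cong) auto
  then show ?thesis
    unfolding sawtooth_corr_def a_def b_def by (simp add: integral_unique algebra_simps)
qed

section \<open>The Voronoi formula for the logarithmic mean\<close>

definition sine_corr :: "nat \<Rightarrow> nat \<Rightarrow> nat \<Rightarrow> real \<Rightarrow> real" where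
  "sine_corr Z k l x = integral {ln (x / Z)..ln Z} (\<lambda>y. sin (2 * pi * real k * exp y) * sin (2 * pi * real l * (x * exp (- y))))"

text \<open>An iterated sum in the order in which the two sawtooth functions get expanded; it is
  regrouped over n = k l in \<open>voronoi_sum_has_sum\<close>. Terms with index 0 vanish by
  division by zero.\<close>

definition voronoi_sum :: "real \<Rightarrow> real" where
  "voronoi_sum x = (\<Sum>k. (\<Sum>l. kernel_limit (2 * pi * sqrt (real k * real l * x)) / (pi * real l)) / (pi * real k))"

text \<open>The translation by \<open>c\<close> moves the origin to the point where
  \<open>k * exp y = l * x * exp (- y)\<close>. There both arguments equal 2 pi times the geometric
  mean \<open>sqrt (k * l * x)\<close>, which becomes the single parameter of the kernel.\<close>

lemma sine_corr_eq:
  assumes x: "x > 0" and k: "k > 0" and l: "l > 0"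
  defines "c \<equiv> ln (real l * x / real k) / 2"
  shows "sine_corr Z k l x = integral {ln (x / Z) - c..ln Z - c} (kernel_integrand (2 * pi * sqrt (real k * real l * x)))"
proof -
  define w where "w = real l * x / real k"
  have w: "w > 0" using assms by (simp add: w_def)
  have ec: "exp c = sqrt w"
    unfolding c_def w_def[symmetric] using w by (simp add: ln_sqrt[symmetric])
  have 1: "sqrt (real k * real l * x) = real k * sqrt w" "sqrt (real k * real l * x) * sqrt w = real l * x"
  proof -
    have "real k * real l * x = (real k)\<^sup>2 * w" using k by (simp add: w_def power2_eq_square)
    then show *: "sqrt (real k * real l * x) = real k * sqrt w" by (simp add: real_sqrt_mult)
    show "sqrt (real k * real l * x) * sqrt w = real l * x"
    proof -
      have "sqrt (real k * real l * x) * sqrt w = real k * w" unfolding * using w by (simp add: mult.assoc)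
      then show ?thesis using k by (simp add: w_def)
    qed
  qed
  have "kernel_integrand (2 * pi * sqrt (real k * real l * x)) (y + - c) =
     sin (2 * pi * real k * exp y) * sin (2 * pi * real l * (x * exp (- y)))" for y
  proof -
    have "2 * pi * sqrt (real k * real l * x) * exp (y + - c) = 2 * pi * real k * exp y"
      using w by (simp add: exp_diff ec 1(1))
    moreover have "2 * pi * sqrt (real k * real l * x) * exp (- (y + - c)) = 2 * pi * (sqrt (real k * real l * x) * sqrt w) * exp (- y)"
      by (simp add: exp_diff exp_minus ec divide_inverse)
    ultimately show ?thesis unfolding kernel_integrand_def 1(2) by (simp add: mult.assoc)
  qed
  then have "sine_corr Z k l x = integral {ln (x / Z)..ln Z} (kernel_integrand (2 * pi * sqrt (real k * real l * x)) \<circ> (\<lambda>y. y + - c))"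
    unfolding sine_corr_def o_def by presburger
  also have "\<dots> = integral {ln (x / Z) + - c..ln Z + - c} (kernel_integrand (2 * pi * sqrt (real k * real l * x)))"
    by (intro integral_shift continuous_intros)
  finally show ?thesis by simp
qed

lemma voronoi_argument_ge_1:
  assumes "x \<ge> 1" "k > 0" "l > 0"
  shows "1 \<le> 2 * pi * sqrt (real k * real l * x)"
proof -
  have "1 \<le> real k * real l" using assms by (metis One_nat_def Suc_leI mult_pos_pos nat_0_less_mult_iff of_nat_1 of_nat_le_iff of_nat_mult)
  then have "1 * 1 \<le> real k * real l * x" using assms by (intro mult_mono) auto
  then have "1 \<le> sqrt (real k * real l * x)" by simp
  moreover have "1 \<le> 2 * pi" using pi_gt3 by simp
  ultimately show ?thesis using mult_mono[of 1 "2 * pi" 1 "sqrt (real k * real l * x)"] by simp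
qed

lemma powr_quarter: "x \<ge> 0 \<Longrightarrow> sqrt (sqrt x) = x powr (1 / 4)"
  by (simp add: powr_half_sqrt[symmetric] powr_powr)

text \<open>The parameter of the kernel is at least sqrt (k l), so the bound by its inverse square
  root gives (k l)^(-1/4), uniformly in \<open>Z\<close> and \<open>x\<close>. Divided by k l this
  becomes the summable majorant (k l)^(-5/4) for every later interchange of limits. For index 0 both
  sides are 0.\<close>

lemma sine_corr_bound:
  assumes x: "x \<ge> 1"
  shows "\<bar>sine_corr Z k l x\<bar> \<le> 4 * real k powr (- 1 / 4) * real l powr (- 1 / 4)"
proof (cases "k = 0 \<or> l = 0")
  case False
  then have kl: "k > 0" "l > 0" by auto
  define z where "z = 2 * pi * sqrt (real k * real l * x)"
  have z: "z \<ge> 1" unfolding z_def by (rule voronoi_argument_ge_1[OF x kl])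
  have "\<bar>sine_corr Z k l x\<bar> \<le> 4 / sqrt z"
    using sine_corr_eq[of x k l] kernel_integral_bound[OF z] x kl by (simp add: z_def)
  also have "\<dots> \<le> 4 / sqrt (sqrt (real k * real l))"
  proof -
    have "sqrt (real k * real l) * 1 \<le> sqrt (real k * real l) * sqrt x" using x by (intro mult_left_mono) auto
    also have "\<dots> = 1 * sqrt (real k * real l * x)" by (simp add: real_sqrt_mult)
    also have "\<dots> \<le> z" unfolding z_def using pi_gt3 x by (intro mult_right_mono) auto
    finally show ?thesis using kl z by (intro divide_left_mono mult_pos_pos) auto
  qed
  also have "\<dots> = 4 * real k powr (- 1 / 4) * real l powr (- 1 / 4)"
    by (simp add: powr_quarter powr_mult powr_minus field_simps)
  finally show ?thesis .
qed (auto simp: sine_corr_def)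

lemma powr_divide_nat: "real n powr a / real n = real n powr (a - 1)"
  by (cases "n = 0") (auto simp: powr_diff)

lemma summable_powr_5_4: "summable (\<lambda>n. real n powr (- 5 / 4))"
  by (simp add: summable_real_powr_iff)

lemma div_pi_le: "a \<ge> 0 \<Longrightarrow> a / (pi * real n) \<le> a / real n"
  using pi_gt3 by (cases "n = 0") (auto intro!: divide_left_mono simp: mult_less_cancel_right1 mult_le_cancel_right1)

lemma sine_corr_term_bound:
  assumes x: "x \<ge> 1"
  shows "\<bar>sine_corr Z k l x / (pi * real l)\<bar> \<le> 4 * real k powr (- 1 / 4) * real l powr (- 5 / 4)"
proof -
  have "\<bar>sine_corr Z k l x / (pi * real l)\<bar> = \<bar>sine_corr Z k l x\<bar> / (pi * real l)" by (simp add: abs_mult)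
  also have "\<dots> \<le> \<bar>sine_corr Z k l x\<bar> / real l" by (rule div_pi_le) simp
  also have "\<dots> \<le> (4 * real k powr (- 1 / 4) * real l powr (- 1 / 4)) / real l"
    by (intro divide_right_mono sine_corr_bound x) auto
  also have "\<dots> = 4 * real k powr (- 1 / 4) * (real l powr (- 1 / 4) / real l)" by simp
  also have "\<dots> = 4 * real k powr (- 1 / 4) * real l powr (- 5 / 4)" by (simp add: powr_divide_nat)
  finally show ?thesis .
qed

definition zeta_5_4 :: real where "zeta_5_4 = (\<Sum>l. real l powr (- 5 / 4))"

lemma sine_corr_inner:
  assumes x: "x \<ge> 1"
  shows "summable (\<lambda>l. \<bar>sine_corr Z k l x / (pi * real l)\<bar>)"
    "\<bar>\<Sum>l. sine_corr Z k l x / (pi * real l)\<bar> \<le> 4 * real k powr (- 1 / 4) * zeta_5_4"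
proof -
  have s: "summable (\<lambda>l. 4 * real k powr (- 1 / 4) * real l powr (- 5 / 4))"
    by (intro summable_mult summable_powr_5_4)
  show 1: "summable (\<lambda>l. \<bar>sine_corr Z k l x / (pi * real l)\<bar>)"
    by (rule summable_comparison_test'[OF s, of 0]) (use sine_corr_term_bound[OF x] in simp)
  have "\<bar>\<Sum>l. sine_corr Z k l x / (pi * real l)\<bar> \<le> (\<Sum>l. \<bar>sine_corr Z k l x / (pi * real l)\<bar>)"
    by (rule summable_rabs[OF 1])
  also have "\<dots> \<le> (\<Sum>l. 4 * real k powr (- 1 / 4) * real l powr (- 5 / 4))"
    by (intro suminf_le 1 s sine_corr_term_bound x)
  also have "\<dots> = 4 * real k powr (- 1 / 4) * zeta_5_4"
    unfolding zeta_5_4_def by (rule suminf_mult[OF summable_powr_5_4])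
  finally show "\<bar>\<Sum>l. sine_corr Z k l x / (pi * real l)\<bar> \<le> 4 * real k powr (- 1 / 4) * zeta_5_4" .
qed

lemma sine_corr_outer_bound:
  assumes x: "x \<ge> 1"
  shows "\<bar>(\<Sum>l. sine_corr Z k l x / (pi * real l)) / (pi * real k)\<bar> \<le> 4 * zeta_5_4 * real k powr (- 5 / 4)"
proof -
  have "\<bar>(\<Sum>l. sine_corr Z k l x / (pi * real l)) / (pi * real k)\<bar> = \<bar>\<Sum>l. sine_corr Z k l x / (pi * real l)\<bar> / (pi * real k)"
    by (simp add: abs_mult)
  also have "\<dots> \<le> \<bar>\<Sum>l. sine_corr Z k l x / (pi * real l)\<bar> / real k" by (rule div_pi_le) simp
  also have "\<dots> \<le> (4 * real k powr (- 1 / 4) * zeta_5_4) / real k"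
    by (intro divide_right_mono sine_corr_inner x) auto
  also have "\<dots> = 4 * zeta_5_4 * (real k powr (- 1 / 4) / real k)" by simp
  also have "\<dots> = 4 * zeta_5_4 * real k powr (- 5 / 4)" by (simp add: powr_divide_nat)
  finally show ?thesis .
qed

text \<open>\<open>integral_sawtooth_series\<close> is applied to one factor at a time: first with a
  sine as the other factor, then with the other sawtooth. The two minus signs cancel, and the
  exceptional sets are countable.\<close>

lemma sawtooth_corr_series:
  assumes x: "x \<ge> 1"
  shows "sawtooth_corr Z x = (\<Sum>k. (\<Sum>l. sine_corr Z k l x / (pi * real l)) / (pi * real k))"
proof -
  define a b where "a = ln (x / Z)" and "b = ln (real Z)"
  have inner: "integral {a..b} (\<lambda>y. sin (2 * pi * real k * exp y) * sawtooth (x * exp (- y)))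
     = - (\<Sum>l. sine_corr Z k l x / (pi * real l))" for k
  proof -
    have "integral {a..b} (\<lambda>y. sawtooth (x * exp (- y)) * sin (2 * pi * real k * exp y)) =
      - (\<Sum>l. integral {a..b} (\<lambda>y. sin (2 * pi * real l * (x * exp (- y))) * sin (2 * pi * real k * exp y)) / (pi * real l))"
    proof (rule integral_sawtooth_series)
      show "continuous_on UNIV (\<lambda>y. x * exp (- y))" by (intro continuous_intros)
      show "(\<lambda>y. sin (2 * pi * real k * exp y)) \<in> borel_measurable borel" by measurable
      have "{y \<in> {a..b}. x * exp (- y) \<in> \<int>} \<subseteq> (\<lambda>n. ln (x / of_int n)) ` UNIV"
      proof
        fix y assume "y \<in> {y \<in> {a..b}. x * exp (- y) \<in> \<int>}"
        then obtain n where "x * exp (- y) = of_int n" by (auto elim: Ints_cases)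
        then have "x / of_int n = exp y" using x by (cases "n = 0") (auto simp: exp_minus field_simps)
        then show "y \<in> (\<lambda>n. ln (x / of_int n)) ` UNIV" by (metis ln_exp rangeI)
      qed
      then show "negligible {y \<in> {a..b}. x * exp (- y) \<in> \<int>}"
        using countable_subset[OF _ countable_image] by (intro countable_imp_null_set_lborel[THEN null_sets_completionI, folded negligible_iff_null_sets]) blast
      have eq: "\<bar>integral {a..b} (\<lambda>y. sin (2 * pi * real l * (x * exp (- y))) * sin (2 * pi * real k * exp y))\<bar> / real l =
         pi * \<bar>sine_corr Z k l x / (pi * real l)\<bar>" for l
        unfolding sine_corr_def a_def[symmetric] b_def[symmetric] by (simp add: abs_mult mult.commute)
      show "summable (\<lambda>l. \<bar>integral {a..b} (\<lambda>y. sin (2 * pi * real l * (x * exp (- y))) * sin (2 * pi * real k * exp y))\<bar> / real l)"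
        unfolding eq by (rule summable_mult[OF sine_corr_inner(1)[OF x]])
    qed (rule abs_sin_le_one)
    then show ?thesis unfolding sine_corr_def a_def[symmetric] b_def[symmetric] by (simp add: mult.commute)
  qed
  have "integral {a..b} (\<lambda>y. sawtooth (exp y) * sawtooth (x * exp (- y))) =
      - (\<Sum>k. integral {a..b} (\<lambda>y. sin (2 * pi * real k * exp y) * sawtooth (x * exp (- y))) / (pi * real k))"
  proof (rule integral_sawtooth_series)
    show "continuous_on UNIV (\<lambda>y::real. exp y)" by (intro continuous_intros)
    show "(\<lambda>y. sawtooth (x * exp (- y))) \<in> borel_measurable borel" by measurable
    have "{y \<in> {a..b}. exp y \<in> \<int>} \<subseteq> (\<lambda>n. ln (of_int n)) ` UNIV"
    proof
      fix y assume "y \<in> {y \<in> {a..b}. exp y \<in> \<int>}"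
      then obtain n where "exp y = of_int n" by (auto elim: Ints_cases)
      then show "y \<in> (\<lambda>n. ln (of_int n)) ` UNIV" by (metis ln_exp rangeI)
    qed
    then show "negligible {y \<in> {a..b}. exp y \<in> \<int>}"
      using countable_subset[OF _ countable_image] by (intro countable_imp_null_set_lborel[THEN null_sets_completionI, folded negligible_iff_null_sets]) blast
    have "summable (\<lambda>k. pi * (4 * zeta_5_4 * real k powr (- 5 / 4)))"
      by (intro summable_mult summable_powr_5_4)
    then show "summable (\<lambda>k. \<bar>integral {a..b} (\<lambda>y. sin (2 * pi * real k * exp y) * sawtooth (x * exp (- y)))\<bar> / real k)"
    proof (rule summable_comparison_test'[where N = 0])
      fix k
      have "\<bar>\<Sum>l. sine_corr Z k l x / (pi * real l)\<bar> / real k = pi * \<bar>(\<Sum>l. sine_corr Z k l x / (pi * real l)) / (pi * real k)\<bar>"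
        by (simp add: abs_mult)
      also have "\<dots> \<le> pi * (4 * zeta_5_4 * real k powr (- 5 / 4))"
        by (intro mult_left_mono sine_corr_outer_bound x) auto
      finally show "norm (\<bar>integral {a..b} (\<lambda>y. sin (2 * pi * real k * exp y) * sawtooth (x * exp (- y)))\<bar> / real k)
        \<le> pi * (4 * zeta_5_4 * real k powr (- 5 / 4))"
        unfolding inner by simp
    qed
  qed (rule abs_sawtooth_le)
  also have "\<dots> = (\<Sum>k. (\<Sum>l. sine_corr Z k l x / (pi * real l)) / (pi * real k))"
  proof -
    have "summable (\<lambda>k. (\<Sum>l. sine_corr Z k l x / (pi * real l)) / (pi * real k))"
      by (rule summable_comparison_test'[OF summable_mult[OF summable_powr_5_4], of 0])
        (use sine_corr_outer_bound[OF x] in auto)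
    then show ?thesis unfolding inner by (simp add: suminf_minus)
  qed
  finally show ?thesis unfolding sawtooth_corr_def a_def[symmetric] b_def[symmetric] .
qed

lemma sawtooth_corr_tendsto:
  assumes x: "x \<ge> 1"
  shows "(\<lambda>Z. sawtooth_corr Z x) \<longlonglongrightarrow> voronoi_sum x"
proof -
  have trm: "(\<lambda>Z. sine_corr Z k l x / (pi * real l)) \<longlonglongrightarrow> kernel_limit (2 * pi * sqrt (real k * real l * x)) / (pi * real l)"
    if k: "k > 0" for k l
  proof (cases "l = 0")
    case False
    define c where "c = ln (real l * x / real k) / 2"
    define z where "z = 2 * pi * sqrt (real k * real l * x)"
    have z: "z \<ge> 1" unfolding z_def using voronoi_argument_ge_1[OF x k] False by simp
    \<comment> \<open>The shift \<open>c\<close> depends on the frequencies but not on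
      \<open>Z\<close>, so both endpoints still run to infinity and the limit does not see
      it.\<close>
    have "(\<lambda>Z. integral {- (ln (real Z) - ln x + c)..ln (real Z) - c} (kernel_integrand z)) \<longlonglongrightarrow> kernel_limit z"
    proof (rule kernel_integral_tendsto[OF z])
      show "filterlim (\<lambda>Z. ln (real Z) - ln x + c) at_top sequentially" by real_asymp
      show "filterlim (\<lambda>Z. ln (real Z) - c) at_top sequentially" by real_asymp
    qed
    moreover have "eventually (\<lambda>Z. integral {- (ln (real Z) - ln x + c)..ln (real Z) - c} (kernel_integrand z) = sine_corr Z k l x) sequentially"
      using eventually_gt_at_top[of 0]
    proof eventually_elim
      case (elim Z)
      have "ln (x / real Z) - c = - (ln (real Z) - ln x + c)" using elim x by (simp add: ln_div)
      then show ?case using sine_corr_eq[of x k l Z] x k False by (simp add: c_def z_def)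
    qed
    ultimately have "(\<lambda>Z. sine_corr Z k l x) \<longlonglongrightarrow> kernel_limit z" by (rule Lim_transform_eventually)
    then show ?thesis unfolding z_def using False by (intro tendsto_intros) auto
  qed simp
  have inner: "(\<lambda>Z. \<Sum>l. sine_corr Z k l x / (pi * real l)) \<longlonglongrightarrow>
      (\<Sum>l. kernel_limit (2 * pi * sqrt (real k * real l * x)) / (pi * real l))" if k: "k > 0" for k
  proof (rule tannerys_theorem[THEN conjunct2, THEN conjunct2])
    show "\<forall>\<^sub>F (l, Z) in at_top \<times>\<^sub>F sequentially. norm (sine_corr Z k l x / (pi * real l)) \<le> 4 * real k powr (- 1 / 4) * real l powr (- 5 / 4)"
      using sine_corr_term_bound[OF x] by (intro always_eventually) auto
    show "summable (\<lambda>l. 4 * real k powr (- 1 / 4) * real l powr (- 5 / 4))"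
      by (intro summable_mult summable_powr_5_4)
  qed (use trm[OF k] in auto)
  have "(\<lambda>Z. \<Sum>k. (\<Sum>l. sine_corr Z k l x / (pi * real l)) / (pi * real k)) \<longlonglongrightarrow> voronoi_sum x"
    unfolding voronoi_sum_def
  proof (rule tannerys_theorem[THEN conjunct2, THEN conjunct2])
    show "\<forall>\<^sub>F (k, Z) in at_top \<times>\<^sub>F sequentially. norm ((\<Sum>l. sine_corr Z k l x / (pi * real l)) / (pi * real k)) \<le> 4 * zeta_5_4 * real k powr (- 5 / 4)"
      using sine_corr_outer_bound[OF x] by (intro always_eventually) auto
    show "summable (\<lambda>k. 4 * zeta_5_4 * real k powr (- 5 / 4))"
      by (intro summable_mult summable_powr_5_4)
    show "(\<lambda>Z. (\<Sum>l. sine_corr Z k l x / (pi * real l)) / (pi * real k)) \<longlonglongrightarrow>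
      (\<Sum>l. kernel_limit (2 * pi * sqrt (real k * real l * x)) / (pi * real l)) / (pi * real k)" for k
      by (cases "k = 0") (auto intro!: tendsto_divide inner)
  qed auto
  then show ?thesis unfolding sawtooth_corr_series[OF x] .
qed

text \<open>Subtracting the identity at x = 1 removes the terms that depend on \<open>Z\<close>
  alone, so no Stirling formula is required; they survive only in the unspecified constant
  \<open>C\<close>, which cancels in increments. Euler's constant enters through
  \<open>harm Z - ln Z\<close>.\<close>

theorem log_divisor_sum_voronoi:
  "\<exists>C. \<forall>x\<ge>1. log_divisor_sum x = x * ln x + (2 * euler_mascheroni - 2) * x + ln x / 4 + C + voronoi_sum x"
proof -
  define W where "W = (\<lambda>x. log_divisor_sum x - x * ln x - ln x / 4 + 2 * x - 2 * x * euler_mascheroni)"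
  have "voronoi_sum x - voronoi_sum 1 = W x - W 1" if x: "x \<ge> 1" for x
  proof (rule LIMSEQ_unique)
    show "(\<lambda>Z. sawtooth_corr Z x - sawtooth_corr Z 1) \<longlonglongrightarrow> voronoi_sum x - voronoi_sum 1"
      by (intro tendsto_diff sawtooth_corr_tendsto x) auto
    define U where "U = (\<lambda>x Z. log_divisor_sum x - x * ln x - ln x / 4 + 2 * x - 2 * x * (harm Z - ln (real Z)) + x / real Z)"
    have U: "U y \<longlonglongrightarrow> W y" for y
    proof -
      have "(\<lambda>Z. y / real Z) \<longlonglongrightarrow> 0" by real_asymp
      then have "U y \<longlonglongrightarrow> log_divisor_sum y - y * ln y - ln y / 4 + 2 * y - 2 * y * euler_mascheroni + 0"
        unfolding U_def by (intro tendsto_intros euler_mascheroni_LIMSEQ)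
      then show ?thesis by (simp add: W_def)
    qed
    have "(\<lambda>Z. U x Z - U 1 Z) \<longlonglongrightarrow> W x - W 1" by (intro tendsto_diff U)
    moreover have "eventually (\<lambda>Z. U x Z - U 1 Z = sawtooth_corr Z x - sawtooth_corr Z 1) sequentially"
      using eventually_ge_at_top[of "nat \<lceil>x\<rceil>"]
    proof eventually_elim
      case (elim Z)
      then have "x \<le> real Z" by linarith
      then show ?case using sawtooth_corr_eq[OF x, of Z] sawtooth_corr_eq[of 1 Z] x unfolding U_def by simp
    qed
    ultimately show "(\<lambda>Z. sawtooth_corr Z x - sawtooth_corr Z 1) \<longlonglongrightarrow> W x - W 1"
      by (rule Lim_transform_eventually)
  qed
  then have "\<forall>x\<ge>1. log_divisor_sum x = x * ln x + (2 * euler_mascheroni - 2) * x + ln x / 4 + (W 1 - voronoi_sum 1) + voronoi_sum x"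
    by (simp add: W_def algebra_simps)
  then show ?thesis by blast
qed

section \<open>Dirichlet series of products of divisor functions\<close>

lemma has_sum_nonneg_product:
  fixes f :: "'a \<Rightarrow> real" and g :: "'b \<Rightarrow> real"
  assumes f: "(f has_sum a) A" and g: "(g has_sum b) B"
    and nonneg: "\<And>x. x \<in> A \<Longrightarrow> f x \<ge> 0" "\<And>y. y \<in> B \<Longrightarrow> g y \<ge> 0"
  shows "((\<lambda>(x, y). f x * g y) has_sum (a * b)) (A \<times> B)"
proof (rule has_sum_SigmaI[where g = "\<lambda>x. f x * b"])
  show 1: "((\<lambda>y. case (x, y) of (x, y) \<Rightarrow> f x * g y) has_sum f x * b) B" for x
    using has_sum_cmult_right[OF g, of "f x"] by simp
  show 2: "((\<lambda>x. f x * b) has_sum a * b) A" by (rule has_sum_cmult_left[OF f])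
  show "(\<lambda>(x, y). f x * g y) summable_on A \<times> B"
    using 1 has_sum_imp_summable[OF 2] nonneg by (intro summable_on_SigmaI[where g = "\<lambda>x. f x * b"]) auto
qed

lemma zeta_real_has_sum:
  assumes s: "s > 1"
  shows "((\<lambda>n. real n powr - s) has_sum zeta_real s) {1..}"
proof -
  have "summable (\<lambda>n. real n powr - s)" using s by (simp add: summable_real_powr_iff)
  then have "summable (\<lambda>n. real (Suc n) powr - s)" by (subst summable_Suc_iff)
  then have "((\<lambda>n. real (Suc n) powr - s) has_sum (\<Sum>n. real (Suc n) powr - s)) UNIV"
    by (intro norm_summable_imp_has_sum) auto
  moreover have "(\<Sum>n. real (Suc n) powr - s) = zeta_real s"
    by (simp add: zeta_real_def powr_minus inverse_eq_divide)
  ultimately show ?thesis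
    by (subst has_sum_reindex_bij_witness[where i = Suc and j = "\<lambda>n. n - 1" and T = UNIV]) auto
qed

lemma zeta_real_pos:
  assumes "s > 1"
  shows "zeta_real s > 0"
proof -
  have "((\<lambda>n. real n powr - s) has_sum 1) {1::nat}"
    using has_sum_finite[of "{1::nat}" "\<lambda>n. real n powr - s"] by simp
  then have "1 \<le> zeta_real s"
    using zeta_real_has_sum[OF assms] by (rule has_sum_mono2) auto
  then show ?thesis by simp
qed

text \<open>Unconditional summability permits grouping the pairs by their product n; the pairs (k,
  l) with product n are indexed by the divisor k.\<close>

lemma has_sum_divisor_tau:
  fixes F :: "nat \<Rightarrow> real"
  assumes "((\<lambda>(k, l). F (k * l)) has_sum S) ({1..} \<times> {1..})"
  shows "((\<lambda>n. real (divisor_tau n) * F n) has_sum S) {1..}"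
proof -
  have "((\<lambda>(n, d). F n) has_sum S) (Sigma {1..} (\<lambda>n. {d. d dvd n}))"
  proof (subst has_sum_reindex_bij_witness[where i = "\<lambda>(k, l). (k * l, k)" and j = "\<lambda>(n, d). (d, n div d)"
        and T = "{1..} \<times> {1..}" and h = "\<lambda>(k, l). F (k * l)"])
    fix a :: "nat \<times> nat" assume "a \<in> Sigma {1..} (\<lambda>n. {d. d dvd n})"
    then obtain n d where a: "a = (n, d)" "n \<ge> 1" "d dvd n" by auto
    then obtain e where e: "n = d * e" by (auto elim: dvdE)
    then have "d \<noteq> 0" "e \<noteq> 0" using a by (metis mult_is_0 not_one_le_zero)+
    then have "d \<ge> 1" "e \<ge> 1" by auto
    then show "(case case a of (n, d) \<Rightarrow> (d, n div d) of (k, l) \<Rightarrow> (k * l, k)) = a"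
      "(case a of (n, d) \<Rightarrow> (d, n div d)) \<in> {1..} \<times> {1..}"
      "(case case a of (n, d) \<Rightarrow> (d, n div d) of (k, l) \<Rightarrow> F (k * l)) = (case a of (n, d) \<Rightarrow> F n)"
      using a e by auto
  qed (use assms in auto)
  then show ?thesis
  proof (rule has_sum_SigmaD)
    fix n :: nat assume "n \<in> {1..}"
    then have "finite {d. d dvd n}" by simp
    from has_sum_finite[OF this, of "\<lambda>_. F n"]
    show "((\<lambda>d. case (n, d) of (n, d) \<Rightarrow> F n) has_sum real (divisor_tau n) * F n) {d. d dvd n}"
      by (simp add: divisor_tau_def)
  qed
qed

lemma divisor_tau_has_sum:
  assumes "s > 1"
  shows "((\<lambda>n. real (divisor_tau n) * real n powr - s) has_sum (zeta_real s)\<^sup>2) {1..}"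
proof (rule has_sum_divisor_tau)
  have "((\<lambda>(k, l). real k powr - s * real l powr - s) has_sum (zeta_real s * zeta_real s)) ({1..} \<times> {1..})"
    by (intro has_sum_nonneg_product zeta_real_has_sum assms) auto
  then show "((\<lambda>(k, l). real (k * l) powr - s) has_sum (zeta_real s)\<^sup>2) ({1..} \<times> {1..})"
    by (simp add: powr_mult power2_eq_square)
qed

definition coprime_pairs :: "(nat \<times> nat) set" where
  "coprime_pairs = {(a, b). a \<ge> 1 \<and> b \<ge> 1 \<and> coprime a b}"

text \<open>\<open>\<tau>(n)\<^sup>2\<close> counts pairs of divisors of \<open>n\<close>, i.e. pairs whose least common multiple divides \<open>n\<close>.
  Writing such a pair as \<open>(g a, g b)\<close> with \<open>a, b\<close> coprime gives \<open>n = q g a b\<close>, whereas all pairs of positive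
  integers give \<open>\<zeta>(s)\<^sup>2 = \<zeta>(2s) \<Sum> (a b)\<^bsup>-s\<^esup>\<close> over coprime pairs.\<close>

lemma coprime_pairs_has_sum:
  assumes s: "s > 1"
  shows "((\<lambda>(a, b). (real a * real b) powr - s) has_sum ((zeta_real s)\<^sup>2 / zeta_real (2 * s))) coprime_pairs"
proof -
  let ?f = "\<lambda>(a, b). (real a * real b) powr - s"
  have all: "(?f has_sum (zeta_real s)\<^sup>2) ({1..} \<times> {1..})"
  proof -
    have "((\<lambda>(k, l). real k powr - s * real l powr - s) has_sum (zeta_real s * zeta_real s)) ({1..} \<times> {1..})"
      by (intro has_sum_nonneg_product zeta_real_has_sum assms) auto
    then show ?thesis by (simp add: powr_mult power2_eq_square)
  qed
  have "?f summable_on coprime_pairs"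
    by (rule summable_on_subset[OF has_sum_imp_summable[OF all]]) (auto simp: coprime_pairs_def)
  then obtain C where C: "(?f has_sum C) coprime_pairs" by (auto simp: summable_on_def)
  have "((\<lambda>(g, p). real g powr - (2 * s) * ?f p) has_sum (zeta_real (2 * s) * C)) ({1..} \<times> coprime_pairs)"
    by (intro has_sum_nonneg_product zeta_real_has_sum C) (use s in auto)
  also have "?this \<longleftrightarrow> (?f has_sum (zeta_real (2 * s) * C)) ({1..} \<times> {1..})"
  proof (rule has_sum_reindex_bij_witness[where j = "\<lambda>(g, a, b). (g * a, g * b)"
        and i = "\<lambda>(u, v). (gcd u v, u div gcd u v, v div gcd u v)"])
    fix x :: "nat \<times> nat \<times> nat" assume "x \<in> {1..} \<times> coprime_pairs"
    then obtain g a b where x: "x = (g, a, b)" "g \<ge> 1" "a \<ge> 1" "b \<ge> 1" "coprime a b"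
      by (auto simp: coprime_pairs_def)
    have "gcd (g * a) (g * b) = g" using x by (simp add: gcd_mult_left)
    then show "(case case x of (g, a, b) \<Rightarrow> (g * a, g * b) of (u, v) \<Rightarrow> (gcd u v, u div gcd u v, v div gcd u v)) = x"
      using x by simp
    show "(case x of (g, a, b) \<Rightarrow> (g * a, g * b)) \<in> {1..} \<times> {1..}" using x by (simp add: Suc_le_eq)
    have "real g powr - (2 * s) = real g powr - s * real g powr - s" by (simp flip: powr_add)
    then show "(case case x of (g, a, b) \<Rightarrow> (g * a, g * b) of (a, b) \<Rightarrow> (real a * real b) powr - s) =
         (case x of (g, p) \<Rightarrow> real g powr - (2 * s) * (case p of (a, b) \<Rightarrow> (real a * real b) powr - s))"
      using x by (simp add: powr_mult)
  next
    fix y :: "nat \<times> nat" assume "y \<in> {1..} \<times> {1..}"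
    then obtain u v where y: "y = (u, v)" "u \<ge> 1" "v \<ge> 1" by auto
    have "coprime (u div gcd u v) (v div gcd u v)" using y by (intro div_gcd_coprime) auto
    moreover have "gcd u v \<ge> 1" "u div gcd u v \<ge> 1" "v div gcd u v \<ge> 1"
      using y by (auto simp: Suc_le_eq div_greater_zero_iff dvd_imp_le)
    ultimately show "(case y of (u, v) \<Rightarrow> (gcd u v, u div gcd u v, v div gcd u v)) \<in> {1..} \<times> coprime_pairs"
      "(case case y of (u, v) \<Rightarrow> (gcd u v, u div gcd u v, v div gcd u v) of (g, a, b) \<Rightarrow> (g * a, g * b)) = y"
      using y by (auto simp: coprime_pairs_def)
  qed simp
  finally have "zeta_real (2 * s) * C = (zeta_real s)\<^sup>2"
    using all by (rule has_sum_unique)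
  then have "C = (zeta_real s)\<^sup>2 / zeta_real (2 * s)"
    using zeta_real_pos[of "2 * s"] s by (simp add: field_simps)
  then show ?thesis using C by simp
qed

lemma divisor_tau_square_has_sum:
  assumes s: "s > 1"
  shows "((\<lambda>n. (real (divisor_tau n))\<^sup>2 * real n powr - s) has_sum ((zeta_real s) ^ 4 / zeta_real (2 * s))) {1..}"
proof -
  let ?z = "zeta_real s"
  define G :: "(nat \<times> nat) \<times> nat \<times> nat \<Rightarrow> real"
    where "G = (\<lambda>((q, g), a, b). real q powr - s * real g powr - s * (real a * real b) powr - s)"
  define H :: "nat \<times> nat \<times> nat \<Rightarrow> real" where "H = (\<lambda>(n, p). real n powr - s)"
  define J :: "(nat \<times> nat) \<times> nat \<times> nat \<Rightarrow> nat \<times> nat \<times> nat"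
    where "J = (\<lambda>((q, g), a, b). (q * g * a * b, g * a, g * b))"
  define I :: "nat \<times> nat \<times> nat \<Rightarrow> (nat \<times> nat) \<times> nat \<times> nat"
    where "I = (\<lambda>(n, u, v). ((n div lcm u v, gcd u v), u div gcd u v, v div gcd u v))"
  have "(G has_sum ((?z * ?z) * (?z\<^sup>2 / zeta_real (2 * s)))) (({1..} \<times> {1..}) \<times> coprime_pairs)"
    using has_sum_nonneg_product[OF has_sum_nonneg_product[OF zeta_real_has_sum[OF s] zeta_real_has_sum[OF s]] coprime_pairs_has_sum[OF s]]
    by (simp add: G_def case_prod_unfold)
  also have "?this \<longleftrightarrow> (H has_sum (?z ^ 4 / zeta_real (2 * s)))
      (Sigma {1..} (\<lambda>n. {d. d dvd n} \<times> {d. d dvd n}))"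
  proof (rule has_sum_reindex_bij_witness[where j = J and i = I])
    fix x :: "(nat \<times> nat) \<times> nat \<times> nat" assume "x \<in> ({1..} \<times> {1..}) \<times> coprime_pairs"
    then obtain q g a b where x: "x = ((q, g), a, b)" "q \<ge> 1" "g \<ge> 1" "a \<ge> 1" "b \<ge> 1" "coprime a b"
      by (auto simp: coprime_pairs_def)
    have gcd: "gcd (g * a) (g * b) = g" using x by (simp add: gcd_mult_left)
    have "lcm (g * a) (g * b) = g * (a * b)" using x by (simp add: lcm_mult_left lcm_coprime)
    then have "q * g * a * b div lcm (g * a) (g * b) = q" using x by (simp add: mult.assoc)
    then show "I (J x) = x"
      using x gcd by (simp add: I_def J_def)
    show "J x \<in> (SIGMA n:{1..}. {d. d dvd n} \<times> {d. d dvd n})"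
      using x by (auto simp: Suc_le_eq J_def)
    show "H (J x) = G x"
      using x by (simp add: powr_mult H_def G_def J_def)
  next
    fix y :: "nat \<times> nat \<times> nat" assume "y \<in> (SIGMA n:{1..}. {d. d dvd n} \<times> {d. d dvd n})"
    then obtain n u v where y: "y = (n, u, v)" "n \<ge> 1" "u dvd n" "v dvd n" by auto
    then have uv: "u \<ge> 1" "v \<ge> 1" by (auto simp: Suc_le_eq intro!: Nat.gr0I)
    have cop: "coprime (u div gcd u v) (v div gcd u v)" using uv by (intro div_gcd_coprime) auto
    have ge: "gcd u v \<ge> 1" "u div gcd u v \<ge> 1" "v div gcd u v \<ge> 1"
      using uv by (auto simp: Suc_le_eq div_greater_zero_iff dvd_imp_le)
    have l: "lcm u v dvd n" using y by (intro lcm_least)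
    have lge: "n div lcm u v \<ge> 1" using l y uv
      by (auto simp: Suc_le_eq div_greater_zero_iff dvd_imp_le lcm_pos_nat)
    have "gcd u v * (u div gcd u v) * (v div gcd u v) = lcm u v"
      by (simp add: lcm_nat_def div_mult_swap)
    then have "n div lcm u v * gcd u v * (u div gcd u v) * (v div gcd u v) = n div lcm u v * lcm u v"
      by (metis mult.assoc)
    then have "n div lcm u v * gcd u v * (u div gcd u v) * (v div gcd u v) = n"
      by (simp only: dvd_div_mult_self[OF l])
    then show "I y \<in> ({1..} \<times> {1..}) \<times> coprime_pairs" "J (I y) = y"
      using y cop ge lge by (auto simp: coprime_pairs_def I_def J_def)
  qed (simp add: power2_eq_square eval_nat_numeral)
  finally show ?thesis
  proof (rule has_sum_SigmaD)
    fix n :: nat assume n: "n \<in> {1..}"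
    have "finite ({d. d dvd n} \<times> {d. d dvd n})" using n by simp
    from has_sum_finite[OF this, of "\<lambda>_. real n powr - s"]
    show "((\<lambda>p. H (n, p)) has_sum (real (divisor_tau n))\<^sup>2 * real n powr - s) ({d. d dvd n} \<times> {d. d dvd n})"
      by (simp add: divisor_tau_def card_cartesian_product power2_eq_square H_def)
  qed
qed

section \<open>Euler factors of the correlation series of tau(c k) tau(d k)\<close>

lemma divisor_tau_prime_power_mult:
  assumes p: "prime p" and m: "m > 0" "\<not> p dvd m"
  shows "divisor_tau (p ^ j * m) = (j + 1) * divisor_tau m"
proof -
  have pj: "p ^ i > 0" for i using p by (simp add: prime_gt_0_nat)
  have "bij_betw (\<lambda>(i, d). p ^ i * d) ({..j} \<times> {d. d dvd m}) {d. d dvd p ^ j * m}"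
  proof (rule bij_betw_imageI)
    show "inj_on (\<lambda>(i, d). p ^ i * d) ({..j} \<times> {d. d dvd m})"
    proof (rule inj_onI, clarify)
      fix i d i' d' assume *: "d dvd m" "d' dvd m" "p ^ i * d = p ^ i' * d'"
      have nd: "d \<noteq> 0" "d' \<noteq> 0" "\<not> p dvd d" "\<not> p dvd d'" using * m by (auto intro: dvd_trans)
      have "multiplicity p (p ^ i * d) = i" "multiplicity p (p ^ i' * d') = i'"
        using p nd by (simp_all add: prime_elem_multiplicity_mult_distrib not_dvd_imp_multiplicity_0)
      then have "i = i'" using * by simp
      then show "i = i' \<and> d = d'" using *(3) pj[of i] by (metis mult_cancel1 not_gr_zero)
    qed
    show "(\<lambda>(i, d). p ^ i * d) ` ({..j} \<times> {d. d dvd m}) = {d. d dvd p ^ j * m}"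
    proof (intro equalityI subsetI)
      fix d assume "d \<in> {d. d dvd p ^ j * m}"
      then obtain a b where "d = a * b" "a dvd p ^ j" "b dvd m"
        using division_decomp[of d "p ^ j" m] by auto
      moreover from this obtain i where "i \<le> j" "a = p ^ i" using p divides_primepow_nat by blast
      ultimately show "d \<in> (\<lambda>(i, d). p ^ i * d) ` ({..j} \<times> {d. d dvd m})" by auto
    qed (auto intro: mult_dvd_mono le_imp_power_dvd)
  qed
  then have "card {d. d dvd p ^ j * m} = card ({..j} \<times> {d. d dvd m})" by (simp add: bij_betw_same_card)
  then show ?thesis by (simp add: divisor_tau_def card_cartesian_product)
qed

text \<open>The local series of \<open>tau(p^(e+j)) tau(p^j) x^j\<close>. The polynomial splits as
  (e+j+1)(j+1) = (j+1)(j+2) + (e-1)(j+1), and the first part is twice the Cauchy product of the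
  series for 1/(1-x)^2 and 1/(1-x).\<close>

lemma sums_Suc_mult_geometric:
  fixes x :: real
  assumes x: "\<bar>x\<bar> < 1"
  shows "(\<lambda>j. (real e + real j + 1) * (real j + 1) * x ^ j) sums (((1 + real e) + x * (1 - real e)) / (1 - x) ^ 3)"
proof -
  have A: "(\<lambda>j. real (Suc j) * x ^ j) sums (1 / (1 - x)\<^sup>2)" using geometric_deriv_sums[of x] x by simp
  have B: "(\<lambda>j. x ^ j) sums (1 / (1 - x))" using geometric_sums[of x] x by simp
  have nA: "summable (\<lambda>j. norm (real (Suc j) * x ^ j))"
    using sums_summable[OF geometric_deriv_sums[of "\<bar>x\<bar>"]] x by (simp add: abs_mult power_abs)
  have nB: "summable (\<lambda>j. norm (x ^ j))" using x by (simp add: power_abs summable_geometric)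
  have X: "(\<lambda>k. \<Sum>i\<le>k. (real (Suc i) * x ^ i) * x ^ (k - i)) sums ((\<Sum>j. real (Suc j) * x ^ j) * (\<Sum>j. x ^ j))"
    by (rule Cauchy_product_sums[OF nA nB])
  have Y: "(\<Sum>i\<le>k. (real (Suc i) * x ^ i) * x ^ (k - i)) = (real k + 1) * (real k + 2) / 2 * x ^ k" for k
  proof -
    have "(\<Sum>i\<le>k. (real (Suc i) * x ^ i) * x ^ (k - i)) = (\<Sum>i\<le>k. real (Suc i) * x ^ k)"
      by (intro sum.cong refl) (simp add: mult.assoc flip: power_add)
    also have "\<dots> = (\<Sum>i\<le>k. real (Suc i)) * x ^ k" by (simp add: sum_distrib_right)
    also have "(\<Sum>i\<le>k. real (Suc i)) = (real k + 1) * (real k + 2) / 2" by (induction k) (auto simp: field_simps)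
    finally show ?thesis .
  qed
  have "(\<lambda>k. (real k + 1) * (real k + 2) / 2 * x ^ k) sums (1 / (1 - x)\<^sup>2 * (1 / (1 - x)))"
    using X unfolding Y sums_unique[OF A, symmetric] sums_unique[OF B, symmetric] .
  then have "(\<lambda>j. 2 * ((real j + 1) * (real j + 2) / 2 * x ^ j) + (real e - 1) * (real (Suc j) * x ^ j)) sums
      (2 * (1 / (1 - x)\<^sup>2 * (1 / (1 - x))) + (real e - 1) * (1 / (1 - x)\<^sup>2))"
    by (intro sums_add sums_mult A)
  moreover have "2 * ((real j + 1) * (real j + 2) / 2 * x ^ j) + (real e - 1) * (real (Suc j) * x ^ j) =
      (real e + real j + 1) * (real j + 1) * x ^ j" for j by (simp add: algebra_simps)
  moreover have "2 * (1 / (1 - x)\<^sup>2 * (1 / (1 - x))) + (real e - 1) * (1 / (1 - x)\<^sup>2) = ((1 + real e) + x * (1 - real e)) / (1 - x) ^ 3"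
  proof -
    define u where "u = 1 - x"
    have u: "u \<noteq> 0" "x = 1 - u" using x by (auto simp: u_def)
    show ?thesis unfolding u(2) using u(1) by (simp add: divide_simps) (simp add: algebra_simps power2_eq_square power3_eq_cube)
  qed
  ultimately show ?thesis by simp
qed

definition tau_corr_term :: "real \<Rightarrow> nat \<Rightarrow> nat \<Rightarrow> nat \<Rightarrow> real" where
  "tau_corr_term s c d k = real (divisor_tau (c * k)) * real (divisor_tau (d * k)) * real k powr - s"

text \<open>Writing k = p^j k' with k' prime to \<open>p\<close> factors the series into a local
  one, depending on \<open>e\<close>, and the sum \<open>\<sigma>\<close> over k', which does not.
  The case e = 0 expresses \<open>T\<close> through \<open>\<sigma>\<close>, so
  \<open>\<sigma>\<close> is eliminated by a quotient and never computed.\<close>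

lemma tau_corr_peel:
  assumes s: "s > 1" and p: "prime p" and c: "c > 0" "\<not> p dvd c" and d: "d > 0" "\<not> p dvd d"
    and T: "(tau_corr_term s c d has_sum T) {1..}"
  defines "x \<equiv> real p powr - s"
  shows "(tau_corr_term s (p ^ e * c) d has_sum (T * (((1 + real e) + x * (1 - real e)) / (1 + x)))) {1..}"
proof -
  have p2: "p \<ge> 2" using p by (rule prime_ge_2_nat)
  have "real p powr - s < real p powr 0" using p2 s by (intro powr_less_mono) auto
  then have x: "0 < x" "x < 1" using p2 by (auto simp: x_def)
  define P where "P = {k. k \<ge> 1 \<and> \<not> p dvd k}"
  have "tau_corr_term s c d summable_on P"
    by (rule summable_on_subset[OF has_sum_imp_summable[OF T]]) (auto simp: P_def)
  then obtain \<sigma> where \<sigma>: "(tau_corr_term s c d has_sum \<sigma>) P" by (auto simp: summable_on_def)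
  have key: "(tau_corr_term s (p ^ e * c) d has_sum (((1 + real e) + x * (1 - real e)) / (1 - x) ^ 3 * \<sigma>)) {1..}" for e
  proof -
    have "((\<lambda>j. (real e + real j + 1) * (real j + 1) * x ^ j) has_sum (((1 + real e) + x * (1 - real e)) / (1 - x) ^ 3)) UNIV"
      using sums_Suc_mult_geometric[of x e] x
      by (intro norm_summable_imp_has_sum) (auto simp: abs_mult sums_iff)
    from has_sum_nonneg_product[OF this \<sigma>]
    have "((\<lambda>(j, k). ((real e + real j + 1) * (real j + 1) * x ^ j) * tau_corr_term s c d k) has_sum
        (((1 + real e) + x * (1 - real e)) / (1 - x) ^ 3 * \<sigma>)) (UNIV \<times> P)"
      using x by (simp add: tau_corr_term_def)
    also have "?this \<longleftrightarrow> (tau_corr_term s (p ^ e * c) d has_sum (((1 + real e) + x * (1 - real e)) / (1 - x) ^ 3 * \<sigma>)) {1..}"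
    proof (rule has_sum_reindex_bij_witness[where j = "\<lambda>(j, k). p ^ j * k" and i = "\<lambda>n. (multiplicity p n, n div p ^ multiplicity p n)"])
      fix y :: "nat \<times> nat" assume "y \<in> UNIV \<times> P"
      then obtain j k where y: "y = (j, k)" "k \<ge> 1" "\<not> p dvd k" by (auto simp: P_def)
      have pj: "p ^ j > 0" using p2 by simp
      have "multiplicity p (p ^ j * k) = j"
        using p y by (simp add: prime_elem_multiplicity_mult_distrib not_dvd_imp_multiplicity_0)
      then show "(multiplicity p (case y of (j, k) \<Rightarrow> p ^ j * k), (case y of (j, k) \<Rightarrow> p ^ j * k) div p ^ multiplicity p (case y of (j, k) \<Rightarrow> p ^ j * k)) = y"
        using y pj by simp
      show "(case y of (j, k) \<Rightarrow> p ^ j * k) \<in> {1..}" using y pj by (simp add: Suc_le_eq)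
      have nd: "\<not> p dvd c * k" "\<not> p dvd d * k" using y c d p by (auto simp: prime_dvd_mult_iff)
      have pos: "c * k > 0" "d * k > 0" using c d y by auto
      have t1: "divisor_tau (p ^ e * c * (p ^ j * k)) = (e + j + 1) * divisor_tau (c * k)"
        using divisor_tau_prime_power_mult[OF p pos(1) nd(1), of "e + j"] by (simp add: power_add mult_ac)
      have t2: "divisor_tau (d * (p ^ j * k)) = (j + 1) * divisor_tau (d * k)"
        using divisor_tau_prime_power_mult[OF p pos(2) nd(2), of j] by (simp add: mult_ac)
      have t3: "real (p ^ j * k) powr - s = x ^ j * real k powr - s"
        using p2 by (simp add: x_def powr_mult powr_powr powr_realpow[symmetric] mult.commute)
      show "tau_corr_term s (p ^ e * c) d (case y of (j, k) \<Rightarrow> p ^ j * k) =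
         (case y of (j, k) \<Rightarrow> (real e + real j + 1) * (real j + 1) * x ^ j * tau_corr_term s c d k)"
        unfolding tau_corr_term_def y(1) prod.case t1 t2 t3 by (simp add: algebra_simps)
    next
      fix n :: nat assume n: "n \<in> {1..}"
      have dv: "p ^ multiplicity p n dvd n" by (rule multiplicity_dvd)
      then show "(case (multiplicity p n, n div p ^ multiplicity p n) of (j, k) \<Rightarrow> p ^ j * k) = n" by simp
      have "\<not> p dvd n div p ^ multiplicity p n"
        using n p2 by (intro multiplicity_decompose) auto
      moreover have "n div p ^ multiplicity p n \<noteq> 0" using dv n by (simp add: dvd_div_eq_0_iff)
      ultimately show "(multiplicity p n, n div p ^ multiplicity p n) \<in> UNIV \<times> P" by (auto simp: P_def)
    qed simp
    finally show ?thesis .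
  qed
  have "T = (1 + x) / (1 - x) ^ 3 * \<sigma>"
    using key[of 0] T has_sum_unique by (simp, blast)
  then have "((1 + real e) + x * (1 - real e)) / (1 - x) ^ 3 * \<sigma> = T * (((1 + real e) + x * (1 - real e)) / (1 + x))"
    using x by simp
  then show ?thesis using key[of e] by simp
qed

lemma prime_power_mult_induct [consumes 1, case_names one step]:
  fixes n :: nat
  assumes n: "n > 0" and one: "P 1"
    and step: "\<And>p e m. prime p \<Longrightarrow> e > 0 \<Longrightarrow> m > 0 \<Longrightarrow> \<not> p dvd m \<Longrightarrow> P m \<Longrightarrow> P (p ^ e * m)"
  shows "P n"
  using n
proof (induction n rule: less_induct)
  case (less n)
  show ?case
  proof (cases "n = 1")
    case False
    then obtain p where p: "prime p" "p dvd n" using prime_factor_nat by blast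
    define e where "e = multiplicity p n"
    define m where "m = n div p ^ e"
    have n: "n = p ^ e * m" by (simp add: e_def m_def multiplicity_dvd)
    have e: "e > 0" using p less.prems by (simp add: e_def prime_multiplicity_gt_zero_iff)
    have m: "m > 0" using n less.prems by (intro Nat.gr0I) auto
    have nd: "\<not> p dvd m" unfolding m_def e_def
      using p less.prems prime_ge_2_nat[of p] by (intro multiplicity_decompose) auto
    have "1 < p ^ e" using one_less_power[OF prime_gt_1_nat[OF p(1)] e] .
    then have "m < n" using n m by simp
    then have "P (p ^ e * m)" using less.IH m p e nd by (intro step) auto
    then show ?thesis using n by simp
  qed (use one in simp)
qed

lemma prod_prime_factors_prime_power_mult:
  fixes F :: "nat \<Rightarrow> nat \<Rightarrow> 'a::comm_monoid_mult"
  assumes p: "prime p" "e > 0" "m > 0" "\<not> p dvd m"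
  shows "(\<Prod>q\<in>prime_factors (p ^ e * m). F q (multiplicity q (p ^ e * m))) =
    F p e * (\<Prod>q\<in>prime_factors m. F q (multiplicity q m))"
proof -
  have pf: "prime_factors (p ^ e * m) = insert p (prime_factors m)"
    using p by (auto simp: in_prime_factors_iff prime_dvd_mult_iff prime_gt_0_nat)
      (metis prime_dvd_power primes_dvd_imp_eq)
  have np: "p \<notin> prime_factors m" using p by (auto simp: in_prime_factors_iff)
  have mp: "multiplicity p (p ^ e * m) = e"
    using p by (simp add: prime_elem_multiplicity_mult_distrib not_dvd_imp_multiplicity_0)
  have mq: "multiplicity q (p ^ e * m) = multiplicity q m" if "q \<in> prime_factors m" for q
  proof -
    have q: "prime q" "q \<noteq> p" using that np by auto
    then have "\<not> q dvd p ^ e" using p prime_dvd_power primes_dvd_imp_eq by blast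
    then show ?thesis using q p
      by (simp add: prime_elem_multiplicity_mult_distrib not_dvd_imp_multiplicity_0 prime_gt_0_nat)
  qed
  show ?thesis unfolding pf using np by (simp add: mp mq)
qed

lemma divisor_tau_eq_prod:
  assumes "n > 0"
  shows "real (divisor_tau n) = (\<Prod>q\<in>prime_factors n. real (multiplicity q n) + 1)"
  using assms
proof (induction n rule: prime_power_mult_induct)
  case one
  then show ?case by (simp add: divisor_tau_def)
next
  case (step p e m)
  have "real (divisor_tau (p ^ e * m)) = (real e + 1) * real (divisor_tau m)"
    by (simp only: divisor_tau_prime_power_mult[OF step(1,3,4)] of_nat_mult of_nat_add of_nat_1)
  then show ?case
    using prod_prime_factors_prime_power_mult[OF step(1-4), of "\<lambda>q k. real k + 1"] step.IH by (simp only:)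
qed

text \<open>The ratio of the local series with exponent \<open>k\<close> to that with exponent 0. It
  is \<open>k + 1\<close> times the factor appearing in the theorem.\<close>

definition euler_factor :: "real \<Rightarrow> nat \<Rightarrow> nat \<Rightarrow> real" where
  "euler_factor s p k = ((1 + real k) + real p powr - s * (1 - real k)) / (1 + real p powr - s)"

text \<open>Prime powers are added to \<open>c\<close> one at a time with \<open>d\<close> fixed;
  coprimality keeps each new prime away from \<open>d\<close> and from the part of \<open>c\<close>
  already built, as \<open>tau_corr_peel\<close> requires.\<close>

lemma tau_corr_extend:
  assumes s: "s > 1" and c: "c > 0" "coprime c d" and d: "d > 0"
    and T: "(tau_corr_term s 1 d has_sum T) {1..}"
  shows "(tau_corr_term s c d has_sum (T * (\<Prod>q\<in>prime_factors c. euler_factor s q (multiplicity q c)))) {1..}"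
  using c
proof (induction c rule: prime_power_mult_induct)
  case one
  then show ?case using T by simp
next
  case (step p e m)
  have "coprime m d" "\<not> p dvd d" using step
    by (auto simp: coprime_mult_left_iff coprime_power_left_iff prime_imp_coprime dest: coprime_common_divisor)
  then show ?case
    using tau_corr_peel[OF s step(1,3,4) d, OF _ step.IH, of e] step
      prod_prime_factors_prime_power_mult[of p e m "euler_factor s"]
    by (simp add: euler_factor_def mult_ac)
qed

lemma tau_corr_term_commute: "tau_corr_term s c d = tau_corr_term s d c"
  by (simp add: tau_corr_term_def fun_eq_iff)

theorem tau_corr_has_sum:
  assumes s: "s > 1" and cd: "c > 0" "d > 0" "coprime c d"
  shows "(tau_corr_term s c d has_sum
    (real (divisor_tau (c * d)) * (zeta_real s ^ 4 / zeta_real (2 * s)) *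
      (\<Prod>p\<in>prime_factors (c * d). let k = real (multiplicity p (c * d)) in
          (1 - (k - 1) / ((k + 1) * real p powr s)) / (1 + 1 / real p powr s)))) {1..}"
proof -
  let ?z = "zeta_real s ^ 4 / zeta_real (2 * s)"
  let ?E = "\<lambda>n. \<Prod>q\<in>prime_factors n. euler_factor s q (multiplicity q n)"
  have "tau_corr_term s 1 1 = (\<lambda>n. (real (divisor_tau n))\<^sup>2 * real n powr - s)"
    by (simp add: tau_corr_term_def power2_eq_square fun_eq_iff)
  then have "(tau_corr_term s 1 1 has_sum ?z) {1..}"
    using divisor_tau_square_has_sum[OF s] by simp
  \<comment> \<open>The series is symmetric in its two parameters, so the same extension builds
    first d against 1 and then c against d.\<close>
  then have "(tau_corr_term s d 1 has_sum ?z * ?E d) {1..}" using s cd by (intro tau_corr_extend) auto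
  then have "(tau_corr_term s 1 d has_sum ?z * ?E d) {1..}" by (simp add: tau_corr_term_commute)
  then have 1: "(tau_corr_term s c d has_sum ?z * ?E d * ?E c) {1..}" using s cd by (intro tau_corr_extend) auto
  have 2: "?E (c * d) = ?E c * ?E d" using cd(1,3)
  proof (induction c rule: prime_power_mult_induct)
    case (step p e m)
    have "coprime m d" "\<not> p dvd d" using step
      by (auto simp: coprime_mult_left_iff coprime_power_left_iff prime_imp_coprime dest: coprime_common_divisor)
    then show ?case
      using step cd prod_prime_factors_prime_power_mult[of p e m "euler_factor s"]
        prod_prime_factors_prime_power_mult[of p e "m * d" "euler_factor s"]
      by (simp add: prime_dvd_mult_iff mult.assoc)
  qed simp
  have pos: "c * d > 0" using cd by simp
  \<comment> \<open>Taking k + 1 out of every Euler factor produces exactly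
    \<open>divisor_tau (c * d)\<close>.\<close>
  have 3: "?E (c * d) = real (divisor_tau (c * d)) *
      (\<Prod>p\<in>prime_factors (c * d). let k = real (multiplicity p (c * d)) in
          (1 - (k - 1) / ((k + 1) * real p powr s)) / (1 + 1 / real p powr s))"
    unfolding divisor_tau_eq_prod[OF pos] prod.distrib[symmetric]
  proof (rule prod.cong)
    fix p assume "p \<in> prime_factors (c * d)"
    then have pos: "real p powr s > 0" by (auto simp: in_prime_factors_iff prime_gt_0_nat)
    define k where "k = real (multiplicity p (c * d))"
    have "k + 1 \<noteq> 0" by (simp add: k_def)
    then have "(k + 1) * ((k - 1) / ((k + 1) * real p powr s)) = (k - 1) / real p powr s" by simp
    then have "(k + 1) * (1 - (k - 1) / ((k + 1) * real p powr s)) = (k + 1) - (k - 1) / real p powr s"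
      by (simp only: right_diff_distrib mult_1_right)
    also have "\<dots> = (1 + k) + 1 / real p powr s * (1 - k)" by (simp add: diff_divide_distrib algebra_simps)
    finally have F: "(k + 1) * (1 - (k - 1) / ((k + 1) * real p powr s)) = (1 + k) + 1 / real p powr s * (1 - k)" .
    show "euler_factor s p (multiplicity p (c * d)) = (real (multiplicity p (c * d)) + 1) *
       (let k = real (multiplicity p (c * d)) in (1 - (k - 1) / ((k + 1) * real p powr s)) / (1 + 1 / real p powr s))"
      unfolding euler_factor_def k_def[symmetric] Let_def powr_minus inverse_eq_divide times_divide_eq_right F ..
  qed simp
  have "?z * ?E d * ?E c = ?z * ?E (c * d)" unfolding 2 by (simp only: mult_ac)
  then show ?thesis using 1 unfolding 3 by (simp only: mult_ac)
qed

section \<open>A mean square bound for sine sums\<close>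

text \<open>An explicit primitive \<open>F\<close> exists. Its main term has the size of the
  reciprocal of the phase derivative c / (2 sqrt x); the constant 6 is three contributions of
  2.\<close>

lemma integral_cos_sqrt_bound:
  assumes c: "c > 0" and X: "0 < X1" "X1 \<le> X2"
  shows "\<bar>integral {X1..X2} (\<lambda>x. cos (c * sqrt x + d))\<bar> \<le> 6 / c * sqrt X2"
proof -
  define F where "F = (\<lambda>x. 2 / c * sqrt x * sin (c * sqrt x + d) + 2 / c\<^sup>2 * cos (c * sqrt x + d))"
  have "((\<lambda>x. cos (c * sqrt x + d)) has_integral (F X2 - F X1)) {X1..X2}"
  proof (intro fundamental_theorem_of_calculus X)
    fix x assume "x \<in> {X1..X2}"
    then have x: "x > 0" using X by auto
    have "(F has_real_derivative (2 / c * (inverse (sqrt x) / 2) * sin (c * sqrt x + d)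
        + 2 / c * sqrt x * (cos (c * sqrt x + d) * (c * (inverse (sqrt x) / 2)))
        + 2 / c\<^sup>2 * (- sin (c * sqrt x + d) * (c * (inverse (sqrt x) / 2))))) (at x within {X1..X2})"
    proof -
      have "((\<lambda>x. A * sqrt x * sin (c * sqrt x + d) + B * cos (c * sqrt x + d)) has_real_derivative
          (A * (inverse (sqrt x) / 2) * sin (c * sqrt x + d)
            + A * sqrt x * (cos (c * sqrt x + d) * (c * (inverse (sqrt x) / 2)))
            + B * (- sin (c * sqrt x + d) * (c * (inverse (sqrt x) / 2))))) (at x within {X1..X2})" for A B
        using x by (auto intro!: derivative_eq_intros simp: algebra_simps)
      from this[of "2 / c" "2 / c\<^sup>2"] show ?thesis unfolding F_def .
    qed
    also have "(2 / c * (inverse (sqrt x) / 2) * sin (c * sqrt x + d)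
        + 2 / c * sqrt x * (cos (c * sqrt x + d) * (c * (inverse (sqrt x) / 2)))
        + 2 / c\<^sup>2 * (- sin (c * sqrt x + d) * (c * (inverse (sqrt x) / 2)))) = cos (c * sqrt x + d)"
    proof -
      define i where "i = inverse (sqrt x)"
      have i: "sqrt x * i = 1" using x by (simp add: i_def)
      have "2 / c * sqrt x * (C * (c * (i / 2))) = C * (sqrt x * i)" for C using c by (simp add: field_simps)
      moreover have "2 / c\<^sup>2 * (- S * (c * (i / 2))) = - (2 / c * (i / 2) * S)" for S
        using c by (simp add: field_simps power2_eq_square)
      ultimately show ?thesis unfolding i_def[symmetric] i by simp
    qed
    finally show "(F has_vector_derivative cos (c * sqrt x + d)) (at x within {X1..X2})"
      by (simp add: has_real_derivative_iff_has_vector_derivative)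
  qed
  then have I: "integral {X1..X2} (\<lambda>x. cos (c * sqrt x + d)) = F X2 - F X1" by (rule integral_unique)
  have s: "\<bar>2 / c * sqrt x * sin (c * sqrt x + d)\<bar> \<le> 2 / c * sqrt X2" if "0 < x" "x \<le> X2" for x
  proof -
    have "\<bar>2 / c * sqrt x * sin (c * sqrt x + d)\<bar> = 2 / c * sqrt x * \<bar>sin (c * sqrt x + d)\<bar>"
      using c that by (simp add: abs_mult)
    also have "\<dots> \<le> 2 / c * sqrt X2 * 1" using c that by (intro mult_mono) auto
    finally show ?thesis by simp
  qed
  \<comment> \<open>Bounding the cosines trivially would leave a term of order 1/c^2, too large for
    close frequencies. The Lipschitz bound trades one factor 1/c for sqrt X2.\<close>
  have lip: "\<bar>cos u - cos v\<bar> \<le> \<bar>u - v\<bar>" for u v :: real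
  proof -
    have "\<bar>cos u - cos v\<bar> = 2 * \<bar>sin ((u + v) / 2)\<bar> * \<bar>sin ((v - u) / 2)\<bar>"
      by (simp add: cos_diff_cos abs_mult)
    also have "\<dots> \<le> 2 * 1 * \<bar>(v - u) / 2\<bar>"
      by (intro mult_mono abs_sin_x_le_abs_x) auto
    finally show ?thesis by simp
  qed
  have "\<bar>2 / c\<^sup>2 * cos (c * sqrt X2 + d) - 2 / c\<^sup>2 * cos (c * sqrt X1 + d)\<bar>
      = 2 / c\<^sup>2 * \<bar>cos (c * sqrt X2 + d) - cos (c * sqrt X1 + d)\<bar>"
    unfolding right_diff_distrib[symmetric] abs_mult by simp
  also have "\<dots> \<le> 2 / c\<^sup>2 * \<bar>(c * sqrt X2 + d) - (c * sqrt X1 + d)\<bar>"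
    by (intro mult_left_mono lip) auto
  also have "\<bar>(c * sqrt X2 + d) - (c * sqrt X1 + d)\<bar> = c * (sqrt X2 - sqrt X1)"
    using c X by (simp add: abs_mult flip: right_diff_distrib)
  also have "2 / c\<^sup>2 * (c * (sqrt X2 - sqrt X1)) = 2 / c * (sqrt X2 - sqrt X1)"
    using c by (simp add: power2_eq_square)
  also have "\<dots> \<le> 2 / c * sqrt X2" using c X by (intro mult_left_mono) auto
  finally have t: "\<bar>2 / c\<^sup>2 * cos (c * sqrt X2 + d) - 2 / c\<^sup>2 * cos (c * sqrt X1 + d)\<bar> \<le> 2 / c * sqrt X2" .
  have "6 / c * sqrt X2 = 2 / c * sqrt X2 + 2 / c * sqrt X2 + 2 / c * sqrt X2" by (simp add: field_simps)
  then show ?thesis unfolding I F_def using s[of X1] s[of X2] t X by linarith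
qed

lemma sum_inverse_dist_le_harm:
  assumes "n \<in> {1..N}"
  shows "(\<Sum>m\<in>{1..N} - {n}. 1 / \<bar>real m - real n\<bar>) \<le> 2 * harm N"
proof -
  have eq: "{1..N} - {n} = {1..<n} \<union> {n<..N}" using assms by auto
  have "(\<Sum>m\<in>{1..<n}. 1 / \<bar>real m - real n\<bar>) = (\<Sum>j\<in>{1..<n}. 1 / real j)"
    by (rule sum.reindex_bij_witness[where i = "\<lambda>j. n - j" and j = "\<lambda>m. n - m"]) (auto simp: of_nat_diff)
  also have "\<dots> \<le> (\<Sum>j\<in>{1..N}. 1 / real j)" using assms by (intro sum_mono2) auto
  finally have 1: "(\<Sum>m\<in>{1..<n}. 1 / \<bar>real m - real n\<bar>) \<le> harm N" by (simp add: harm_def inverse_eq_divide)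
  have "(\<Sum>m\<in>{n<..N}. 1 / \<bar>real m - real n\<bar>) = (\<Sum>j\<in>{1..N - n}. 1 / real j)"
    by (rule sum.reindex_bij_witness[where i = "\<lambda>j. n + j" and j = "\<lambda>m. m - n"]) (auto simp: of_nat_diff)
  also have "\<dots> \<le> (\<Sum>j\<in>{1..N}. 1 / real j)" using assms by (intro sum_mono2) auto
  finally have 2: "(\<Sum>m\<in>{n<..N}. 1 / \<bar>real m - real n\<bar>) \<le> harm N" by (simp add: harm_def inverse_eq_divide)
  have "(\<Sum>m\<in>{1..N} - {n}. 1 / \<bar>real m - real n\<bar>) =
    (\<Sum>m\<in>{1..<n}. 1 / \<bar>real m - real n\<bar>) + (\<Sum>m\<in>{n<..N}. 1 / \<bar>real m - real n\<bar>)"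
    unfolding eq by (rule sum.union_disjoint) auto
  then show ?thesis using 1 2 by simp
qed

text \<open>Multiplying the gap by its conjugate turns it into |m - n|, with the error sqrt n / m.
  The harmonic sums then contribute 2 * 2 for the distances and 1 for the error. The weight sqrt
  (n/m) is needed for large m, where the unweighted sum over m would grow like sqrt N instead of a
  logarithm.\<close>

lemma weighted_sqrt_gap_sum_le:
  assumes n: "n \<in> {1..N}"
  shows "(\<Sum>m\<in>{1..N} - {n}. sqrt (real n / real m) / \<bar>sqrt (real m) - sqrt (real n)\<bar>) \<le> 5 * sqrt (real n) * harm N"
proof -
  have "sqrt (real n / real m) / \<bar>sqrt (real m) - sqrt (real n)\<bar> \<le> 2 * sqrt (real n) * (1 / \<bar>real m - real n\<bar>) + sqrt (real n) * (1 / real m)"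
    if m: "m \<in> {1..N} - {n}" for m
  proof -
    define u v where "u = sqrt (real m)" and "v = sqrt (real n)"
    have uv: "u > 0" "v > 0" "u \<noteq> v" using m n by (auto simp: u_def v_def)
    have mn: "real m = u * u" "real n = v * v" by (simp_all add: u_def v_def)
    have "sqrt (real n / real m) = v / u" by (simp add: u_def v_def real_sqrt_divide)
    moreover have "\<bar>real m - real n\<bar> = \<bar>u - v\<bar> * (u + v)"
      unfolding mn using uv by (simp add: square_diff_square_factored abs_mult)
    moreover have "v / u / \<bar>u - v\<bar> \<le> 2 * v * (1 / (\<bar>u - v\<bar> * (u + v))) + v * (1 / (u * u))"
    proof -
      have "v / u / t - 2 * v * (1 / (t * (u + v))) = v * ((u + v) - 2 * u) / (u * t * (u + v))" if "t > 0" for t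
      proof -
        have "u + v \<noteq> 0" using uv by simp
        then show ?thesis using uv that by (simp add: divide_simps) (simp add: algebra_simps)
      qed
      from this[of "\<bar>u - v\<bar>"] have "v / u / \<bar>u - v\<bar> - 2 * v * (1 / (\<bar>u - v\<bar> * (u + v))) = v * ((u + v) - 2 * u) / (u * \<bar>u - v\<bar> * (u + v))"
        using uv by simp
      also have "\<dots> \<le> v * \<bar>u - v\<bar> / (u * \<bar>u - v\<bar> * (u + v))"
        using uv by (intro divide_right_mono mult_left_mono) auto
      also have "v * \<bar>u - v\<bar> / (u * \<bar>u - v\<bar> * (u + v)) = v / (u * (u + v))"
      proof -
        have "v * t / (u * t * (u + v)) = v / (u * (u + v))" if "t > 0" for t
          using uv that by (simp add: divide_simps)
        from this[of "\<bar>u - v\<bar>"] show ?thesis using uv by simp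
      qed
      also have "\<dots> \<le> v / (u * u)" using uv by (intro divide_left_mono mult_left_mono) auto
      finally show ?thesis by simp
    qed
    ultimately show ?thesis unfolding mn(1)[symmetric] u_def[symmetric] v_def[symmetric] by simp
  qed
  then have "(\<Sum>m\<in>{1..N} - {n}. sqrt (real n / real m) / \<bar>sqrt (real m) - sqrt (real n)\<bar>) \<le>
      (\<Sum>m\<in>{1..N} - {n}. 2 * sqrt (real n) * (1 / \<bar>real m - real n\<bar>) + sqrt (real n) * (1 / real m))"
    by (rule sum_mono)
  also have "\<dots> = 2 * sqrt (real n) * (\<Sum>m\<in>{1..N} - {n}. 1 / \<bar>real m - real n\<bar>) + sqrt (real n) * (\<Sum>m\<in>{1..N} - {n}. 1 / real m)"
    by (simp only: sum.distrib sum_distrib_left)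
  also have "\<dots> \<le> 2 * sqrt (real n) * (2 * harm N) + sqrt (real n) * harm N"
  proof (intro add_mono mult_left_mono sum_inverse_dist_le_harm n)
    have "(\<Sum>m\<in>{1..N} - {n}. 1 / real m) \<le> (\<Sum>m\<in>{1..N}. 1 / real m)" by (intro sum_mono2) auto
    then show "(\<Sum>m\<in>{1..N} - {n}. 1 / real m) \<le> harm N" by (simp add: harm_def inverse_eq_divide)
  qed auto
  finally show ?thesis by (simp add: mult_ac)
qed

definition sqrt_sine_sum :: "real \<Rightarrow> (nat \<Rightarrow> real) \<Rightarrow> nat set \<Rightarrow> real \<Rightarrow> real" where
  "sqrt_sine_sum \<phi> a A x = (\<Sum>n\<in>A. a n * sin (4 * pi * sqrt (real n * x) + \<phi>))"

text \<open>The diagonal gives half the length of the interval. Off the diagonal a weighted AM-GM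
  inequality followed by exchanging m and n reduces the double sum to single sums of
  \<open>weighted_sqrt_gap_sum_le\<close>. This loses a logarithm against Hilbert's inequality,
  which costs nothing here.\<close>

lemma sqrt_sine_sum_mean_square:
  fixes a :: "nat \<Rightarrow> real"
  assumes A: "A \<subseteq> {1..N}" and X: "0 < X1" "X1 \<le> X2" and a: "\<And>n. a n \<ge> 0"
  shows "integral {X1..X2} (\<lambda>x. (sqrt_sine_sum \<phi> a A x)\<^sup>2) \<le>
    (X2 - X1) / 2 * (\<Sum>n\<in>A. (a n)\<^sup>2) + sqrt X2 * (1 + 5 * harm N) * (\<Sum>n\<in>A. (a n)\<^sup>2 * sqrt (real n))"
proof -
  have fA: "finite A" using A finite_subset by blast
  define e where "e = (\<lambda>n x. sin (4 * pi * sqrt (real n * x) + \<phi>))"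
  have ce: "continuous_on S (e n)" for S n unfolding e_def by (intro continuous_intros)
  define J where "J = (\<lambda>m n. integral {X1..X2} (\<lambda>x. e m x * e n x))"
  define w where "w = (\<lambda>m n. 1 / \<bar>sqrt (real m) - sqrt (real n)\<bar>)"
  have ab: "(\<lambda>x. cos (c * sqrt x + d)) integrable_on {X1..X2}" for c d
    by (intro integrable_continuous_real continuous_intros)
  have prod: "e m x * e n x = (cos (4 * pi * (sqrt (real m) - sqrt (real n)) * sqrt x + 0)
       - cos (4 * pi * (sqrt (real m) + sqrt (real n)) * sqrt x + 2 * \<phi>)) / 2" for m n x
    by (simp add: e_def sin_times_sin real_sqrt_mult algebra_simps)
  have J_eq: "J m n = (integral {X1..X2} (\<lambda>x. cos (4 * pi * (sqrt (real m) - sqrt (real n)) * sqrt x + 0))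
       - integral {X1..X2} (\<lambda>x. cos (4 * pi * (sqrt (real m) + sqrt (real n)) * sqrt x + 2 * \<phi>))) / 2" for m n
    unfolding J_def prod integral_divide by (subst Henstock_Kurzweil_Integration.integral_diff[OF ab ab]) simp
  have six: "6 / (4 * pi * r) * sqrt X2 \<le> sqrt X2 * (1 / r)" if "r > 0" for r
  proof -
    have "6 * r \<le> 4 * pi * r" using pi_gt3 that by (intro mult_right_mono) auto
    then have "6 / (4 * pi * r) \<le> 1 / r" using that pi_gt3 by (simp add: divide_simps)
    then show ?thesis using X by (subst mult.commute) (rule mult_left_mono, auto)
  qed
  have diag: "J n n \<le> (X2 - X1) / 2 + sqrt X2" if n: "n \<in> A" for n
  proof -
    have n1: "1 \<le> sqrt (real n)" using n A by auto
    have "\<bar>integral {X1..X2} (\<lambda>x. cos (4 * pi * (sqrt (real n) + sqrt (real n)) * sqrt x + 2 * \<phi>))\<bar> \<le>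
        6 / (4 * pi * (sqrt (real n) + sqrt (real n))) * sqrt X2"
      using n1 by (intro integral_cos_sqrt_bound X) auto
    also have "\<dots> \<le> sqrt X2 * (1 / (sqrt (real n) + sqrt (real n)))" using n1 by (intro six) auto
    also have "\<dots> \<le> sqrt X2 * 1"
    proof (rule mult_left_mono)
      show "1 / (sqrt (real n) + sqrt (real n)) \<le> 1" using n1 by (intro divide_le_eq_1_pos[THEN iffD2]) linarith+
    qed (use X in simp)
    finally have b: "\<bar>integral {X1..X2} (\<lambda>x. cos (4 * pi * (sqrt (real n) + sqrt (real n)) * sqrt x + 2 * \<phi>))\<bar> \<le> sqrt X2" by simp
    have "J n n = (X2 - X1 - integral {X1..X2} (\<lambda>x. cos (4 * pi * (sqrt (real n) + sqrt (real n)) * sqrt x + 2 * \<phi>))) / 2"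
      unfolding J_eq using X by simp
    moreover have "sqrt X2 \<ge> 0" using X by simp
    moreover have "(p - i) / 2 \<le> p / 2 + s" if "- i \<le> s" "0 \<le> s" for p i s :: real
      using that by (simp add: field_simps)
    ultimately show ?thesis using abs_le_D2[OF b] by metis
  qed
  have off: "\<bar>J m n\<bar> \<le> sqrt X2 * w m n" if mn: "m \<in> A" "n \<in> A" "m \<noteq> n" for m n
  proof -
    have "m \<ge> 1" "n \<ge> 1" using mn A by auto
    then have pos: "sqrt (real m) > 0" "sqrt (real n) > 0" by auto
    have ne: "\<bar>sqrt (real m) - sqrt (real n)\<bar> > 0" using mn by simp
    have abs: "cos (4 * pi * (sqrt (real m) - sqrt (real n)) * sqrt x + 0) = cos (4 * pi * \<bar>sqrt (real m) - sqrt (real n)\<bar> * sqrt x + 0)" for x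
      by (cases "sqrt (real m) \<ge> sqrt (real n)") (auto simp: abs_real_def minus_diff_eq[symmetric, of "sqrt (real n)"] simp del: minus_diff_eq)
    have 1: "\<bar>integral {X1..X2} (\<lambda>x. cos (4 * pi * (sqrt (real m) - sqrt (real n)) * sqrt x + 0))\<bar> \<le> sqrt X2 * w m n"
    proof -
      have "\<bar>integral {X1..X2} (\<lambda>x. cos (4 * pi * (sqrt (real m) - sqrt (real n)) * sqrt x + 0))\<bar> \<le>
         6 / (4 * pi * \<bar>sqrt (real m) - sqrt (real n)\<bar>) * sqrt X2"
        unfolding abs using ne by (intro integral_cos_sqrt_bound X mult_pos_pos) auto
      also have "\<dots> \<le> sqrt X2 * w m n" unfolding w_def by (intro six ne)
      finally show ?thesis .
    qed
    have 2: "\<bar>integral {X1..X2} (\<lambda>x. cos (4 * pi * (sqrt (real m) + sqrt (real n)) * sqrt x + 2 * \<phi>))\<bar> \<le> sqrt X2 * w m n"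
    proof -
      have "\<bar>integral {X1..X2} (\<lambda>x. cos (4 * pi * (sqrt (real m) + sqrt (real n)) * sqrt x + 2 * \<phi>))\<bar> \<le>
         6 / (4 * pi * (sqrt (real m) + sqrt (real n))) * sqrt X2"
        using pos by (intro integral_cos_sqrt_bound X mult_pos_pos add_pos_pos) auto
      also have "\<dots> \<le> sqrt X2 * (1 / (sqrt (real m) + sqrt (real n)))" using pos by (intro six add_pos_pos)
      also have "\<dots> \<le> sqrt X2 * w m n" unfolding w_def
      proof (intro mult_left_mono divide_left_mono mult_pos_pos add_pos_pos ne pos)
        show "\<bar>sqrt (real m) - sqrt (real n)\<bar> \<le> sqrt (real m) + sqrt (real n)"
          using pos by (intro abs_leI) linarith+
      qed (use X in auto)
      finally show ?thesis .
    qed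
    show ?thesis unfolding J_eq using order_trans[OF abs_triangle_ineq4 add_mono[OF 1 2]] by (simp add: abs_divide)
  qed
  have "integral {X1..X2} (\<lambda>x. (sqrt_sine_sum \<phi> a A x)\<^sup>2) = (\<Sum>m\<in>A. \<Sum>n\<in>A. a m * a n * J m n)"
  proof (rule integral_unique)
    have "((\<lambda>x. \<Sum>m\<in>A. \<Sum>n\<in>A. a m * a n * (e m x * e n x)) has_integral (\<Sum>m\<in>A. \<Sum>n\<in>A. a m * a n * J m n)) {X1..X2}"
      unfolding J_def
      by (intro has_integral_sum fA has_integral_mult_right integrable_integral integrable_continuous_real continuous_intros ce)
    moreover have "(sqrt_sine_sum \<phi> a A x)\<^sup>2 = (\<Sum>m\<in>A. \<Sum>n\<in>A. a m * a n * (e m x * e n x))" for x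
      unfolding sqrt_sine_sum_def power2_eq_square sum_product e_def by (intro sum.cong refl) (simp only: mult_ac)
    ultimately show "((\<lambda>x. (sqrt_sine_sum \<phi> a A x)\<^sup>2) has_integral (\<Sum>m\<in>A. \<Sum>n\<in>A. a m * a n * J m n)) {X1..X2}"
      by simp
  qed
  also have "\<dots> = (\<Sum>m\<in>A. a m * a m * J m m + (\<Sum>n\<in>A - {m}. a m * a n * J m n))"
    using fA by (intro sum.cong refl) (simp add: sum.remove)
  also have "\<dots> \<le> (\<Sum>m\<in>A. (a m)\<^sup>2 * ((X2 - X1) / 2 + sqrt X2) +
      (\<Sum>n\<in>A - {m}. ((a m)\<^sup>2 * sqrt (real m / real n) + (a n)\<^sup>2 * sqrt (real n / real m)) / 2 * (sqrt X2 * w m n)))"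
  proof (intro sum_mono add_mono)
    fix m assume m: "m \<in> A"
    show "a m * a m * J m m \<le> (a m)\<^sup>2 * ((X2 - X1) / 2 + sqrt X2)"
      using diag[OF m] by (simp add: power2_eq_square mult_left_mono)
    fix n assume n: "n \<in> A - {m}"
    have mn: "real m > 0" "real n > 0" using m n A by force+
    \<comment> \<open>AM-GM is applied to \<open>a m * s\<close> and \<open>a n / s\<close>; the
      squares of \<open>s\<close> and \<open>1 / s\<close> are the weights sqrt (m/n) and sqrt (n/m)
      that make the gap sums logarithmic.\<close>
    define s where "s = sqrt (sqrt (real m / real n))"
    have s: "s > 0" using mn by (simp add: s_def)
    have s2: "s\<^sup>2 = sqrt (real m / real n)" by (simp add: s_def)
    have s3: "(1 / s)\<^sup>2 = sqrt (real n / real m)" by (simp add: power_divide s2 real_sqrt_divide)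
    have "0 \<le> (a m * s - a n * (1 / s))\<^sup>2" by simp
    also have "\<dots> = (a m)\<^sup>2 * s\<^sup>2 + (a n)\<^sup>2 * (1 / s)\<^sup>2 - 2 * (a m * a n)"
      unfolding power2_diff power_mult_distrib using s by simp
    finally have "a m * a n \<le> ((a m)\<^sup>2 * sqrt (real m / real n) + (a n)\<^sup>2 * sqrt (real n / real m)) / 2"
      unfolding s2 s3 by simp
    moreover have "J m n \<le> sqrt X2 * w m n" using off[OF m, of n] n by (auto simp: abs_le_iff)
    moreover have "0 \<le> sqrt X2 * w m n" using X by (simp add: w_def)
    ultimately show "a m * a n * J m n \<le> ((a m)\<^sup>2 * sqrt (real m / real n) + (a n)\<^sup>2 * sqrt (real n / real m)) / 2 * (sqrt X2 * w m n)"
      using a by (meson mult_left_mono mult_right_mono order_trans mult_nonneg_nonneg)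
  qed
  also have "\<dots> = (\<Sum>m\<in>A. (a m)\<^sup>2 * ((X2 - X1) / 2 + sqrt X2)) +
      ((\<Sum>m\<in>A. \<Sum>n\<in>A - {m}. (a m)\<^sup>2 * sqrt (real m / real n) * (sqrt X2 * w m n)) +
       (\<Sum>m\<in>A. \<Sum>n\<in>A - {m}. (a n)\<^sup>2 * sqrt (real n / real m) * (sqrt X2 * w m n))) / 2"
    by (simp add: sum.distrib[symmetric] sum_divide_distrib add_divide_distrib distrib_right)
  also have "(\<Sum>m\<in>A. \<Sum>n\<in>A - {m}. (a n)\<^sup>2 * sqrt (real n / real m) * (sqrt X2 * w m n)) =
      (\<Sum>m\<in>A. \<Sum>n\<in>A - {m}. (a m)\<^sup>2 * sqrt (real m / real n) * (sqrt X2 * w m n))"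
  proof -
    have sw: "(\<Sum>m\<in>A. \<Sum>n\<in>A - {m}. f m n) = (\<Sum>m\<in>A. \<Sum>n\<in>A - {m}. f n m)" for f :: "nat \<Rightarrow> nat \<Rightarrow> real"
    proof -
      have "(\<Sum>m\<in>A. \<Sum>n\<in>A - {m}. f m n) = (\<Sum>m\<in>A. \<Sum>n\<in>{n\<in>A. m \<noteq> n}. f m n)"
        by (intro sum.cong refl) auto
      also have "\<dots> = (\<Sum>n\<in>A. \<Sum>m\<in>{m\<in>A. m \<noteq> n}. f m n)"
        by (rule sum.swap_restrict[OF fA fA])
      also have "\<dots> = (\<Sum>m\<in>A. \<Sum>n\<in>A - {m}. f n m)" by (intro sum.cong refl) auto
      finally show ?thesis .
    qed
    show ?thesis by (subst sw) (simp add: w_def abs_minus_commute)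
  qed
  also have "(\<Sum>m\<in>A. (a m)\<^sup>2 * ((X2 - X1) / 2 + sqrt X2)) +
      ((\<Sum>m\<in>A. \<Sum>n\<in>A - {m}. (a m)\<^sup>2 * sqrt (real m / real n) * (sqrt X2 * w m n)) +
       (\<Sum>m\<in>A. \<Sum>n\<in>A - {m}. (a m)\<^sup>2 * sqrt (real m / real n) * (sqrt X2 * w m n))) / 2 =
     (\<Sum>m\<in>A. (a m)\<^sup>2 * ((X2 - X1) / 2 + sqrt X2) + (a m)\<^sup>2 * sqrt X2 * (\<Sum>n\<in>A - {m}. sqrt (real m / real n) * w m n))"
    by (simp add: sum.distrib sum_distrib_left mult_ac)
  also have "\<dots> \<le> (\<Sum>m\<in>A. (a m)\<^sup>2 * ((X2 - X1) / 2 + sqrt X2 * sqrt (real m)) + (a m)\<^sup>2 * sqrt X2 * (5 * sqrt (real m) * harm N))"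
  proof (intro sum_mono add_mono mult_left_mono)
    fix m assume m: "m \<in> A"
    then have m1: "m \<in> {1..N}" using A by auto
    then have "1 \<le> sqrt (real m)" by simp
    then show "sqrt X2 \<le> sqrt X2 * sqrt (real m)" using X by (simp add: mult_le_cancel_left1)
    have "(\<Sum>n\<in>A - {m}. sqrt (real m / real n) * w m n) \<le> (\<Sum>n\<in>{1..N} - {m}. sqrt (real m / real n) * w m n)"
      using A by (intro sum_mono2) (auto simp: w_def)
    also have "\<dots> = (\<Sum>n\<in>{1..N} - {m}. sqrt (real m / real n) / \<bar>sqrt (real n) - sqrt (real m)\<bar>)"
      by (simp add: w_def abs_minus_commute)
    also have "\<dots> \<le> 5 * sqrt (real m) * harm N" by (rule weighted_sqrt_gap_sum_le[OF m1])
    finally show "(\<Sum>n\<in>A - {m}. sqrt (real m / real n) * w m n) \<le> 5 * sqrt (real m) * harm N" .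
  qed (use X in auto)
  also have "\<dots> = (X2 - X1) / 2 * (\<Sum>n\<in>A. (a n)\<^sup>2) + sqrt X2 * (1 + 5 * harm N) * (\<Sum>n\<in>A. (a n)\<^sup>2 * sqrt (real n))"
    unfolding sum_distrib_left sum.distrib[symmetric] by (intro sum.cong refl) (simp add: algebra_simps)
  finally show ?thesis .
qed

section \<open>The divisor error term as an almost periodic function\<close>

lemma zeta_powr_has_sum:
  assumes "t < -1"
  shows "((\<lambda>n. real n powr t) has_sum zeta_real (- t)) {1..}"
  using zeta_real_has_sum[of "- t"] assms by simp

lemma divisor_tau_powr_has_sum:
  assumes "t < -1"
  shows "((\<lambda>n. real (divisor_tau n) * real n powr t) has_sum (zeta_real (- t))\<^sup>2) {1..}"
  using divisor_tau_has_sum[of "- t"] assms by simp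

lemma suminf_eq_has_sum:
  fixes f :: "nat \<Rightarrow> real"
  assumes "(f has_sum S) {1..}" "f 0 = 0"
  shows "suminf f = S"
proof -
  have "(f has_sum S) UNIV"
    using assms by (subst has_sum_cong_neutral[of "{1..}" UNIV f f]) (auto simp: Suc_le_eq)
  then show ?thesis using has_sum_imp_sums sums_unique by blast
qed

text \<open>The majorant 3 (k l)^(-5/4) makes the double series unconditionally summable, so it may
  be grouped by n = k l, which produces the divisor function.\<close>

lemma voronoi_sum_has_sum:
  assumes x: "x \<ge> 1"
  shows "((\<lambda>n. real (divisor_tau n) * (kernel_limit (2 * pi * sqrt (real n * x)) / (pi\<^sup>2 * real n))) has_sum voronoi_sum x) {1..}"
proof -
  define F where "F = (\<lambda>n. kernel_limit (2 * pi * sqrt (real n * x)) / (pi\<^sup>2 * real n))"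
  obtain \<phi> where \<phi>: "\<And>z. z \<ge> 1 \<Longrightarrow> \<bar>kernel_limit z - sqrt pi / (2 * sqrt z) * cos (2 * z + \<phi>)\<bar> \<le> 2 / (z * sqrt z)"
    using half_kernel_asymptotic by blast
  have F_bound: "\<bar>F n\<bar> \<le> 3 * real n powr (- 5 / 4)" if n: "n \<ge> 1" for n
  proof -
    define z where "z = 2 * pi * sqrt (real n * x)"
    have z: "z \<ge> 1" using voronoi_argument_ge_1[of x n 1] x n by (simp add: z_def)
    have "\<bar>sqrt pi / (2 * sqrt z) * cos (2 * z + \<phi>)\<bar> \<le> sqrt pi / (2 * sqrt z) * 1"
      unfolding abs_mult using z by (intro mult_mono) auto
    also have "\<dots> \<le> 2 / (2 * sqrt z)"
    proof -
      have "sqrt pi \<le> 2" using pi_less_4 real_sqrt_less_mono[of pi 4] by simp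
      then show ?thesis using z by (simp only: mult_1_right) (intro divide_right_mono, auto)
    qed
    finally have 1: "\<bar>sqrt pi / (2 * sqrt z) * cos (2 * z + \<phi>)\<bar> \<le> 1 / sqrt z" by simp
    have "1 * sqrt z \<le> z * sqrt z" using z by (intro mult_right_mono) auto
    then have "2 / (z * sqrt z) \<le> 2 / sqrt z" using z by (intro divide_left_mono) auto
    then have "\<bar>kernel_limit z\<bar> \<le> 3 / sqrt z" using \<phi>[OF z] 1 by linarith
    also have "\<dots> \<le> 3 / sqrt (sqrt (real n))"
    proof -
      have "1 * sqrt (real n) \<le> 2 * pi * sqrt (real n * x)"
        using pi_gt3 x n by (intro mult_mono) auto
      then show ?thesis unfolding z_def using n x by (intro divide_left_mono mult_pos_pos) auto
    qed
    also have "\<dots> = 3 * real n powr (- 1 / 4)" by (simp add: powr_quarter powr_minus field_simps)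
    finally have kl: "\<bar>kernel_limit z\<bar> \<le> 3 * real n powr (- 1 / 4)" .
    have "\<bar>F n\<bar> = \<bar>kernel_limit z\<bar> / (pi\<^sup>2 * real n)" by (simp add: F_def z_def abs_mult)
    also have "\<dots> \<le> (3 * real n powr (- 1 / 4)) / (1 * real n)"
    proof (intro frac_le mult_right_mono kl)
      show "1 \<le> pi\<^sup>2" using pi_gt3 by (intro one_le_power) simp
    qed (use n in auto)
    also have "\<dots> = 3 * (real n powr (- 1 / 4) / real n)" by simp
    also have "\<dots> = 3 * real n powr (- 5 / 4)" by (simp add: powr_divide_nat)
    finally show ?thesis .
  qed
  have "((\<lambda>(k, l). real k powr (- 5 / 4) * real l powr (- 5 / 4)) has_sum (zeta_real (5 / 4) * zeta_real (5 / 4))) ({1..} \<times> {1..})"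
    using zeta_powr_has_sum[of "- 5 / 4"] by (intro has_sum_nonneg_product) auto
  then have "(\<lambda>p. 3 * (case p of (k, l) \<Rightarrow> real k powr (- 5 / 4) * real l powr (- 5 / 4))) summable_on ({1..} \<times> {1..})"
    by (intro summable_on_cmult_right has_sum_imp_summable)
  then have "(\<lambda>p. norm (case p of (k, l) \<Rightarrow> F (k * l))) summable_on ({1..} \<times> {1..})"
  proof (rule summable_on_comparison_test)
    fix p :: "nat \<times> nat" assume "p \<in> {1..} \<times> {1..}"
    then show "norm (case p of (k, l) \<Rightarrow> F (k * l)) \<le> 3 * (case p of (k, l) \<Rightarrow> real k powr (- 5 / 4) * real l powr (- 5 / 4))"
      using F_bound[of "fst p * snd p"] by (auto simp: powr_mult Suc_le_eq)
  qed auto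
  then have summ: "(\<lambda>(k, l). F (k * l)) summable_on ({1..} \<times> {1..})"
    by (rule abs_summable_summable)
  then obtain S where S: "((\<lambda>(k, l). F (k * l)) has_sum S) ({1..} \<times> {1..})" by (auto simp: summable_on_def)
  have row: "((\<lambda>l. F (k * l)) has_sum (\<Sum>l. F (k * l))) {1..}" if k: "k \<in> {1..}" for k
  proof -
    have "(\<lambda>l. F (k * l)) summable_on {1..}"
      using summable_on_SigmaD1[of "\<lambda>k l. F (k * l)" "{1..}" "\<lambda>_. {1..}" k] summ k by simp
    then obtain s where s: "((\<lambda>l. F (k * l)) has_sum s) {1..}" by (auto simp: summable_on_def)
    moreover have "(\<Sum>l. F (k * l)) = s" by (rule suminf_eq_has_sum[OF s]) (simp add: F_def)
    ultimately show ?thesis by simp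
  qed
  have "((\<lambda>k. \<Sum>l. F (k * l)) has_sum S) {1..}"
    by (rule has_sum_SigmaD[OF S]) (use row in auto)
  moreover have "(\<Sum>l. F (0 * l)) = 0" by (simp add: F_def)
  ultimately have "(\<Sum>k. \<Sum>l. F (k * l)) = S" using suminf_eq_has_sum by blast
  moreover have "(\<Sum>l. F (k * l)) = (\<Sum>l. kernel_limit (2 * pi * sqrt (real k * real l * x)) / (pi * real l)) / (pi * real k)" for k
  proof (cases "k = 0")
    case False
    have eq: "F (k * l) = kernel_limit (2 * pi * sqrt (real k * real l * x)) / (pi * real l) * (1 / (pi * real k))" for l
      by (simp add: F_def power2_eq_square)
    have "summable (\<lambda>l. F (k * l))"
    proof -
      have "((\<lambda>l. F (k * l)) has_sum (\<Sum>l. F (k * l))) UNIV"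
        using row[of k] False by (subst has_sum_cong_neutral[of "{1..}" UNIV "\<lambda>l. F (k * l)" "\<lambda>l. F (k * l)"]) (auto simp: Suc_le_eq F_def)
      then show ?thesis using has_sum_imp_sums sums_summable by blast
    qed
    then have "summable (\<lambda>l. F (k * l) * (pi * real k))" by (rule summable_mult2)
    moreover have "F (k * l) * (pi * real k) = kernel_limit (2 * pi * sqrt (real k * real l * x)) / (pi * real l)" for l
      unfolding eq using False by simp
    ultimately have "summable (\<lambda>l. kernel_limit (2 * pi * sqrt (real k * real l * x)) / (pi * real l))" by simp
    from suminf_mult2[OF this, of "1 / (pi * real k)"] show ?thesis unfolding eq by simp
  qed (simp add: F_def)
  ultimately have "S = voronoi_sum x" by (simp add: voronoi_sum_def)
  then show ?thesis using has_sum_divisor_tau[OF S] by (simp add: F_def)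
qed

text \<open>The amplitude sqrt pi / (2 sqrt z) at z = 2 pi sqrt (n x), divided by pi^2 n, with the
  powers of n and x removed.\<close>

definition voronoi_const :: real where "voronoi_const = 1 / (2 * sqrt 2 * pi\<^sup>2)"

definition voronoi_partial :: "real \<Rightarrow> nat \<Rightarrow> real \<Rightarrow> real" where
  "voronoi_partial \<phi> N x = x powr (- 1 / 4) * (\<Sum>n=1..N. real (divisor_tau n) * real n powr (- 5 / 4) * cos (4 * pi * sqrt (real n * x) + \<phi>))"

text \<open>There are two errors: the kernel asymptotics cost x^(-3/4) times the sum of
  \<open>tau(n) n^(-7/4)\<close>, and the cut at \<open>N\<close> costs x^(-1/4) times the tail of
  \<open>tau(n) n^(-5/4)\<close>. In the tail n^(-1/8) is bounded by N^(-1/8), which leaves the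
  convergent exponent -9/8.\<close>

lemma voronoi_truncated:
  "\<exists>\<phi> C. C \<ge> 0 \<and> (\<forall>x\<ge>1. \<forall>N\<ge>1. \<bar>voronoi_sum x - voronoi_const * voronoi_partial \<phi> N x\<bar> \<le>
     C * (x powr (- 3 / 4) + x powr (- 1 / 4) * real N powr (- 1 / 8)))"
proof -
  obtain \<phi> where \<phi>: "\<And>z. z \<ge> 1 \<Longrightarrow> \<bar>kernel_limit z - sqrt pi / (2 * sqrt z) * cos (2 * z + \<phi>)\<bar> \<le> 2 / (z * sqrt z)"
    using half_kernel_asymptotic by blast
  define C where "C = 2 * (zeta_real (7 / 4))\<^sup>2 + (zeta_real (9 / 8))\<^sup>2"
  have "\<bar>voronoi_sum x - voronoi_const * voronoi_partial \<phi> N x\<bar> \<le>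
     C * (x powr (- 3 / 4) + x powr (- 1 / 4) * real N powr (- 1 / 8))" if x: "x \<ge> 1" and N: "N \<ge> 1" for x N
  proof -
    define G where "G = (\<lambda>n. real (divisor_tau n) * (kernel_limit (2 * pi * sqrt (real n * x)) / (pi\<^sup>2 * real n)))"
    define M where "M = (\<lambda>n. if n \<le> N then voronoi_const * x powr (- 1 / 4) *
        (real (divisor_tau n) * real n powr (- 5 / 4) * cos (4 * pi * sqrt (real n * x) + \<phi>)) else 0)"
    have M: "(M has_sum voronoi_const * voronoi_partial \<phi> N x) {1..}"
    proof -
      have "(M has_sum (\<Sum>n=1..N. M n)) {1..N}" by (rule has_sum_finite) simp
      then have "(M has_sum (\<Sum>n=1..N. M n)) {1..}"
        by (subst has_sum_cong_neutral[of "{1..N}" "{1..}" M M]) (auto simp: M_def)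
      moreover have "(\<Sum>n=1..N. M n) = voronoi_const * voronoi_partial \<phi> N x"
        unfolding voronoi_partial_def sum_distrib_left by (intro sum.cong refl) (simp add: M_def)
      ultimately show ?thesis by simp
    qed
    have diff: "((\<lambda>n. G n - M n) has_sum (voronoi_sum x - voronoi_const * voronoi_partial \<phi> N x)) {1..}"
      using has_sum_add[OF voronoi_sum_has_sum[OF x] has_sum_cmult_right[OF M, of "-1"]] by (simp add: G_def)
    have neg: "((\<lambda>n. - (G n - M n)) has_sum - (voronoi_sum x - voronoi_const * voronoi_partial \<phi> N x)) {1..}"
      using has_sum_cmult_right[OF diff, of "-1"] by simp
    define U where "U = (\<lambda>n. 2 * x powr (- 3 / 4) * (real (divisor_tau n) * real n powr (- 7 / 4)) +
        x powr (- 1 / 4) * real N powr (- 1 / 8) * (real (divisor_tau n) * real n powr (- 9 / 8)))"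
    have U: "(U has_sum (2 * x powr (- 3 / 4) * (zeta_real (7 / 4))\<^sup>2 + x powr (- 1 / 4) * real N powr (- 1 / 8) * (zeta_real (9 / 8))\<^sup>2)) {1..}"
      unfolding U_def using divisor_tau_powr_has_sum[of "- 7 / 4"] divisor_tau_powr_has_sum[of "- 9 / 8"]
      by (intro has_sum_add has_sum_cmult_right) auto
    have GM: "\<bar>G n - M n\<bar> \<le> U n" if n: "n \<in> {1..}" for n
    proof -
      have n0: "real n > 0" "n \<ge> 1" using n by auto
      define T where "T = voronoi_const * x powr (- 1 / 4) *
        (real (divisor_tau n) * real n powr (- 5 / 4) * cos (4 * pi * sqrt (real n * x) + \<phi>))"
      define z where "z = 2 * pi * sqrt (real n * x)"
      have z: "z \<ge> 1" using voronoi_argument_ge_1[of x n 1] x n by (simp add: z_def)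
      have sz: "sqrt z = sqrt (2 * pi) * (real n powr (1 / 4) * x powr (1 / 4))"
        using x n0 by (simp add: z_def real_sqrt_mult powr_quarter)
      have zz: "z * sqrt z \<ge> real n powr (3 / 4) * x powr (3 / 4)"
      proof -
        have "sqrt (real n * x) = real n powr (1 / 2) * x powr (1 / 2)"
          using x n0 by (simp add: real_sqrt_mult powr_half_sqrt)
        then have "z * sqrt z = (2 * pi * sqrt (2 * pi)) * ((real n powr (1 / 2) * real n powr (1 / 4)) * (x powr (1 / 2) * x powr (1 / 4)))"
          unfolding sz by (simp add: z_def mult_ac)
        also have "\<dots> = (2 * pi * sqrt (2 * pi)) * (real n powr (3 / 4) * x powr (3 / 4))"
          by (simp flip: powr_add)
        also have "\<dots> \<ge> 1 * (real n powr (3 / 4) * x powr (3 / 4))"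
          using pi_gt3 mult_mono[of 1 "2 * pi" 1 "sqrt (2 * pi)"] by (intro mult_right_mono) auto
        finally show ?thesis by simp
      qed
      have T_eq: "T = real (divisor_tau n) * (sqrt pi / (2 * sqrt z) * cos (2 * z + \<phi>) / (pi\<^sup>2 * real n))"
      proof -
        have a: "real n powr (- 5 / 4) = 1 / (real n powr (1 / 4) * real n)"
          using powr_divide_nat[of n "- 1 / 4"] n0 by (simp add: powr_minus field_simps)
        have b: "x powr (- 1 / 4) = 1 / x powr (1 / 4)" by (simp add: powr_minus field_simps)
        have c: "sqrt pi / (2 * sqrt z) = 1 / (2 * sqrt 2) * (1 / (real n powr (1 / 4) * x powr (1 / 4)))"
          unfolding sz by (simp add: real_sqrt_mult)
        have d: "4 * pi * sqrt (real n * x) + \<phi> = 2 * z + \<phi>" by (simp add: z_def)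
        show ?thesis unfolding T_def a b c d voronoi_const_def by simp
      qed
      have "G n - T = real (divisor_tau n) * ((kernel_limit z - sqrt pi / (2 * sqrt z) * cos (2 * z + \<phi>)) / (pi\<^sup>2 * real n))"
        unfolding G_def T_eq z_def[symmetric] by (simp add: diff_divide_distrib right_diff_distrib)
      then have "\<bar>G n - T\<bar> = real (divisor_tau n) * (\<bar>kernel_limit z - sqrt pi / (2 * sqrt z) * cos (2 * z + \<phi>)\<bar> / (pi\<^sup>2 * real n))"
        by (simp add: abs_mult abs_divide)
      also have "\<dots> \<le> real (divisor_tau n) * ((2 / (real n powr (3 / 4) * x powr (3 / 4))) / (1 * real n))"
      proof (intro mult_left_mono frac_le mult_right_mono)
        have "2 / (z * sqrt z) \<le> 2 / (real n powr (3 / 4) * x powr (3 / 4))"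
          using zz n0 x z by (intro divide_left_mono mult_pos_pos) auto
        then show "\<bar>kernel_limit z - sqrt pi / (2 * sqrt z) * cos (2 * z + \<phi>)\<bar> \<le> 2 / (real n powr (3 / 4) * x powr (3 / 4))"
          using \<phi>[OF z] by linarith
        show "1 \<le> pi\<^sup>2" using pi_gt3 by (intro one_le_power) simp
      qed (use n0 in auto)
      also have "\<dots> = 2 * x powr (- 3 / 4) * (real (divisor_tau n) * real n powr (- 7 / 4))"
      proof -
        have "real n powr (- 7 / 4) = 1 / (real n powr (3 / 4) * real n)"
          using powr_divide_nat[of n "- 3 / 4"] n0 by (simp add: powr_minus field_simps)
        moreover have "x powr (- 3 / 4) = 1 / x powr (3 / 4)" by (simp add: powr_minus field_simps)
        ultimately show ?thesis by (simp add: mult_ac)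
      qed
      finally have 1: "\<bar>G n - T\<bar> \<le> 2 * x powr (- 3 / 4) * (real (divisor_tau n) * real n powr (- 7 / 4))" .
      have 2: "\<bar>T - M n\<bar> \<le> x powr (- 1 / 4) * real N powr (- 1 / 8) * (real (divisor_tau n) * real n powr (- 9 / 8))"
      proof (cases "n \<le> N")
        case True
        then show ?thesis by (simp add: T_def M_def)
      next
        case False
        have vc: "0 \<le> voronoi_const" "voronoi_const \<le> 1"
        proof -
          have "1 \<le> sqrt (2 :: real)" by simp
          then have "1 \<le> 2 * sqrt (2 :: real)" by linarith
          then have "1 * 1 \<le> (2 * sqrt 2) * pi\<^sup>2" using pi_gt3 by (intro mult_mono one_le_power) auto
          then show "voronoi_const \<le> 1" unfolding voronoi_const_def by (intro divide_le_eq_1_pos[THEN iffD2]) auto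
          show "0 \<le> voronoi_const" by (simp add: voronoi_const_def)
        qed
        have "\<bar>T - M n\<bar> = voronoi_const * x powr (- 1 / 4) * (real (divisor_tau n) * real n powr (- 5 / 4) * \<bar>cos (4 * pi * sqrt (real n * x) + \<phi>)\<bar>)"
          using False vc by (simp add: T_def M_def abs_mult)
        also have "\<dots> \<le> 1 * x powr (- 1 / 4) * (real (divisor_tau n) * real n powr (- 5 / 4) * 1)"
          using vc by (intro mult_mono) auto
        also have "real n powr (- 5 / 4) = real n powr (- 1 / 8) * real n powr (- 9 / 8)" by (simp flip: powr_add)
        also have "1 * x powr (- 1 / 4) * (real (divisor_tau n) * (real n powr (- 1 / 8) * real n powr (- 9 / 8)) * 1) \<le>
            1 * x powr (- 1 / 4) * (real (divisor_tau n) * (real N powr (- 1 / 8) * real n powr (- 9 / 8)) * 1)"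
          using False N by (intro mult_left_mono mult_right_mono powr_mono2') auto
        finally show ?thesis by (simp add: mult_ac)
      qed
      show ?thesis unfolding U_def using 1 2 by linarith
    qed
    have "\<bar>voronoi_sum x - voronoi_const * voronoi_partial \<phi> N x\<bar> \<le>
       2 * x powr (- 3 / 4) * (zeta_real (7 / 4))\<^sup>2 + x powr (- 1 / 4) * real N powr (- 1 / 8) * (zeta_real (9 / 8))\<^sup>2"
    proof (rule abs_leI)
      show "voronoi_sum x - voronoi_const * voronoi_partial \<phi> N x \<le>
         2 * x powr (- 3 / 4) * (zeta_real (7 / 4))\<^sup>2 + x powr (- 1 / 4) * real N powr (- 1 / 8) * (zeta_real (9 / 8))\<^sup>2"
        by (rule has_sum_mono[OF diff U]) (use GM in \<open>auto simp: abs_le_iff\<close>)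
      show "- (voronoi_sum x - voronoi_const * voronoi_partial \<phi> N x) \<le>
         2 * x powr (- 3 / 4) * (zeta_real (7 / 4))\<^sup>2 + x powr (- 1 / 4) * real N powr (- 1 / 8) * (zeta_real (9 / 8))\<^sup>2"
        by (rule has_sum_mono[OF neg U]) (use GM in \<open>auto simp: abs_le_iff\<close>)
    qed
    also have "\<dots> \<le> C * (x powr (- 3 / 4) + x powr (- 1 / 4) * real N powr (- 1 / 8))"
    proof -
      have "0 \<le> (zeta_real (9 / 8))\<^sup>2 * x powr (- 3 / 4)" "0 \<le> 2 * (zeta_real (7 / 4))\<^sup>2 * (x powr (- 1 / 4) * real N powr (- 1 / 8))"
        by simp_all
      then show ?thesis unfolding C_def by (simp add: algebra_simps)
    qed
    finally show ?thesis .
  qed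
  moreover have "C \<ge> 0" by (simp add: C_def)
  ultimately show ?thesis by blast
qed

section \<open>From the logarithmic mean back to the divisor error term\<close>

definition divisor_sum :: "real \<Rightarrow> real" where
  "divisor_sum x = (\<Sum>n | 1 \<le> n \<and> real n \<le> x. real (divisor_tau n))"

definition divisor_main :: "real \<Rightarrow> real" where
  "divisor_main x = x * ln x + (2 * euler_mascheroni - 1) * x"

lemma Delta_eq: "Delta x = divisor_sum x - divisor_main x"
  by (simp add: Delta_def divisor_sum_def divisor_main_def)

lemma finite_le_real: "finite {n. 1 \<le> n \<and> real n \<le> x}"
  by (rule finite_subset[of _ "{..nat \<lfloor>x\<rfloor>}"]) (auto simp: le_nat_floor)

lemma divisor_sum_mono: "x \<le> y \<Longrightarrow> divisor_sum x \<le> divisor_sum y"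
  unfolding divisor_sum_def by (intro sum_mono2 finite_le_real) auto

lemma divisor_sum_nonneg: "divisor_sum x \<ge> 0"
  unfolding divisor_sum_def by (intro sum_nonneg) auto

text \<open>The logarithmic mean is the integral of \<open>divisor_sum t\<close> dt/t, and
  \<open>divisor_sum\<close> is monotone; the proof compares term by term instead of integrating a
  step function.\<close>

lemma log_divisor_sum_increment:
  assumes x: "1 \<le> x" "x \<le> y"
  shows "divisor_sum x * ln (y / x) \<le> log_divisor_sum y - log_divisor_sum x"
    "log_divisor_sum y - log_divisor_sum x \<le> divisor_sum y * ln (y / x)"
proof -
  define A where "A = (\<lambda>x. {n. 1 \<le> n \<and> real n \<le> x})"
  have sub: "A x \<subseteq> A y" and fA: "finite (A x)" "finite (A y)"
    using x finite_le_real by (auto simp: A_def)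
  have A: "{n. 1 \<le> n \<and> real n \<le> x} = A x" for x by (simp add: A_def)
  have S: "sum g (A y) = sum g (A x) + sum g (A y - A x)" for g :: "nat \<Rightarrow> real"
    using sum.subset_diff[OF sub fA(2), of g] by (simp only: add.commute)
  \<comment> \<open>The logarithmic length of the part of [x, y] on which \<open>n\<close> is
    already counted.\<close>
  define c where "c = (\<lambda>n. if real n \<le> x then ln (y / x) else ln (y / real n))"
  have "log_divisor_sum y = (\<Sum>n\<in>A x. real (divisor_tau n) * ln (y / real n)) + (\<Sum>n\<in>A y - A x. real (divisor_tau n) * ln (y / real n))"
    unfolding log_divisor_sum_def A S ..
  moreover have "(\<Sum>n\<in>A y - A x. real (divisor_tau n) * ln (y / real n)) = (\<Sum>n\<in>A y - A x. real (divisor_tau n) * c n)"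
    by (intro sum.cong refl) (auto simp: c_def A_def)
  moreover have "(\<Sum>n\<in>A x. real (divisor_tau n) * ln (y / real n)) - log_divisor_sum x = (\<Sum>n\<in>A x. real (divisor_tau n) * c n)"
    unfolding log_divisor_sum_def A sum_subtractf[symmetric]
  proof (intro sum.cong refl)
    fix n assume "n \<in> A x"
    then have n: "0 < real n" "real n \<le> x" by (auto simp: A_def)
    then show "real (divisor_tau n) * ln (y / real n) - real (divisor_tau n) * ln (x / real n) = real (divisor_tau n) * c n"
      using x by (simp add: c_def ln_div algebra_simps)
  qed
  moreover have "(\<Sum>n\<in>A y. real (divisor_tau n) * c n) = (\<Sum>n\<in>A x. real (divisor_tau n) * c n) + (\<Sum>n\<in>A y - A x. real (divisor_tau n) * c n)"
    by (rule S)
  ultimately have eq: "log_divisor_sum y - log_divisor_sum x = (\<Sum>n\<in>A y. real (divisor_tau n) * c n)" by linarith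
  have c: "0 \<le> c n" "c n \<le> ln (y / x)" if "n \<in> A y" for n
  proof -
    have n: "1 \<le> real n" "real n \<le> y" using that by (auto simp: A_def)
    show "0 \<le> c n" using n x by (simp add: c_def)
    show "c n \<le> ln (y / x)"
    proof (cases "real n \<le> x")
      case False
      then have "y / real n \<le> y / x" using x by (intro divide_left_mono) auto
      then show ?thesis using False n x by (simp add: c_def)
    qed (simp add: c_def)
  qed
  have "(\<Sum>n\<in>A y. real (divisor_tau n) * c n) \<le> (\<Sum>n\<in>A y. real (divisor_tau n) * ln (y / x))"
    using c by (intro sum_mono mult_left_mono) auto
  then show "log_divisor_sum y - log_divisor_sum x \<le> divisor_sum y * ln (y / x)"
    unfolding eq by (simp add: divisor_sum_def A_def sum_distrib_right)
  have "(\<Sum>n\<in>A x. real (divisor_tau n) * ln (y / x)) = (\<Sum>n\<in>A x. real (divisor_tau n) * c n)"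
    by (intro sum.cong refl) (simp add: c_def A_def)
  also have "\<dots> \<le> (\<Sum>n\<in>A y. real (divisor_tau n) * c n)"
    using c sub fA by (intro sum_mono2) auto
  finally show "divisor_sum x * ln (y / x) \<le> log_divisor_sum y - log_divisor_sum x"
    unfolding eq by (simp add: divisor_sum_def A_def sum_distrib_right)
qed

text \<open>Chosen as a primitive of \<open>divisor_main x / x\<close>, so that main terms obey the
  same sandwich as the sums. The remaining ln x / 4 and the constant are left to the error.\<close>

definition log_divisor_main :: "real \<Rightarrow> real" where
  "log_divisor_main x = x * ln x + (2 * euler_mascheroni - 2) * x"

lemma divisor_main_deriv:
  "x > 0 \<Longrightarrow> (divisor_main has_real_derivative (ln x + 2 * euler_mascheroni)) (at x within S)"
  unfolding divisor_main_def by (auto intro!: derivative_eq_intros)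

lemma log_divisor_main_deriv:
  "x > 0 \<Longrightarrow> (log_divisor_main has_real_derivative (divisor_main x / x)) (at x within S)"
  unfolding divisor_main_def log_divisor_main_def by (auto intro!: derivative_eq_intros simp: field_simps)

lemma divisor_main_mono:
  assumes "1 \<le> x" "x \<le> y"
  shows "divisor_main x \<le> divisor_main y"
proof (rule DERIV_nonneg_imp_nondecreasing[OF assms(2)])
  fix s assume "x \<le> s" "s \<le> y"
  then have "s > 0" "ln s + 2 * euler_mascheroni \<ge> 0"
    using assms euler_mascheroni_pos by (auto intro!: add_nonneg_nonneg)
  then show "\<exists>D. (divisor_main has_real_derivative D) (at s) \<and> 0 \<le> D"
    using divisor_main_deriv by blast
qed

lemma log_divisor_main_increment:
  assumes x: "1 \<le> x" "x \<le> y"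
  shows "divisor_main x * ln (y / x) \<le> log_divisor_main y - log_divisor_main x"
    "log_divisor_main y - log_divisor_main x \<le> divisor_main y * ln (y / x)"
proof -
  have d: "((\<lambda>s. log_divisor_main s - c * ln s) has_real_derivative ((divisor_main s - c) / s)) (at s)" if "s > 0" for s c
    using that by (auto intro!: derivative_eq_intros log_divisor_main_deriv simp: diff_divide_distrib)
  have "log_divisor_main x - divisor_main x * ln x \<le> log_divisor_main y - divisor_main x * ln y"
  proof (rule DERIV_nonneg_imp_nondecreasing[OF x(2)])
    fix s assume s: "x \<le> s" "s \<le> y"
    have "(divisor_main s - divisor_main x) / s \<ge> 0" using divisor_main_mono[OF x(1) s(1)] s x by simp
    then show "\<exists>D. ((\<lambda>s. log_divisor_main s - divisor_main x * ln s) has_real_derivative D) (at s) \<and> 0 \<le> D"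
      using d[of s "divisor_main x"] s x by auto
  qed
  then show "divisor_main x * ln (y / x) \<le> log_divisor_main y - log_divisor_main x"
    using x by (simp add: ln_div algebra_simps)
  have "log_divisor_main x - divisor_main y * ln x \<ge> log_divisor_main y - divisor_main y * ln y"
  proof (rule DERIV_nonpos_imp_nonincreasing[OF x(2)])
    fix s assume s: "x \<le> s" "s \<le> y"
    have "(divisor_main s - divisor_main y) / s \<le> 0" using divisor_main_mono[of s y] s x by (simp add: divide_nonpos_pos)
    then show "\<exists>D. ((\<lambda>s. log_divisor_main s - divisor_main y * ln s) has_real_derivative D) (at s) \<and> D \<le> 0"
      using d[of s "divisor_main y"] s x by auto
  qed
  then show "log_divisor_main y - log_divisor_main x \<le> divisor_main y * ln (y / x)"
    using x by (simp add: ln_div algebra_simps)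
qed

text \<open>Monotonicity is one-sided: the increment over [x, y] bounds \<open>Delta\<close> from
  above at the left endpoint and from below at the right endpoint. The growth of the main term
  across the window is the price.\<close>

lemma Delta_increment_bounds:
  assumes x: "1 \<le> x" "x \<le> y"
  defines "E \<equiv> \<lambda>x. log_divisor_sum x - log_divisor_main x"
  shows "ln (y / x) * Delta x \<le> ln (y / x) * (divisor_main y - divisor_main x) + (E y - E x)"
    "- (ln (y / x) * (divisor_main y - divisor_main x)) + (E y - E x) \<le> ln (y / x) * Delta y"
  using log_divisor_sum_increment[OF x] log_divisor_main_increment[OF x]
  unfolding Delta_eq E_def by (auto simp: algebra_simps)

text \<open>The coefficient after differentiation: the phase derivative raises n^(-5/4) by
  n^(1/2).\<close>

definition tau_coeff :: "nat \<Rightarrow> real" where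
  "tau_coeff n = real (divisor_tau n) * real n powr (- 3 / 4)"

abbreviation tau_sine_sum :: "real \<Rightarrow> nat set \<Rightarrow> real \<Rightarrow> real" where
  "tau_sine_sum \<phi> A x \<equiv> sqrt_sine_sum \<phi> tau_coeff A x"

lemma continuous_on_sqrt_sine_sum [continuous_intros]: "continuous_on S (sqrt_sine_sum \<phi> a A)"
  unfolding sqrt_sine_sum_def by (intro continuous_intros)

lemma ln_has_integral:
  fixes x y :: real
  shows "0 < x \<Longrightarrow> x \<le> y \<Longrightarrow> ((\<lambda>s. 1 / s) has_integral ln (y / x)) {x..y}"
proof -
  assume xy: "0 < x" "x \<le> y"
  have "((\<lambda>s. 1 / s) has_integral (ln y - ln x)) {x..y}"
    by (rule fundamental_theorem_of_calculus[where f = ln])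
      (use xy in \<open>auto intro!: derivative_eq_intros simp flip: has_real_derivative_iff_has_vector_derivative\<close>)
  then show ?thesis using xy by (simp add: ln_div)
qed

lemma sqrt_phase_deriv:
  assumes "n > 0" "s > 0"
  shows "((\<lambda>s. 4 * pi * sqrt (real n * s) + \<phi>) has_real_derivative 4 * pi * (real n * (inverse (sqrt (real n * s)) / 2))) (at s within S)"
proof -
  have "real n * s > 0" using assms by simp
  then show ?thesis by (auto intro!: derivative_eq_intros)
qed

lemmas cos_sqrt_phase_deriv = DERIV_chain2[OF DERIV_cos sqrt_phase_deriv]
lemmas sin_sqrt_phase_deriv = DERIV_chain2[OF DERIV_sin sqrt_phase_deriv]

text \<open>Differentiating the cosines gives the integrand \<open>s powr (- 3 / 4)\<close> times
  the sine sum. Differentiating the prefactor gives an error of at most a constant times 1/s,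
  uniformly in \<open>N\<close> because the sum of \<open>tau(n) n^(-5/4)\<close> converges.\<close>

lemma voronoi_partial_increment:
  assumes x: "1 \<le> x" "x \<le> y"
  shows "\<bar>voronoi_partial \<phi> N y - voronoi_partial \<phi> N x +
      2 * pi * integral {x..y} (\<lambda>s. s powr (- 3 / 4) * tau_sine_sum \<phi> {1..N} s)\<bar> \<le> (zeta_real (5 / 4))\<^sup>2 / 4 * ln (y / x)"
proof -
  define c where "c = (\<lambda>s. \<Sum>n=1..N. real (divisor_tau n) * real n powr (- 5 / 4) * cos (4 * pi * sqrt (real n * s) + \<phi>))"
  define g where "g = (\<lambda>s. s powr (- 3 / 4) * tau_sine_sum \<phi> {1..N} s)"
  have cb: "\<bar>c s\<bar> \<le> (zeta_real (5 / 4))\<^sup>2" for s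
  proof -
    have "\<bar>c s\<bar> \<le> (\<Sum>n=1..N. real (divisor_tau n) * real n powr (- 5 / 4))"
      unfolding c_def
    proof (rule order_trans[OF sum_abs], rule sum_mono)
      fix n
      show "\<bar>real (divisor_tau n) * real n powr (- 5 / 4) * cos (4 * pi * sqrt (real n * s) + \<phi>)\<bar> \<le> real (divisor_tau n) * real n powr (- 5 / 4)"
        unfolding abs_mult by (simp add: mult_left_le)
    qed
    also have "\<dots> \<le> (zeta_real (5 / 4))\<^sup>2"
      by (rule has_sum_mono2[OF has_sum_finite]) (use divisor_tau_powr_has_sum[of "- 5 / 4"] in auto)
    finally show ?thesis .
  qed
  have d: "(voronoi_partial \<phi> N has_real_derivative (- (2 * pi * g s) - s powr (- 5 / 4) / 4 * c s)) (at s within S)" if s: "s > 0" for s S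
  proof -
    have cd: "(c has_real_derivative - (2 * pi * s powr (- 1 / 2) * tau_sine_sum \<phi> {1..N} s)) (at s within S)"
    proof -
      have "(c has_real_derivative (\<Sum>n=1..N. real (divisor_tau n) * real n powr (- 5 / 4) *
          (- sin (4 * pi * sqrt (real n * s) + \<phi>) * (4 * pi * (real n * (inverse (sqrt (real n * s)) / 2)))))) (at s within S)"
        unfolding c_def using s by (intro DERIV_sum DERIV_cmult cos_sqrt_phase_deriv) auto
      also have "(\<Sum>n=1..N. real (divisor_tau n) * real n powr (- 5 / 4) *
          (- sin (4 * pi * sqrt (real n * s) + \<phi>) * (4 * pi * (real n * (inverse (sqrt (real n * s)) / 2))))) =
          (\<Sum>n=1..N. - (2 * pi * s powr (- 1 / 2)) * (tau_coeff n * sin (4 * pi * sqrt (real n * s) + \<phi>)))"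
      proof (intro sum.cong refl)
        fix n assume "n \<in> {1..N}"
        then have n: "real n > 0" by simp
        have "real n * (inverse (sqrt (real n * s)) / 2) = real n powr 1 * (real n powr (- 1 / 2) * s powr (- 1 / 2)) / 2"
        proof -
          have "inverse (sqrt (real n * s)) = (real n * s) powr (- (1 / 2))"
            using n s by (simp only: powr_minus powr_half_sqrt mult_nonneg_nonneg less_imp_le)
          also have "\<dots> = real n powr (- (1 / 2)) * s powr (- (1 / 2))" by (rule powr_mult)
          finally show ?thesis using n by simp
        qed
        also have "\<dots> = real n powr (1 / 2) * s powr (- 1 / 2) / 2"
        proof -
          have "real n powr 1 * real n powr (- 1 / 2) = real n powr (1 / 2)" by (subst powr_add[symmetric]) simp
          then show ?thesis by (simp only: mult.assoc[symmetric])
        qed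
        finally have 1: "real n * (inverse (sqrt (real n * s)) / 2) = real n powr (1 / 2) * s powr (- 1 / 2) / 2" .
        have 2: "real n powr (- 3 / 4) = real n powr (- 5 / 4) * real n powr (1 / 2)" by (simp flip: powr_add)
        show "real (divisor_tau n) * real n powr (- 5 / 4) *
          (- sin (4 * pi * sqrt (real n * s) + \<phi>) * (4 * pi * (real n * (inverse (sqrt (real n * s)) / 2)))) =
          - (2 * pi * s powr (- 1 / 2)) * (tau_coeff n * sin (4 * pi * sqrt (real n * s) + \<phi>))"
          unfolding 1 tau_coeff_def 2 by simp
      qed
      also have "\<dots> = - (2 * pi * s powr (- 1 / 2) * tau_sine_sum \<phi> {1..N} s)"
        unfolding sqrt_sine_sum_def sum_distrib_left[symmetric] by simp
      finally show ?thesis .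
    qed
    have "((\<lambda>s. s powr (- 1 / 4) * c s) has_real_derivative
       (s powr (- 1 / 4) * (- (2 * pi * s powr (- 1 / 2) * tau_sine_sum \<phi> {1..N} s)) + (- 1 / 4 * s powr (- 1 / 4 - 1)) * c s)) (at s within S)"
      by (intro DERIV_mult' cd has_real_derivative_powr'[THEN DERIV_subset]) (use s in \<open>auto intro!: derivative_eq_intros\<close>)
    moreover have "s powr (- 3 / 4) = s powr (- 1 / 4) * s powr (- 1 / 2)" by (simp flip: powr_add)
    moreover have vp: "voronoi_partial \<phi> N = (\<lambda>s. s powr (- 1 / 4) * c s)"
      by (simp add: voronoi_partial_def c_def fun_eq_iff)
    ultimately show ?thesis unfolding vp g_def by (simp add: mult_ac)
  qed
  have "((\<lambda>s. - (2 * pi * g s) - s powr (- 5 / 4) / 4 * c s) has_integral (voronoi_partial \<phi> N y - voronoi_partial \<phi> N x)) {x..y}"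
    by (intro fundamental_theorem_of_calculus x)
      (use x d in \<open>auto simp flip: has_real_derivative_iff_has_vector_derivative\<close>)
  moreover have "(\<lambda>s. g s) integrable_on {x..y}"
    unfolding g_def using x by (intro integrable_continuous_real continuous_intros) auto
  ultimately have "((\<lambda>s. (- (2 * pi * g s) - s powr (- 5 / 4) / 4 * c s) + 2 * pi * g s) has_integral
      (voronoi_partial \<phi> N y - voronoi_partial \<phi> N x + 2 * pi * integral {x..y} g)) {x..y}"
    by (intro has_integral_add has_integral_mult_right integrable_integral)
  then have hi: "((\<lambda>s. - (s powr (- 5 / 4) / 4 * c s)) has_integral
      (voronoi_partial \<phi> N y - voronoi_partial \<phi> N x + 2 * pi * integral {x..y} g)) {x..y}" by simp
  have "norm (voronoi_partial \<phi> N y - voronoi_partial \<phi> N x + 2 * pi * integral {x..y} g) \<le> (zeta_real (5 / 4))\<^sup>2 / 4 * ln (y / x)"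
  proof -
    define Z where "Z = (zeta_real (5 / 4))\<^sup>2"
    have zi: "((\<lambda>s. Z / 4 * (1 / s)) has_integral (Z / 4 * ln (y / x))) {x..y}"
      using x by (intro has_integral_mult_right ln_has_integral) auto
    have "norm (integral {x..y} (\<lambda>s. - (s powr (- 5 / 4) / 4 * c s))) \<le> integral {x..y} (\<lambda>s. Z / 4 * (1 / s))"
    proof (rule integral_norm_bound_integral)
      fix s assume s: "s \<in> {x..y}"
      then have "s powr (- 5 / 4) \<le> s powr (- 1)" using x by (intro powr_mono) auto
      moreover have "s powr (- 1) = 1 / s" using s x by (intro powr_neg_one) auto
      ultimately have "s powr (- 5 / 4) \<le> 1 / s" by (simp only:)
      then have "s powr (- 5 / 4) / 4 * \<bar>c s\<bar> \<le> 1 / s / 4 * Z"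
        using cb[of s] s x by (intro mult_mono divide_right_mono) (auto simp: Z_def)
      then show "norm (- (s powr (- 5 / 4) / 4 * c s)) \<le> Z / 4 * (1 / s)"
        by (simp add: abs_mult mult_ac)
    qed (use hi zi in \<open>auto intro: has_integral_integrable\<close>)
    then show ?thesis unfolding integral_unique[OF hi] integral_unique[OF zi] by (simp add: Z_def)
  qed
  then show ?thesis by (simp add: g_def)
qed

text \<open>Relative to the measure ds/s of the logarithmic mean, the density
  \<open>s powr (- 3 / 4)\<close> times the sine sum becomes this function. \<open>Delta\<close> is
  approximated by \<open>- tau_const\<close> times it; the sign comes from differentiating a
  cosine.\<close>

definition tau_approx :: "real \<Rightarrow> nat \<Rightarrow> real \<Rightarrow> real" where
  "tau_approx \<phi> K x = x powr (1 / 4) * tau_sine_sum \<phi> {1..K} x"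

text \<open>For s >= 1 differentiation of each term costs at most s^(1/4) s^(-1/2), so the
  derivative is bounded. The constant may grow with \<open>K\<close>, which stays fixed while X
  tends to infinity; it allows treating \<open>tau_approx\<close> as constant on a window.\<close>

lemma tau_approx_lipschitz:
  "\<exists>C\<ge>0. \<forall>u\<ge>1. \<forall>v\<ge>u. \<bar>tau_approx \<phi> K v - tau_approx \<phi> K u\<bar> \<le> C * (v - u)"
proof -
  define D where "D = (\<lambda>s. \<Sum>n=1..K. tau_coeff n * (cos (4 * pi * sqrt (real n * s) + \<phi>) * (4 * pi * (real n * (inverse (sqrt (real n * s)) / 2)))))"
  define C where "C = (\<Sum>n=1..K. tau_coeff n * (2 * pi * real n)) + (\<Sum>n=1..K. tau_coeff n)"
  have t0: "tau_coeff n \<ge> 0" for n by (simp add: tau_coeff_def)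
  have d: "(tau_approx \<phi> K has_real_derivative
      (s powr (1 / 4) * D s + (1 / 4 * s powr (1 / 4 - 1)) * tau_sine_sum \<phi> {1..K} s)) (at s within S)" if s: "s > 0" for s S
  proof -
    have "(tau_sine_sum \<phi> {1..K} has_real_derivative D s) (at s within S)"
      unfolding sqrt_sine_sum_def D_def using s by (intro DERIV_sum DERIV_cmult sin_sqrt_phase_deriv) auto
    then show ?thesis unfolding tau_approx_def
      by (intro DERIV_mult' has_real_derivative_powr'[THEN DERIV_subset]) (use s in \<open>auto intro!: derivative_eq_intros\<close>)
  qed
  have b: "\<bar>s powr (1 / 4) * D s + (1 / 4 * s powr (1 / 4 - 1)) * tau_sine_sum \<phi> {1..K} s\<bar> \<le> C" if s: "s \<ge> 1" for s
  proof -
    have 1: "\<bar>s powr (1 / 4) * D s\<bar> \<le> (\<Sum>n=1..K. tau_coeff n * (2 * pi * real n))"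
    proof -
      have eq: "s powr (1 / 4) * D s = (\<Sum>n=1..K. tau_coeff n * (cos (4 * pi * sqrt (real n * s) + \<phi>) * (2 * pi * real n * (s powr (1 / 4) * inverse (sqrt (real n * s))))))"
        unfolding D_def sum_distrib_left by (intro sum.cong refl) simp
      have "\<bar>s powr (1 / 4) * D s\<bar> \<le> (\<Sum>n=1..K. tau_coeff n * (1 * (2 * pi * real n * 1)))"
        unfolding eq
      proof (rule order_trans[OF sum_abs], rule sum_mono)
        fix n assume "n \<in> {1..K}"
        then have n: "1 \<le> real n" by simp
        have "s powr (1 / 4) \<le> s powr (1 / 2)" using s by (intro powr_mono) auto
        also have "\<dots> = 1 * sqrt s" using s by (simp add: powr_half_sqrt)
        also have "\<dots> \<le> sqrt (real n) * sqrt s" using n s by (intro mult_right_mono) auto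
        also have "\<dots> = sqrt (real n * s)" by (simp add: real_sqrt_mult)
        finally have "s powr (1 / 4) * inverse (sqrt (real n * s)) \<le> 1"
          using n s by (simp add: divide_inverse[symmetric] divide_le_eq_1)
        moreover have "0 \<le> s powr (1 / 4) * inverse (sqrt (real n * s))" using s by simp
        ultimately have "\<bar>cos (4 * pi * sqrt (real n * s) + \<phi>)\<bar> * \<bar>2 * pi * real n * (s powr (1 / 4) * inverse (sqrt (real n * s)))\<bar> \<le> 1 * (2 * pi * real n * 1)"
        proof (intro mult_mono)
          assume q: "s powr (1 / 4) * inverse (sqrt (real n * s)) \<le> 1" "0 \<le> s powr (1 / 4) * inverse (sqrt (real n * s))"
          have "0 \<le> 2 * pi * real n * (s powr (1 / 4) * inverse (sqrt (real n * s)))"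
            by (rule mult_nonneg_nonneg[OF _ q(2)]) simp
          then have "\<bar>2 * pi * real n * (s powr (1 / 4) * inverse (sqrt (real n * s)))\<bar> = 2 * pi * real n * (s powr (1 / 4) * inverse (sqrt (real n * s)))"
            by (rule abs_of_nonneg)
          also have "\<dots> \<le> 2 * pi * real n * 1" using q(1) by (intro mult_left_mono) auto
          finally show "\<bar>2 * pi * real n * (s powr (1 / 4) * inverse (sqrt (real n * s)))\<bar> \<le> 2 * pi * real n * 1" .
        qed auto
        then show "\<bar>tau_coeff n * (cos (4 * pi * sqrt (real n * s) + \<phi>) * (2 * pi * real n * (s powr (1 / 4) * inverse (sqrt (real n * s)))))\<bar>
           \<le> tau_coeff n * (1 * (2 * pi * real n * 1))"
          unfolding abs_mult[of "tau_coeff n"] abs_mult[of "cos _"] using t0[of n] by (simp add: mult_left_mono)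
      qed
      then show ?thesis by simp
    qed
    have 2: "\<bar>(1 / 4 * s powr (1 / 4 - 1)) * tau_sine_sum \<phi> {1..K} s\<bar> \<le> 1 * (\<Sum>n=1..K. tau_coeff n)"
      unfolding abs_mult
    proof (intro mult_mono)
      have "s powr (1 / 4 - 1) \<le> s powr 0" using s by (intro powr_mono) auto
      then show "\<bar>1 / 4\<bar> * \<bar>s powr (1 / 4 - 1)\<bar> \<le> 1" using s by simp
      show "\<bar>tau_sine_sum \<phi> {1..K} s\<bar> \<le> (\<Sum>n=1..K. tau_coeff n)"
        unfolding sqrt_sine_sum_def
        by (rule order_trans[OF sum_abs], rule sum_mono) (use t0 in \<open>auto simp: abs_mult mult_left_le\<close>)
    qed (use t0 in \<open>auto intro: sum_nonneg\<close>)
    show ?thesis unfolding C_def using order_trans[OF abs_triangle_ineq add_mono[OF 1 2]] by simp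
  qed
  have "\<bar>tau_approx \<phi> K v - tau_approx \<phi> K u\<bar> \<le> C * (v - u)" if "u \<ge> 1" "v \<ge> u" for u v
  proof -
    have "norm (tau_approx \<phi> K v - tau_approx \<phi> K u) \<le> C * norm (v - u)"
      by (rule field_differentiable_bound[where S = "{u..v}"
            and f' = "\<lambda>s. s powr (1 / 4) * D s + (1 / 4 * s powr (1 / 4 - 1)) * tau_sine_sum \<phi> {1..K} s"])
        (use that d b in auto)
    then show ?thesis using that by simp
  qed
  moreover have "C \<ge> 0" unfolding C_def using t0 by (intro add_nonneg_nonneg sum_nonneg) auto
  ultimately show ?thesis by blast
qed

text \<open>Cauchy-Schwarz against the constant 1, obtained by integrating the square of
  \<open>\<bar>f s\<bar> - m\<close> with \<open>m\<close> the mean of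
  \<open>\<bar>f s\<bar>\<close>.\<close>

lemma integral_abs_square_le:
  fixes f :: "real \<Rightarrow> real"
  assumes "x < y" "continuous_on {x..y} f"
  shows "(integral {x..y} (\<lambda>s. \<bar>f s\<bar>))\<^sup>2 \<le> (y - x) * integral {x..y} (\<lambda>s. (f s)\<^sup>2)"
proof -
  define I where "I = integral {x..y} (\<lambda>s. \<bar>f s\<bar>)"
  define m where "m = I / (y - x)"
  have h1: "((\<lambda>s. \<bar>f s\<bar>) has_integral I) {x..y}"
    unfolding I_def using assms by (intro integrable_integral integrable_continuous_real continuous_intros)
  have h2: "((\<lambda>s. (f s)\<^sup>2) has_integral integral {x..y} (\<lambda>s. (f s)\<^sup>2)) {x..y}"
    using assms by (intro integrable_integral integrable_continuous_real continuous_intros)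
  have h3: "((\<lambda>s. m\<^sup>2) has_integral (y - x) * m\<^sup>2) {x..y}"
    using has_integral_const_real[of "m\<^sup>2" x y] assms by simp
  have "((\<lambda>s. (f s)\<^sup>2 - 2 * m * \<bar>f s\<bar> + m\<^sup>2) has_integral
      (integral {x..y} (\<lambda>s. (f s)\<^sup>2) - 2 * m * I + (y - x) * m\<^sup>2)) {x..y}"
    by (intro has_integral_add has_integral_diff has_integral_mult_right h1 h2 h3)
  moreover have "0 \<le> (f s)\<^sup>2 - 2 * m * \<bar>f s\<bar> + m\<^sup>2" for s
    using zero_le_power2[of "\<bar>f s\<bar> - m"] by (simp add: power2_diff algebra_simps)
  ultimately have "0 \<le> integral {x..y} (\<lambda>s. (f s)\<^sup>2) - 2 * m * I + (y - x) * m\<^sup>2"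
    by (rule has_integral_nonneg)
  moreover have "2 * m * I - (y - x) * m\<^sup>2 = I\<^sup>2 / (y - x)"
  proof -
    have "2 * (I / d) * I - d * (I / d)\<^sup>2 = I\<^sup>2 / d" if "d > 0" for d
      using that by (simp add: power2_eq_square)
    then show ?thesis unfolding m_def using assms by simp
  qed
  ultimately have "I\<^sup>2 / (y - x) \<le> integral {x..y} (\<lambda>s. (f s)\<^sup>2)" by linarith
  then show ?thesis using assms by (simp add: I_def field_simps)
qed

text \<open>The constant 1 / (pi sqrt 2) of the classical Voronoi formula.\<close>

definition tau_const :: real where "tau_const = 2 * pi * voronoi_const"

lemma tau_const_pos: "tau_const > 0"
  by (simp add: tau_const_def voronoi_const_def)

text \<open>The terms n <= K of the averaged sine sum are replaced by their value at an endpoint,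
  which moves \<open>tau_approx\<close> to the left side at the cost \<open>L * (y - x)\<close>; the
  terms K < n <= N stay inside the window integral. Only \<open>L\<close> depends on
  \<open>K\<close>: the phase and \<open>C\<close> are fixed before it, which the final choice of
  \<open>K\<close> relies on for the phase.\<close>

lemma Delta_window_bound:
  "\<exists>\<phi> C. C \<ge> 0 \<and> (\<forall>K. \<exists>L\<ge>0. \<forall>N\<ge>max 1 K. \<forall>x\<ge>1. \<forall>y>x.
     (let W = (divisor_main y - divisor_main x) + C + L * (y - x)
        + y / (y - x) * (C * (x powr (- 3 / 4) + x powr (- 1 / 4) * real N powr (- 1 / 8)))
        + y / (y - x) * (tau_const * x powr (- 3 / 4) * integral {x..y} (\<lambda>s. \<bar>tau_sine_sum \<phi> {K<..N} s\<bar>))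
      in Delta x + tau_const * tau_approx \<phi> K x \<le> W \<and> - (Delta y + tau_const * tau_approx \<phi> K y) \<le> W))"
proof -
  obtain \<phi> C0 where C0: "C0 \<ge> 0" and V: "\<And>x N. x \<ge> 1 \<Longrightarrow> N \<ge> 1 \<Longrightarrow>
     \<bar>voronoi_sum x - voronoi_const * voronoi_partial \<phi> N x\<bar> \<le> C0 * (x powr (- 3 / 4) + x powr (- 1 / 4) * real N powr (- 1 / 8))"
    using voronoi_truncated by blast
  obtain c1 where c1: "\<And>x. x \<ge> 1 \<Longrightarrow> log_divisor_sum x = x * ln x + (2 * euler_mascheroni - 2) * x + ln x / 4 + c1 + voronoi_sum x"
    using log_divisor_sum_voronoi by blast
  define Z where "Z = (zeta_real (5 / 4))\<^sup>2"
  have vc: "voronoi_const > 0" by (simp add: voronoi_const_def)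
  have Z: "Z \<ge> 0" by (simp add: Z_def)
  \<comment> \<open>The 1/4 comes from the term ln x / 4, the next summand from differentiating the
    prefactor of the partial sum, and the factor 2 from truncation errors at both endpoints.\<close>
  define C where "C = max (1 / 4 + voronoi_const * Z / 4) (2 * C0)"
  have C: "1 / 4 + voronoi_const * Z / 4 \<le> C" "2 * C0 \<le> C" by (auto simp: C_def)
  have Cn: "C \<ge> 0" using C C0 by linarith
  have main: "\<exists>L\<ge>0. \<forall>N\<ge>max 1 K. \<forall>x\<ge>1. \<forall>y>x.
     (let W = (divisor_main y - divisor_main x) + C + L * (y - x)
        + y / (y - x) * (C * (x powr (- 3 / 4) + x powr (- 1 / 4) * real N powr (- 1 / 8)))
        + y / (y - x) * (tau_const * x powr (- 3 / 4) * integral {x..y} (\<lambda>s. \<bar>tau_sine_sum \<phi> {K<..N} s\<bar>))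
      in Delta x + tau_const * tau_approx \<phi> K x \<le> W \<and> - (Delta y + tau_const * tau_approx \<phi> K y) \<le> W)" for K
  proof -
    obtain L0 where "L0 \<ge> 0" "\<forall>u\<ge>1. \<forall>v\<ge>u. \<bar>tau_approx \<phi> K v - tau_approx \<phi> K u\<bar> \<le> L0 * (v - u)"
      using tau_approx_lipschitz[where K = K and \<phi> = \<phi>] by auto
    then have L0: "L0 \<ge> 0" "\<And>u v. u \<ge> 1 \<Longrightarrow> v \<ge> u \<Longrightarrow> \<bar>tau_approx \<phi> K v - tau_approx \<phi> K u\<bar> \<le> L0 * (v - u)"
      by auto
    show ?thesis
    proof (intro exI[of _ "tau_const * L0"] conjI allI impI)
      show "0 \<le> tau_const * L0" using L0 tau_const_pos by simp
      fix N x y assume N: "max 1 K \<le> N" and x: "(1::real) \<le> x" and y: "x < y"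
      define w where "w = ln (y / x)"
      have w: "w > 0" using x y by (simp add: w_def)
      \<comment> \<open>Everything is divided by \<open>w = ln (y / x)\<close> at the end, and w >=
        1 - x/y = (y - x)/y. This is the source of the factors \<open>y / (y - x)\<close> in the
        bound.\<close>
      have wy: "1 \<le> y / (y - x) * w"
      proof -
        have "ln (x / y) \<le> x / y - 1" using x y by (intro ln_le_minus_one) auto
        then have "1 - x / y \<le> w" using x y by (simp add: w_def ln_div)
        then have "y / (y - x) * (1 - x / y) \<le> y / (y - x) * w" using x y by (intro mult_left_mono) auto
        moreover have "y / (y - x) * (1 - x / y) = 1"
        proof -
          have "1 - x / y = (y - x) / y" using x y by (simp add: diff_divide_distrib)
          then show ?thesis using x y by simp
        qed
        ultimately show ?thesis by (simp only:)
      qed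
      define E where "E = (\<lambda>x. log_divisor_sum x - log_divisor_main x)"
      define err where "err = C0 * (x powr (- 3 / 4) + x powr (- 1 / 4) * real N powr (- 1 / 8))"
      define e where "e = C * (x powr (- 3 / 4) + x powr (- 1 / 4) * real N powr (- 1 / 8))"
      define R where "R = integral {x..y} (\<lambda>s. \<bar>tau_sine_sum \<phi> {K<..N} s\<bar>)"
      define m where "m = divisor_main y - divisor_main x"
      have err0: "err \<ge> 0" using C0 by (simp add: err_def)
      have e2: "2 * err \<le> e" unfolding err_def e_def mult.assoc[symmetric] using C by (intro mult_right_mono) auto
      have R0: "R \<ge> 0" unfolding R_def by (rule integral_nonneg) (auto intro!: integrable_continuous_real continuous_intros)
      have Ex: "E s = ln s / 4 + c1 + voronoi_sum s" if "s \<ge> 1" for s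
        using c1[OF that] by (simp add: E_def log_divisor_main_def)
      have Vx: "\<bar>voronoi_sum x - voronoi_const * voronoi_partial \<phi> N x\<bar> \<le> err"
        unfolding err_def using V[OF x] N by simp
      have Vy: "\<bar>voronoi_sum y - voronoi_const * voronoi_partial \<phi> N y\<bar> \<le> err"
      proof -
        have "C0 * (y powr (- 3 / 4) + y powr (- 1 / 4) * real N powr (- 1 / 8)) \<le> err"
          unfolding err_def using x y C0 by (intro mult_left_mono add_mono mult_right_mono powr_mono2') auto
        then show ?thesis using V[of y N] x y N by auto
      qed
      define I where "I = integral {x..y} (\<lambda>s. s powr (- 3 / 4) * tau_sine_sum \<phi> {1..N} s)"
      define I1 where "I1 = integral {x..y} (\<lambda>s. s powr (- 3 / 4) * tau_sine_sum \<phi> {1..K} s)"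
      define I2 where "I2 = integral {x..y} (\<lambda>s. s powr (- 3 / 4) * tau_sine_sum \<phi> {K<..N} s)"
      have P: "\<bar>voronoi_partial \<phi> N y - voronoi_partial \<phi> N x + 2 * pi * I\<bar> \<le> Z / 4 * w"
        unfolding Z_def w_def I_def using voronoi_partial_increment[of x y] x y by simp
      have I: "I = I1 + I2"
      proof -
        have "{1..N} = {1..K} \<union> {K<..N}" using N by auto
        then have "tau_sine_sum \<phi> {1..N} s = tau_sine_sum \<phi> {1..K} s + tau_sine_sum \<phi> {K<..N} s" for s
          unfolding sqrt_sine_sum_def by (simp only:) (intro sum.union_disjoint, auto)
        then show ?thesis unfolding I_def I1_def I2_def distrib_left using x
          by (subst Henstock_Kurzweil_Integration.integral_add[symmetric])
            (auto intro!: integrable_continuous_real continuous_intros simp: distrib_left)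
      qed
      have I2: "\<bar>I2\<bar> \<le> x powr (- 3 / 4) * R"
      proof -
        have "norm I2 \<le> integral {x..y} (\<lambda>s. x powr (- 3 / 4) * \<bar>tau_sine_sum \<phi> {K<..N} s\<bar>)"
          unfolding I2_def
        proof (rule integral_norm_bound_integral)
          fix s assume s: "s \<in> {x..y}"
          show "norm (s powr (- 3 / 4) * tau_sine_sum \<phi> {K<..N} s) \<le> x powr (- 3 / 4) * \<bar>tau_sine_sum \<phi> {K<..N} s\<bar>"
            unfolding norm_mult using s x by (auto intro!: mult_right_mono powr_mono2')
        qed (use x in \<open>auto intro!: integrable_continuous_real continuous_intros\<close>)
        then show ?thesis by (simp add: R_def)
      qed
      have I1: "\<bar>I1 - w * tau_approx \<phi> K v\<bar> \<le> w * (L0 * (y - x))" if v: "v \<in> {x..y}" for v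
      proof -
        have wi: "((\<lambda>s. 1 / s) has_integral w) {x..y}" unfolding w_def using x y by (intro ln_has_integral) auto
        have ii: "((\<lambda>s. s powr (- 3 / 4) * tau_sine_sum \<phi> {1..K} s) has_integral I1) {x..y}"
          unfolding I1_def using x by (intro integrable_integral integrable_continuous_real continuous_intros) auto
        have hd: "((\<lambda>s. s powr (- 3 / 4) * tau_sine_sum \<phi> {1..K} s - 1 / s * tau_approx \<phi> K v) has_integral (I1 - w * tau_approx \<phi> K v)) {x..y}"
          by (intro has_integral_diff ii has_integral_mult_left wi)
        have hu: "((\<lambda>s. 1 / s * (L0 * (y - x))) has_integral (w * (L0 * (y - x)))) {x..y}"
          by (intro has_integral_mult_left wi)
        have "norm (integral {x..y} (\<lambda>s. s powr (- 3 / 4) * tau_sine_sum \<phi> {1..K} s - 1 / s * tau_approx \<phi> K v))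
           \<le> integral {x..y} (\<lambda>s. 1 / s * (L0 * (y - x)))"
        proof (rule integral_norm_bound_integral)
          fix s assume s: "s \<in> {x..y}"
          then have s0: "s > 0" using x by simp
          have "s powr (- 3 / 4) = 1 / s * s powr (1 / 4)"
          proof -
            show ?thesis using powr_diff[of s "1 / 4" 1] s0 by simp
          qed
          then have "s powr (- 3 / 4) * tau_sine_sum \<phi> {1..K} s - 1 / s * tau_approx \<phi> K v = 1 / s * (tau_approx \<phi> K s - tau_approx \<phi> K v)"
            unfolding tau_approx_def[of \<phi> K s] by (simp add: right_diff_distrib diff_divide_distrib)
          moreover have "\<bar>tau_approx \<phi> K s - tau_approx \<phi> K v\<bar> \<le> L0 * (y - x)"
          proof -
            have "\<bar>tau_approx \<phi> K s - tau_approx \<phi> K v\<bar> \<le> L0 * \<bar>s - v\<bar>"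
              using L0(2)[of s v] L0(2)[of v s] s v x by (cases "s \<le> v") (auto simp: abs_minus_commute)
            also have "\<dots> \<le> L0 * (y - x)" using s v L0(1) by (intro mult_left_mono) auto
            finally show ?thesis .
          qed
          ultimately show "norm (s powr (- 3 / 4) * tau_sine_sum \<phi> {1..K} s - 1 / s * tau_approx \<phi> K v) \<le> 1 / s * (L0 * (y - x))"
            using s0 by (simp add: abs_mult divide_right_mono)
        qed (use hd hu in \<open>auto intro: has_integral_integrable\<close>)
        then show ?thesis unfolding integral_unique[OF hd] integral_unique[OF hu] by simp
      qed
      define G where "G = C * w + e + tau_const * (w * (L0 * (y - x)) + x powr (- 3 / 4) * R)"
      have key: "\<bar>E y - E x + w * (tau_const * tau_approx \<phi> K v)\<bar> \<le> G" if v: "v \<in> {x..y}" for v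
      proof -
        define dP where "dP = voronoi_partial \<phi> N y - voronoi_partial \<phi> N x"
        define dV where "dV = voronoi_sum y - voronoi_sum x"
        have Ed: "E y - E x = w / 4 + dV"
          using Ex[of x] Ex[of y] x y by (simp add: w_def dV_def ln_div diff_divide_distrib)
        have a: "\<bar>dV - voronoi_const * dP\<bar> \<le> e"
        proof -
          have "dV - voronoi_const * dP = (voronoi_sum y - voronoi_const * voronoi_partial \<phi> N y) - (voronoi_sum x - voronoi_const * voronoi_partial \<phi> N x)"
            by (simp add: dV_def dP_def algebra_simps)
          then show ?thesis using order_trans[OF abs_triangle_ineq4 add_mono[OF Vy Vx]] e2 by simp
        qed
        have b: "\<bar>voronoi_const * dP + tau_const * I\<bar> \<le> voronoi_const * (Z / 4 * w)"
        proof -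
          have "voronoi_const * dP + tau_const * I = voronoi_const * (dP + 2 * pi * I)"
            by (simp add: tau_const_def algebra_simps)
          then show ?thesis using P vc by (simp add: abs_mult dP_def)
        qed
        have c: "\<bar>tau_const * (w * tau_approx \<phi> K v) - tau_const * I\<bar> \<le> tau_const * (w * (L0 * (y - x)) + x powr (- 3 / 4) * R)"
        proof -
          have "\<bar>w * tau_approx \<phi> K v - I\<bar> \<le> w * (L0 * (y - x)) + x powr (- 3 / 4) * R"
            using I1[OF v] I2 unfolding I by (simp only: abs_le_iff) linarith
          then show ?thesis using tau_const_pos by (simp add: abs_mult flip: right_diff_distrib)
        qed
        have d: "w / 4 + voronoi_const * (Z / 4 * w) \<le> C * w"
          using mult_right_mono[OF C(1), of w] w by (simp add: algebra_simps)
        have "E y - E x + w * (tau_const * tau_approx \<phi> K v) =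
          w / 4 + (dV - voronoi_const * dP) + (voronoi_const * dP + tau_const * I) + (tau_const * (w * tau_approx \<phi> K v) - tau_const * I)"
          unfolding Ed by (simp add: algebra_simps)
        then show ?thesis unfolding G_def using a b c d w by (simp only: abs_le_iff) linarith
      qed
      have Gw: "G \<le> w * (C + tau_const * L0 * (y - x) + y / (y - x) * e + y / (y - x) * (tau_const * x powr (- 3 / 4) * R))"
      proof -
        have e0: "e \<ge> 0" using e2 err0 by linarith
        have "1 * e \<le> y / (y - x) * w * e" by (rule mult_right_mono[OF wy e0])
        moreover have "1 * (tau_const * x powr (- 3 / 4) * R) \<le> y / (y - x) * w * (tau_const * x powr (- 3 / 4) * R)"
          using R0 tau_const_pos by (intro mult_right_mono[OF wy]) simp
        ultimately show ?thesis unfolding G_def by (simp add: algebra_simps)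
      qed
      define W where "W = m + C + tau_const * L0 * (y - x) + y / (y - x) * e + y / (y - x) * (tau_const * x powr (- 3 / 4) * R)"
      have xy: "x \<le> y" using y by simp
      have "w * (Delta x + tau_const * tau_approx \<phi> K x) \<le> w * W"
        using Delta_increment_bounds(1)[OF x xy] key[of x, unfolded E_def] Gw xy
        unfolding W_def w_def[symmetric] m_def[symmetric] by (simp add: abs_le_iff algebra_simps)
      then have u1: "Delta x + tau_const * tau_approx \<phi> K x \<le> W" using w by simp
      have "w * (- (Delta y + tau_const * tau_approx \<phi> K y)) \<le> w * W"
        using Delta_increment_bounds(2)[OF x xy] key[of y, unfolded E_def] Gw xy
        unfolding W_def w_def[symmetric] m_def[symmetric] by (simp add: abs_le_iff algebra_simps)
      then have u2: "- (Delta y + tau_const * tau_approx \<phi> K y) \<le> W" using w by simp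
      show "let W = (divisor_main y - divisor_main x) + C + tau_const * L0 * (y - x)
        + y / (y - x) * (C * (x powr (- 3 / 4) + x powr (- 1 / 4) * real N powr (- 1 / 8)))
        + y / (y - x) * (tau_const * x powr (- 3 / 4) * integral {x..y} (\<lambda>s. \<bar>tau_sine_sum \<phi> {K<..N} s\<bar>))
      in Delta x + tau_const * tau_approx \<phi> K x \<le> W \<and> - (Delta y + tau_const * tau_approx \<phi> K y) \<le> W"
        using u1 u2 unfolding W_def m_def e_def R_def Let_def by blast
    qed
  qed
  show ?thesis using Cn main by blast
qed

section \<open>Mean square of the remainder on dyadic intervals\<close>

lemma borel_measurable_Delta [measurable]: "Delta \<in> borel_measurable borel"
proof -
  have "divisor_sum \<in> borel_measurable borel"
    by (intro borel_measurable_mono monoI divisor_sum_mono)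
  then have "(\<lambda>x. divisor_sum x - (x * ln x + (2 * euler_mascheroni - 1) * x)) \<in> borel_measurable borel"
    by measurable
  then show ?thesis unfolding Delta_eq[abs_def] divisor_main_def .
qed

lemma Delta_bounded_on_interval:
  assumes a: "a > 0"
  shows "\<exists>B. \<forall>x\<in>{a..b}. \<bar>Delta x\<bar> \<le> B"
proof -
  have "continuous_on {a..b} divisor_main"
    unfolding divisor_main_def using a by (auto intro!: continuous_intros)
  then have "bounded (divisor_main ` {a..b})"
    by (intro compact_imp_bounded compact_continuous_image) auto
  then obtain B where "\<forall>x\<in>{a..b}. \<bar>divisor_main x\<bar> \<le> B"
    by (auto simp: bounded_iff)
  then have B: "\<And>x. x \<in> {a..b} \<Longrightarrow> \<bar>divisor_main x\<bar> \<le> B" by blast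
  have "\<bar>Delta x\<bar> \<le> divisor_sum b + B" if "x \<in> {a..b}" for x
    using divisor_sum_mono[of x b] divisor_sum_nonneg[of x] B[OF that] that unfolding Delta_eq by auto
  then show ?thesis by blast
qed

text \<open>Each point lies in windows of total measure at most 2 H. Instead of Fubini, the
  primitive \<open>G\<close> is integrated over two shifted intervals; the difference telescopes to
  its integral over the last window minus that over the first.\<close>

lemma integral_window_le:
  fixes r :: "real \<Rightarrow> real"
  assumes r: "continuous_on UNIV r" "\<And>x. r x \<ge> 0" and H: "H > 0" and ab: "a \<le> b"
  shows "(\<lambda>x. integral {x - H..x + H} r) integrable_on {a..b}"
    "integral {a..b} (\<lambda>x. integral {x - H..x + H} r) \<le> 2 * H * integral {a - H..b + H} r"
proof -
  define G where "G = (\<lambda>u. integral {a - H..u} r)"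
  have ri: "r integrable_on {x..y}" for x y
    using r(1) continuous_on_subset by (intro integrable_continuous_real) blast
  have cG: "continuous_on {a - H..b + H} G"
    unfolding G_def by (intro indefinite_integral_continuous_1 ri)
  have G_mono: "G u \<le> G v" if "u \<le> v" for u v
    unfolding G_def using r that by (intro integral_subset_le ri) auto
  have G0: "G u \<ge> 0" for u unfolding G_def using r by (intro integral_nonneg ri) auto
  have Gi: "G integrable_on {x..y}" if "a - H \<le> x" "y \<le> b + H" for x y
    by (intro integrable_continuous_real continuous_on_subset[OF cG]) (use that in auto)
  have win: "integral {x - H..x + H} r = G (x + H) - G (x - H)" if "x \<in> {a..b}" for x
  proof -
    have "G (x - H) + integral {x - H..x + H} r = G (x + H)"
      unfolding G_def using that H by (intro Henstock_Kurzweil_Integration.integral_combine ri) auto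
    then show ?thesis by simp
  qed
  have c1: "continuous_on {a..b} (\<lambda>x. G (x + H))" "continuous_on {a..b} (\<lambda>x. G (x + - H))"
    using H by (auto intro!: continuous_on_compose2[OF cG] continuous_intros)
  have s1: "integral {a..b} (\<lambda>x. G (x + H)) = integral {a + H..b + H} G"
    using integral_shift[of a H b G] continuous_on_subset[OF cG, of "{a + H..b + H}"] H by (simp add: o_def)
  have s2: "integral {a..b} (\<lambda>x. G (x + - H)) = integral {a - H..b - H} G"
    using integral_shift[of a "- H" b G] continuous_on_subset[OF cG, of "{a - H..b - H}"] H by (simp add: o_def)
  have ii: "(\<lambda>x. G (x + H)) integrable_on {a..b}" "(\<lambda>x. G (x + - H)) integrable_on {a..b}"
    by (intro integrable_continuous_real c1)+
  show "(\<lambda>x. integral {x - H..x + H} r) integrable_on {a..b}"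
    using integrable_diff[OF ii] by (rule integrable_eq) (simp add: win)
  have "integral {a..b} (\<lambda>x. integral {x - H..x + H} r) = integral {a..b} (\<lambda>x. G (x + H) - G (x + - H))"
    by (intro integral_cong) (simp add: win)
  also have "\<dots> = integral {a + H..b + H} G - integral {a - H..b - H} G"
    by (simp only: Henstock_Kurzweil_Integration.integral_diff[OF ii] s1 s2)
  also have "\<dots> = integral {b - H..b + H} G - integral {a - H..a + H} G"
  proof -
    have "integral {a - H..a + H} G + integral {a + H..b + H} G = integral {a - H..b + H} G"
      using H ab by (intro Henstock_Kurzweil_Integration.integral_combine Gi) auto
    moreover have "integral {a - H..b - H} G + integral {b - H..b + H} G = integral {a - H..b + H} G"
      using H ab by (intro Henstock_Kurzweil_Integration.integral_combine Gi) auto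
    ultimately show ?thesis by simp
  qed
  also have "\<dots> \<le> integral {b - H..b + H} (\<lambda>_. G (b + H)) - 0"
    using H ab G_mono G0 by (intro diff_mono integral_le integral_nonneg Gi) auto
  also have "\<dots> = 2 * H * integral {a - H..b + H} r" using H by (simp add: G_def)
  finally show "integral {a..b} (\<lambda>x. integral {x - H..x + H} r) \<le> 2 * H * integral {a - H..b + H} r" .
qed

definition tau_square_total :: real where
  "tau_square_total = zeta_real (3 / 2) ^ 4 / zeta_real 3"

definition tau_tail :: "nat \<Rightarrow> real" where
  "tau_tail K = tau_square_total - (\<Sum>n=1..K. (tau_coeff n)\<^sup>2)"

lemma tau_coeff_square: "(tau_coeff n)\<^sup>2 = (real (divisor_tau n))\<^sup>2 * real n powr - (3 / 2)"
proof -
  have "(real n powr (- 3 / 4))\<^sup>2 = real n powr - (3 / 2)"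
    by (cases "n = 0") (auto simp: power2_eq_square simp flip: powr_add)
  then show ?thesis by (simp add: tau_coeff_def power_mult_distrib)
qed

lemma tau_coeff_square_has_sum: "((\<lambda>n. (tau_coeff n)\<^sup>2) has_sum tau_square_total) {1..}"
  unfolding tau_coeff_square tau_square_total_def using divisor_tau_square_has_sum[of "3 / 2"] by simp

lemma sum_tau_coeff_square_le_tail:
  assumes "K \<le> N"
  shows "(\<Sum>n\<in>{K<..N}. (tau_coeff n)\<^sup>2) \<le> tau_tail K"
proof -
  have "(\<Sum>n\<in>{1..N}. (tau_coeff n)\<^sup>2) \<le> tau_square_total"
    by (rule has_sum_mono2[OF has_sum_finite tau_coeff_square_has_sum]) auto
  moreover have "{1..N} = {1..K} \<union> {K<..N}" using assms by auto
  then have "(\<Sum>n\<in>{1..N}. (tau_coeff n)\<^sup>2) = (\<Sum>n\<in>{1..K}. (tau_coeff n)\<^sup>2) + (\<Sum>n\<in>{K<..N}. (tau_coeff n)\<^sup>2)"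
    by (simp only:) (rule sum.union_disjoint, auto)
  ultimately show ?thesis by (simp add: tau_tail_def)
qed

lemma tau_tail_nonneg: "tau_tail K \<ge> 0"
  using sum_tau_coeff_square_le_tail[of K K] by simp

lemma tau_tail_tendsto: "tau_tail \<longlonglongrightarrow> 0"
proof -
  have "((\<lambda>n. (tau_coeff (Suc n))\<^sup>2) has_sum tau_square_total) UNIV"
    using tau_coeff_square_has_sum
    by (subst has_sum_reindex_bij_witness[where i = "\<lambda>n. n - 1" and j = Suc and T = "{1..}" and h = "\<lambda>n. (tau_coeff n)\<^sup>2"]) auto
  from has_sum_imp_sums[OF this]
  have "(\<lambda>K. \<Sum>n<K. (tau_coeff (Suc n))\<^sup>2) \<longlonglongrightarrow> tau_square_total" by (simp add: sums_def)
  moreover have "(\<Sum>n<K. (tau_coeff (Suc n))\<^sup>2) = (\<Sum>n=1..K. (tau_coeff n)\<^sup>2)" for K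
    by (rule sum.reindex_bij_witness[where i = "\<lambda>n. n - 1" and j = Suc]) auto
  ultimately have "(\<lambda>K. tau_square_total - (\<Sum>n=1..K. (tau_coeff n)\<^sup>2)) \<longlonglongrightarrow> tau_square_total - tau_square_total"
    by (intro tendsto_intros) simp
  then show ?thesis by (simp add: tau_tail_def[abs_def])
qed

text \<open>Rankin's trick.\<close>

lemma sum_tau_coeff_square_sqrt_le:
  "\<exists>T\<ge>0. \<forall>K N. (\<Sum>n\<in>{K<..N}. (tau_coeff n)\<^sup>2 * sqrt (real n)) \<le> real N powr (1 / 16) * T"
proof -
  define T where "T = zeta_real (17 / 16) ^ 4 / zeta_real (2 * (17 / 16))"
  have hs: "((\<lambda>n. (real (divisor_tau n))\<^sup>2 * real n powr - (17 / 16)) has_sum T) {1..}"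
    unfolding T_def by (rule divisor_tau_square_has_sum) simp
  have "(\<Sum>n\<in>{K<..N}. (tau_coeff n)\<^sup>2 * sqrt (real n)) \<le> real N powr (1 / 16) * T" for K N
  proof -
    have "(\<Sum>n\<in>{K<..N}. (tau_coeff n)\<^sup>2 * sqrt (real n)) \<le> (\<Sum>n\<in>{K<..N}. real N powr (1 / 16) * ((real (divisor_tau n))\<^sup>2 * real n powr - (17 / 16)))"
    proof (rule sum_mono)
      fix n assume n: "n \<in> {K<..N}"
      have "real n powr - (3 / 2) * sqrt (real n) = real n powr (1 / 16) * real n powr - (17 / 16)"
        by (simp add: powr_half_sqrt[symmetric] flip: powr_add)
      also have "\<dots> \<le> real N powr (1 / 16) * real n powr - (17 / 16)"
        using n by (intro mult_right_mono powr_mono2) auto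
      finally have "(real (divisor_tau n))\<^sup>2 * (real n powr - (3 / 2) * sqrt (real n)) \<le> (real (divisor_tau n))\<^sup>2 * (real N powr (1 / 16) * real n powr - (17 / 16))"
        by (rule mult_left_mono) simp
      then show "(tau_coeff n)\<^sup>2 * sqrt (real n) \<le> real N powr (1 / 16) * ((real (divisor_tau n))\<^sup>2 * real n powr - (17 / 16))"
        unfolding tau_coeff_square by (simp add: mult_ac)
    qed
    also have "\<dots> = real N powr (1 / 16) * (\<Sum>n\<in>{K<..N}. (real (divisor_tau n))\<^sup>2 * real n powr - (17 / 16))"
      by (simp add: sum_distrib_left)
    also have "\<dots> \<le> real N powr (1 / 16) * T"
      by (intro mult_left_mono has_sum_mono2[OF has_sum_finite hs]) auto
    finally show ?thesis .
  qed
  moreover have "T \<ge> 0" using has_sum_nonneg[OF hs] by simp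
  ultimately show ?thesis by blast
qed

lemma harm_le_1_plus_ln: "N \<ge> 1 \<Longrightarrow> harm N \<le> 1 + ln (real N)"
  using euler_mascheroni_sequence_decreasing[of 1 N] by (simp add: harm_expand)

lemma divisor_main_increment_le:
  assumes "1 \<le> x" "x \<le> y"
  shows "divisor_main y - divisor_main x \<le> (y - x) * (ln y + 2 * euler_mascheroni)"
proof -
  have "divisor_main y - (ln y + 2 * euler_mascheroni) * y \<le> divisor_main x - (ln y + 2 * euler_mascheroni) * x"
  proof (rule DERIV_nonpos_imp_nonincreasing[OF assms(2)])
    fix s assume s: "x \<le> s" "s \<le> y"
    have "((\<lambda>s. divisor_main s - (ln y + 2 * euler_mascheroni) * s) has_real_derivative ((ln s + 2 * euler_mascheroni) - (ln y + 2 * euler_mascheroni))) (at s)"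
      using s assms by (auto intro!: derivative_eq_intros divisor_main_deriv)
    moreover have "ln s \<le> ln y" using s assms by simp
    ultimately show "\<exists>D. ((\<lambda>s. divisor_main s - (ln y + 2 * euler_mascheroni) * s) has_real_derivative D) (at s) \<and> D \<le> 0"
      by (intro exI conjI) auto
  qed
  then show ?thesis by (simp add: algebra_simps)
qed

text \<open>The window has length H = X^(1/8) and N is of order X^4. The factor 360 is 288 * 5/4:
  the 5/4 is half the length of [X/2, 3X] over X, and 288 = 144 * 2, where 144 = 2 * 36 * 2 comes
  from squaring a sum of two terms, squaring the factor 6, and Cauchy-Schwarz on length 2 H, while
  the last 2 counts the overlap of the windows.\<close>

lemma Delta_mean_square_dyadic:
  "\<exists>\<phi>. \<forall>K. \<forall>e>0. eventually (\<lambda>X. integral {X..2 * X} (\<lambda>x. (Delta x + tau_const * tau_approx \<phi> K x)\<^sup>2)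
      \<le> (360 * tau_const\<^sup>2 * tau_tail K + e) * X powr (3 / 2)) at_top"
proof -
  obtain \<phi> C where C: "C \<ge> 0" and W: "\<And>K. \<exists>L\<ge>0. \<forall>N\<ge>max 1 K. \<forall>x\<ge>1. \<forall>y>x.
     (let W = (divisor_main y - divisor_main x) + C + L * (y - x)
        + y / (y - x) * (C * (x powr (- 3 / 4) + x powr (- 1 / 4) * real N powr (- 1 / 8)))
        + y / (y - x) * (tau_const * x powr (- 3 / 4) * integral {x..y} (\<lambda>s. \<bar>tau_sine_sum \<phi> {K<..N} s\<bar>))
      in Delta x + tau_const * tau_approx \<phi> K x \<le> W \<and> - (Delta y + tau_const * tau_approx \<phi> K y) \<le> W)"
    using Delta_window_bound by blast
  obtain T where T: "T \<ge> 0" "\<And>K N. (\<Sum>n\<in>{K<..N}. (tau_coeff n)\<^sup>2 * sqrt (real n)) \<le> real N powr (1 / 16) * T"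
    using sum_tau_coeff_square_sqrt_le by blast
  have "eventually (\<lambda>X. integral {X..2 * X} (\<lambda>x. (Delta x + tau_const * tau_approx \<phi> K x)\<^sup>2)
      \<le> (360 * tau_const\<^sup>2 * tau_tail K + e) * X powr (3 / 2)) at_top" if e: "e > 0" for K e
  proof -
    obtain L where L: "L \<ge> 0" and WL: "\<And>N x y. N \<ge> max 1 K \<Longrightarrow> x \<ge> 1 \<Longrightarrow> y > x \<Longrightarrow>
     (let W = (divisor_main y - divisor_main x) + C + L * (y - x)
        + y / (y - x) * (C * (x powr (- 3 / 4) + x powr (- 1 / 4) * real N powr (- 1 / 8)))
        + y / (y - x) * (tau_const * x powr (- 3 / 4) * integral {x..y} (\<lambda>s. \<bar>tau_sine_sum \<phi> {K<..N} s\<bar>))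
      in Delta x + tau_const * tau_approx \<phi> K x \<le> W \<and> - (Delta y + tau_const * tau_approx \<phi> K y) \<le> W)"
      using W[of K] by blast
    define \<gamma> :: real where "\<gamma> = euler_mascheroni"
    define B where "B = tau_const"
    have B: "B > 0" using tau_const_pos by (simp add: B_def)
    \<comment> \<open>\<open>sm\<close> collects the pointwise errors: growth of the main term,
      constants, Lipschitz error and truncation, all of order X^(1/8) up to a logarithm.
      \<open>off\<close> is the off-diagonal part of the mean square, of order X^(5/4) ln X. Both
      are negligible against X^(3/2) after integration.\<close>
    define sm where "sm = (\<lambda>X::real. X powr (1 / 8) * (ln (3 * X) + 2 * \<gamma>) + C + L * X powr (1 / 8) + 12 * C * X powr (1 / 8))"
    define off where "off = (\<lambda>X::real. 288 * B\<^sup>2 * X powr (1 / 2) * (sqrt (3 * X) * (1 + 5 * (1 + 4 * ln (2 * X))) * ((2 * X) powr (1 / 4) * T)))"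
    have lim: "((\<lambda>X. (2 * X * (sm X)\<^sup>2 + off X) / X powr (3 / 2)) \<longlongrightarrow> 0) at_top"
      unfolding sm_def off_def by real_asymp
    then have ev: "eventually (\<lambda>X. (2 * X * (sm X)\<^sup>2 + off X) / X powr (3 / 2) < e) at_top"
      using e by (auto simp: order_tendsto_iff)
    have "eventually (\<lambda>X::real. X powr (1 / 8) \<le> X / 2) at_top" by real_asymp
    then show ?thesis
      using ev eventually_ge_at_top[of "max 2 (real K)"]
    proof eventually_elim
      case (elim X)
      define H where "H = X powr (1 / 8)"
      have X: "X \<ge> 2" "X \<ge> real K" and HX: "H \<le> X / 2" using elim by (auto simp: H_def)
      have H: "H > 0" using X by (simp add: H_def)
      define M where "M = nat \<lceil>X\<rceil>"
      have M: "X \<le> real M" "real M \<le> 2 * X" using X by (auto simp: M_def) linarith+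
      define N where "N = M ^ 4"
      have M1: "M \<ge> 1" using M X by (cases M) auto
      have NK: "N \<ge> max 1 K"
      proof -
        have "M \<le> M ^ 4" using M1 by (simp add: self_le_power)
        moreover have "K \<le> M" using M X by linarith
        ultimately show ?thesis using M1 by (auto simp: N_def)
      qed
      have N_powr: "real N = real M powr 4"
        using M1 powr_realpow[of "real M" 4] by (simp add: N_def)
      have N8: "real N powr (- 1 / 8) \<le> X powr (- 1 / 2)"
      proof -
        have "real N powr (- 1 / 8) = real M powr (- 1 / 2)"
          unfolding N_powr powr_powr by simp
        also have "\<dots> \<le> X powr (- 1 / 2)" using M X by (intro powr_mono2') auto
        finally show ?thesis .
      qed
      have N16: "real N powr (1 / 16) \<le> (2 * X) powr (1 / 4)"
      proof -
        have "real N powr (1 / 16) = real M powr (1 / 4)"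
          unfolding N_powr powr_powr by simp
        also have "\<dots> \<le> (2 * X) powr (1 / 4)" using M X by (intro powr_mono2) auto
        finally show ?thesis .
      qed
      have hN: "harm N \<le> 1 + 4 * ln (2 * X)"
      proof -
        have "ln (real N) = 4 * ln (real M)" using M1 by (simp add: N_def ln_realpow)
        also have "\<dots> \<le> 4 * ln (2 * X)" using M M1 X by simp
        finally show ?thesis using harm_le_1_plus_ln[of N] NK by simp
      qed
      define R where "R = tau_sine_sum \<phi> {K<..N}"
      have cR: "continuous_on S R" for S unfolding R_def by (intro continuous_intros)
      have cR2: "continuous_on S (\<lambda>s. (R s)\<^sup>2)" for S by (intro continuous_intros cR)
      define f where "f = (\<lambda>x. Delta x + B * tau_approx \<phi> K x)"
      define S where "S = sm X"
      \<comment> \<open>With y <= 3 X and x >= X/2, the factor y/(y - x) is at most 3 X / H, and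
        negative powers of x are at most doubled, hence the 6. The powers combine to (X/H) X^(-3/4)
        = X^(1/8).\<close>
      have win: "(divisor_main y - divisor_main x) + C + L * (y - x)
        + y / (y - x) * (C * (x powr (- 3 / 4) + x powr (- 1 / 4) * real N powr (- 1 / 8)))
        + y / (y - x) * (tau_const * x powr (- 3 / 4) * I) \<le> S + 6 * B * X powr (1 / 8) * I"
        if x: "X / 2 \<le> x" "y = x + H" "y \<le> 3 * X" and I: "I \<ge> 0" for x y I
      proof -
        have xx: "x \<ge> 1" "x > 0" "y - x = H" using x X by auto
        have yH: "0 \<le> y / (y - x)" "y / (y - x) \<le> 3 * X / H"
          using xx x H by (auto intro!: divide_right_mono)
        have half: "x powr (- t) \<le> 2 * X powr (- t)" if "0 < t" "t \<le> 1" for t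
        proof -
          have "x powr (- t) \<le> (X / 2) powr (- t)" using x X that by (intro powr_mono2') auto
          also have "\<dots> = X powr (- t) * 2 powr t" using X by (simp add: powr_divide powr_minus field_simps)
          also have "\<dots> \<le> X powr (- t) * 2 powr 1" using that by (intro mult_left_mono powr_mono) auto
          finally show ?thesis by simp
        qed
        have h34: "x powr (- 3 / 4) \<le> 2 * X powr (- 3 / 4)" using half[of "3 / 4"] by simp
        have h14: "x powr (- 1 / 4) \<le> 2 * X powr (- 1 / 4)" using half[of "1 / 4"] by simp
        have XH: "3 * X / H * X powr (- 3 / 4) = 3 * X powr (1 / 8)"
        proof -
          have "X / H = X powr (7 / 8)" using X powr_diff[of X 1 "1 / 8"] by (simp add: H_def)
          then have "X / H * X powr (- 3 / 4) = X powr (1 / 8)" by (simp flip: powr_add)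
          then show ?thesis by simp
        qed
        have 1: "divisor_main y - divisor_main x \<le> H * (ln (3 * X) + 2 * \<gamma>)"
        proof -
          have "divisor_main y - divisor_main x \<le> (y - x) * (ln y + 2 * euler_mascheroni)"
            using xx H by (intro divisor_main_increment_le) auto
          also have "\<dots> \<le> H * (ln (3 * X) + 2 * \<gamma>)"
            unfolding xx(3) \<gamma>_def using x xx H X by (intro mult_left_mono add_mono) auto
          finally show ?thesis .
        qed
        have 2: "y / (y - x) * (C * (x powr (- 3 / 4) + x powr (- 1 / 4) * real N powr (- 1 / 8))) \<le> 12 * C * X powr (1 / 8)"
        proof -
          have "x powr (- 1 / 4) * real N powr (- 1 / 8) \<le> 2 * X powr (- 1 / 4) * X powr (- 1 / 2)"
            using h14 N8 by (intro mult_mono) auto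
          also have "\<dots> = 2 * X powr (- 3 / 4)" by (simp flip: powr_add)
          finally have "x powr (- 3 / 4) + x powr (- 1 / 4) * real N powr (- 1 / 8) \<le> 4 * X powr (- 3 / 4)"
            using h34 by simp
          then have "y / (y - x) * (C * (x powr (- 3 / 4) + x powr (- 1 / 4) * real N powr (- 1 / 8))) \<le> 3 * X / H * (C * (4 * X powr (- 3 / 4)))"
            using yH C X H by (intro mult_mono) auto
          also have "\<dots> = 4 * C * (3 * X / H * X powr (- 3 / 4))" by simp
          also have "\<dots> = 12 * C * X powr (1 / 8)" unfolding XH by simp
          finally show ?thesis .
        qed
        have 3: "y / (y - x) * (tau_const * x powr (- 3 / 4) * I) \<le> 6 * B * X powr (1 / 8) * I"
        proof -
          have "y / (y - x) * (tau_const * x powr (- 3 / 4) * I) \<le> 3 * X / H * (B * (2 * X powr (- 3 / 4)) * I)"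
            unfolding B_def[symmetric] using yH h34 B I X H by (intro mult_mono mult_right_mono mult_left_mono) auto
          also have "\<dots> = 2 * B * I * (3 * X / H * X powr (- 3 / 4))" by simp
          also have "\<dots> = 6 * B * X powr (1 / 8) * I" unfolding XH by simp
          finally show ?thesis .
        qed
        show ?thesis unfolding S_def sm_def H_def[symmetric] xx(3)
          using 1 2[unfolded xx(3)] 3[unfolded xx(3)] unfolding H_def[symmetric] by linarith
      qed
      \<comment> \<open>The upper bound for \<open>f x\<close> uses the window to the right of
        \<open>x\<close>, the lower bound the one to its left; both lie in [x - H, x + H].\<close>
      have pw: "(f x)\<^sup>2 \<le> 2 * S\<^sup>2 + 144 * B\<^sup>2 * X powr (3 / 8) * integral {x - H..x + H} (\<lambda>s. (R s)\<^sup>2)" if x: "x \<in> {X..2 * X}" for x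
      proof -
        define I where "I = (\<lambda>u. integral {u..u + H} (\<lambda>s. \<bar>R s\<bar>))"
        have I0: "I u \<ge> 0" for u unfolding I_def
          by (rule integral_nonneg) (auto intro!: integrable_continuous_real continuous_intros cR)
        have b1: "f x \<le> S + 6 * B * X powr (1 / 8) * I x"
          using WL[OF NK, of x "x + H"] win[of x "x + H" "I x"] x X HX H I0[of x]
          unfolding Let_def I_def R_def f_def B_def[symmetric] by auto
        have b2: "- f x \<le> S + 6 * B * X powr (1 / 8) * I (x - H)"
          using WL[OF NK, of "x - H" x] win[of "x - H" x "I (x - H)"] x X HX H I0[of "x - H"]
          unfolding Let_def I_def R_def f_def B_def[symmetric] by auto
        define J where "J = integral {x - H..x + H} (\<lambda>s. \<bar>R s\<bar>)"
        have J: "J = I (x - H) + I x"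
        proof -
          have "integral {x - H..x} (\<lambda>s. \<bar>R s\<bar>) + integral {x..x + H} (\<lambda>s. \<bar>R s\<bar>) = J"
            unfolding J_def using H by (intro Henstock_Kurzweil_Integration.integral_combine integrable_continuous_real continuous_intros cR) auto
          then show ?thesis by (simp add: I_def)
        qed
        have c: "6 * B * X powr (1 / 8) * I x \<le> 6 * B * X powr (1 / 8) * J" "6 * B * X powr (1 / 8) * I (x - H) \<le> 6 * B * X powr (1 / 8) * J"
          unfolding J using B I0 by (auto intro!: mult_left_mono)
        have "\<bar>f x\<bar> \<le> S + 6 * B * X powr (1 / 8) * J" using b1 b2 c by (intro abs_leI) linarith+
        then have "(f x)\<^sup>2 \<le> (S + 6 * B * X powr (1 / 8) * J)\<^sup>2"
          by (metis abs_ge_zero power2_abs power_mono)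
        also have "\<dots> \<le> 2 * S\<^sup>2 + 2 * (6 * B * X powr (1 / 8) * J)\<^sup>2"
          using zero_le_power2[of "S - 6 * B * X powr (1 / 8) * J"] unfolding power2_sum power2_diff by linarith
        also have "(6 * B * X powr (1 / 8) * J)\<^sup>2 = 36 * B\<^sup>2 * X powr (1 / 4) * J\<^sup>2"
          by (simp add: power_mult_distrib) (simp add: power2_eq_square flip: powr_add)
        also have "36 * B\<^sup>2 * X powr (1 / 4) * J\<^sup>2 \<le> 36 * B\<^sup>2 * X powr (1 / 4) * (2 * H * integral {x - H..x + H} (\<lambda>s. (R s)\<^sup>2))"
          using integral_abs_square_le[of "x - H" "x + H" R] H cR unfolding J_def by (intro mult_left_mono) auto
        also have "2 * S\<^sup>2 + 2 * (36 * B\<^sup>2 * X powr (1 / 4) * (2 * H * integral {x - H..x + H} (\<lambda>s. (R s)\<^sup>2))) =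
          2 * S\<^sup>2 + 144 * B\<^sup>2 * (X powr (1 / 4) * H) * integral {x - H..x + H} (\<lambda>s. (R s)\<^sup>2)" by simp
        also have "X powr (1 / 4) * H = X powr (3 / 8)" unfolding H_def by (simp flip: powr_add)
        finally show ?thesis by simp
      qed
      define q where "q = 144 * B\<^sup>2 * X powr (3 / 8)"
      have q0: "q \<ge> 0" by (simp add: q_def)
      have wi: "(\<lambda>x. integral {x - H..x + H} (\<lambda>s. (R s)\<^sup>2)) integrable_on {X..2 * X}"
        "integral {X..2 * X} (\<lambda>x. integral {x - H..x + H} (\<lambda>s. (R s)\<^sup>2)) \<le> 2 * H * integral {X - H..2 * X + H} (\<lambda>s. (R s)\<^sup>2)"
        using integral_window_le[of "\<lambda>s. (R s)\<^sup>2" H X "2 * X"] cR2 H X by auto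
      have gi: "((\<lambda>x. 2 * S\<^sup>2 + q * integral {x - H..x + H} (\<lambda>s. (R s)\<^sup>2)) has_integral
          ((2 * X - X) * (2 * S\<^sup>2) + q * integral {X..2 * X} (\<lambda>x. integral {x - H..x + H} (\<lambda>s. (R s)\<^sup>2)))) {X..2 * X}"
        using has_integral_const_real[of "2 * S\<^sup>2" X "2 * X"] X
        by (intro has_integral_add has_integral_mult_right integrable_integral wi) simp
      have "integral {X..2 * X} (\<lambda>x. (f x)\<^sup>2) \<le> integral {X..2 * X} (\<lambda>x. 2 * S\<^sup>2 + q * integral {x - H..x + H} (\<lambda>s. (R s)\<^sup>2))"
      proof (rule integral_le)
        show "(\<lambda>x. 2 * S\<^sup>2 + q * integral {x - H..x + H} (\<lambda>s. (R s)\<^sup>2)) integrable_on {X..2 * X}"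
          using gi by (rule has_integral_integrable)
        obtain b where "\<forall>x\<in>{X..2 * X}. \<bar>Delta x\<bar> \<le> b"
          using Delta_bounded_on_interval[of X "2 * X"] X by auto
        then have b: "\<And>x. x \<in> {X..2 * X} \<Longrightarrow> \<bar>Delta x\<bar> \<le> b" by blast
        have "continuous_on {X..2 * X} (tau_approx \<phi> K)"
          unfolding tau_approx_def using X by (intro continuous_intros) auto
        then have "bounded (tau_approx \<phi> K ` {X..2 * X})"
          by (intro compact_imp_bounded compact_continuous_image) auto
        then obtain b' where "\<forall>x\<in>{X..2 * X}. \<bar>tau_approx \<phi> K x\<bar> \<le> b'"
          by (auto simp: bounded_iff)
        then have b': "\<And>x. x \<in> {X..2 * X} \<Longrightarrow> \<bar>tau_approx \<phi> K x\<bar> \<le> b'" by blast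
        show "(\<lambda>x. (f x)\<^sup>2) integrable_on {X..2 * X}"
        proof (rule bounded_borel_imp_integrable_on[where B = "(b + B * b')\<^sup>2"])
          show "(\<lambda>x. (f x)\<^sup>2) \<in> borel_measurable borel"
            unfolding f_def tau_approx_def sqrt_sine_sum_def by measurable
          fix x assume x: "x \<in> {X..2 * X}"
          have "\<bar>f x\<bar> \<le> \<bar>Delta x\<bar> + B * \<bar>tau_approx \<phi> K x\<bar>"
            unfolding f_def using abs_triangle_ineq[of "Delta x" "B * tau_approx \<phi> K x"] B by (simp add: abs_mult)
          also have "\<dots> \<le> b + B * b'" using b[OF x] b'[OF x] B by (intro add_mono mult_left_mono) auto
          finally show "\<bar>(f x)\<^sup>2\<bar> \<le> (b + B * b')\<^sup>2"
            by (metis abs_ge_zero abs_power2 power2_abs power_mono)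
        qed
      qed (use pw in \<open>simp add: q_def\<close>)
      also have "\<dots> = 2 * X * S\<^sup>2 + q * integral {X..2 * X} (\<lambda>x. integral {x - H..x + H} (\<lambda>s. (R s)\<^sup>2))"
        using integral_unique[OF gi] by simp
      also have "\<dots> \<le> 2 * X * S\<^sup>2 + q * (2 * H * integral {X / 2..3 * X} (\<lambda>s. (R s)\<^sup>2))"
      proof -
        have "integral {X - H..2 * X + H} (\<lambda>s. (R s)\<^sup>2) \<le> integral {X / 2..3 * X} (\<lambda>s. (R s)\<^sup>2)"
          using HX X by (intro integral_subset_le integrable_continuous_real cR2) auto
        then have "2 * H * integral {X - H..2 * X + H} (\<lambda>s. (R s)\<^sup>2) \<le> 2 * H * integral {X / 2..3 * X} (\<lambda>s. (R s)\<^sup>2)"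
          using H by (intro mult_left_mono) auto
        then show ?thesis using wi(2) q0 by (intro add_left_mono mult_left_mono) auto
      qed
      also have "q * (2 * H * integral {X / 2..3 * X} (\<lambda>s. (R s)\<^sup>2)) = 288 * B\<^sup>2 * (X powr (3 / 8) * H) * integral {X / 2..3 * X} (\<lambda>s. (R s)\<^sup>2)"
        by (simp add: q_def)
      also have "X powr (3 / 8) * H = X powr (1 / 2)" unfolding H_def by (simp flip: powr_add)
      also have "2 * X * S\<^sup>2 + 288 * B\<^sup>2 * X powr (1 / 2) * integral {X / 2..3 * X} (\<lambda>s. (R s)\<^sup>2) \<le>
         2 * X * S\<^sup>2 + 288 * B\<^sup>2 * X powr (1 / 2) * (5 * X / 4 * tau_tail K + sqrt (3 * X) * (1 + 5 * (1 + 4 * ln (2 * X))) * ((2 * X) powr (1 / 4) * T))"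
      proof (intro add_left_mono mult_left_mono)
        have "integral {X / 2..3 * X} (\<lambda>s. (R s)\<^sup>2) \<le> (3 * X - X / 2) / 2 * (\<Sum>n\<in>{K<..N}. (tau_coeff n)\<^sup>2) +
            sqrt (3 * X) * (1 + 5 * harm N) * (\<Sum>n\<in>{K<..N}. (tau_coeff n)\<^sup>2 * sqrt (real n))"
          unfolding R_def using X by (intro sqrt_sine_sum_mean_square) (auto simp: tau_coeff_def)
        also have "\<dots> \<le> (3 * X - X / 2) / 2 * tau_tail K + sqrt (3 * X) * (1 + 5 * (1 + 4 * ln (2 * X))) * ((2 * X) powr (1 / 4) * T)"
        proof (intro add_mono mult_mono mult_left_mono sum_tau_coeff_square_le_tail)
          have "(\<Sum>n\<in>{K<..N}. (tau_coeff n)\<^sup>2 * sqrt (real n)) \<le> real N powr (1 / 16) * T" by (rule T)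
          also have "\<dots> \<le> (2 * X) powr (1 / 4) * T" using N16 T by (intro mult_right_mono)
          finally show "(\<Sum>n\<in>{K<..N}. (tau_coeff n)\<^sup>2 * sqrt (real n)) \<le> (2 * X) powr (1 / 4) * T" .
        qed (use X NK hN in \<open>auto intro!: sum_nonneg add_nonneg_nonneg mult_nonneg_nonneg harm_nonneg ln_ge_zero\<close>)
        finally show "integral {X / 2..3 * X} (\<lambda>s. (R s)\<^sup>2) \<le> 5 * X / 4 * tau_tail K + sqrt (3 * X) * (1 + 5 * (1 + 4 * ln (2 * X))) * ((2 * X) powr (1 / 4) * T)"
          by (simp add: field_simps)
      qed (use B in auto)
      also have "\<dots> = 360 * B\<^sup>2 * tau_tail K * (X powr (1 / 2) * X) + (2 * X * S\<^sup>2 + off X)"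
        by (simp add: off_def algebra_simps)
      also have "X powr (1 / 2) * X = X powr (3 / 2)"
        using X powr_add[of X "1 / 2" 1] by simp
      also have "2 * X * S\<^sup>2 + off X \<le> e * X powr (3 / 2)"
        using elim X unfolding S_def by (simp add: divide_less_eq)
      finally show ?case by (simp add: f_def B_def algebra_simps)
    qed
  qed
  then show ?thesis by blast
qed

section \<open>Correlations\<close>

text \<open>\<open>Delta\<close> jumps at integers, so continuity cannot supply integrability. This
  class is closed under sums and products and guarantees that all integrals over [1, X]
  exist.\<close>

definition locally_bounded_borel :: "(real \<Rightarrow> real) \<Rightarrow> bool" where
  "locally_bounded_borel f \<longleftrightarrow> f \<in> borel_measurable borel \<and> (\<forall>X. \<exists>B. \<forall>x\<in>{1..X}. \<bar>f x\<bar> \<le> B)"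

lemma locally_bounded_borel_integrable:
  assumes "locally_bounded_borel f" "1 \<le> a"
  shows "f integrable_on {a..b}"
proof -
  obtain B where "\<forall>x\<in>{1..b}. \<bar>f x\<bar> \<le> B" using assms unfolding locally_bounded_borel_def by blast
  then show ?thesis using assms unfolding locally_bounded_borel_def
    by (intro bounded_borel_imp_integrable_on[where B = B]) auto
qed

lemma locally_bounded_borel_mult:
  assumes "locally_bounded_borel f" "locally_bounded_borel g"
  shows "locally_bounded_borel (\<lambda>x. f x * g x)"
  unfolding locally_bounded_borel_def
proof (intro conjI allI)
  show "(\<lambda>x. f x * g x) \<in> borel_measurable borel"
    using assms unfolding locally_bounded_borel_def by (intro borel_measurable_times) auto
  fix X
  obtain B where B: "\<forall>x\<in>{1..X}. \<bar>f x\<bar> \<le> B" using assms unfolding locally_bounded_borel_def by blast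
  obtain C where C: "\<forall>x\<in>{1..X}. \<bar>g x\<bar> \<le> C" using assms unfolding locally_bounded_borel_def by blast
  have "\<bar>f x * g x\<bar> \<le> B * C" if "x \<in> {1..X}" for x
  proof -
    have "\<bar>f x\<bar> \<le> B" "\<bar>g x\<bar> \<le> C" using B C that by auto
    then show ?thesis unfolding abs_mult by (intro mult_mono) auto
  qed
  then show "\<exists>B. \<forall>x\<in>{1..X}. \<bar>f x * g x\<bar> \<le> B" by blast
qed

lemma locally_bounded_borel_add:
  assumes "locally_bounded_borel f" "locally_bounded_borel g"
  shows "locally_bounded_borel (\<lambda>x. f x + g x)"
  unfolding locally_bounded_borel_def
proof (intro conjI allI)
  show "(\<lambda>x. f x + g x) \<in> borel_measurable borel"
    using assms unfolding locally_bounded_borel_def by (intro borel_measurable_add) auto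
  fix X
  obtain B where B: "\<forall>x\<in>{1..X}. \<bar>f x\<bar> \<le> B" using assms unfolding locally_bounded_borel_def by blast
  obtain C where C: "\<forall>x\<in>{1..X}. \<bar>g x\<bar> \<le> C" using assms unfolding locally_bounded_borel_def by blast
  have "\<bar>f x + g x\<bar> \<le> B + C" if "x \<in> {1..X}" for x
    using B C that abs_triangle_ineq[of "f x" "g x"] by fastforce
  then show "\<exists>B. \<forall>x\<in>{1..X}. \<bar>f x + g x\<bar> \<le> B" by blast
qed

lemma locally_bounded_borel_const: "locally_bounded_borel (\<lambda>_. c)"
  unfolding locally_bounded_borel_def by auto

lemma locally_bounded_borel_Delta:
  assumes \<alpha>: "\<alpha> > 0"
  shows "locally_bounded_borel (\<lambda>x. Delta (\<alpha> * x))"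
  unfolding locally_bounded_borel_def
proof (intro conjI allI)
  fix X
  obtain B where B: "\<forall>x\<in>{\<alpha>..\<alpha> * X}. \<bar>Delta x\<bar> \<le> B"
    using Delta_bounded_on_interval[OF \<alpha>] by blast
  have "\<bar>Delta (\<alpha> * x)\<bar> \<le> B" if "x \<in> {1..X}" for x
    using B that \<alpha> by auto
  then show "\<exists>B. \<forall>x\<in>{1..X}. \<bar>Delta (\<alpha> * x)\<bar> \<le> B" by blast
qed measurable

lemma locally_bounded_borel_tau_approx:
  assumes \<alpha>: "\<alpha> > 0"
  shows "locally_bounded_borel (\<lambda>x. tau_approx \<phi> K (\<alpha> * x))"
  unfolding locally_bounded_borel_def
proof (intro conjI allI)
  show "(\<lambda>x. tau_approx \<phi> K (\<alpha> * x)) \<in> borel_measurable borel"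
    unfolding tau_approx_def sqrt_sine_sum_def by measurable
  fix X
  have "continuous_on {1..X} (\<lambda>x. tau_approx \<phi> K (\<alpha> * x))"
    unfolding tau_approx_def sqrt_sine_sum_def using \<alpha> by (intro continuous_intros) auto
  then have "bounded ((\<lambda>x. tau_approx \<phi> K (\<alpha> * x)) ` {1..X})"
    by (intro compact_imp_bounded compact_continuous_image) auto
  then show "\<exists>B. \<forall>x\<in>{1..X}. \<bar>tau_approx \<phi> K (\<alpha> * x)\<bar> \<le> B"
    by (auto simp: bounded_iff)
qed

text \<open>Repeated halving does not worsen the constant, because 2 * 2^(-3/2) <= 1: the bound at
  X/2 and the dyadic bound on [X/2, X] add up to at most the bound at X. The fixed initial piece, on
  which the hypothesis says nothing, is absorbed by \<open>e\<close>.\<close>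

lemma dyadic_integral_bound:
  fixes g :: "real \<Rightarrow> real"
  assumes gi: "\<And>a b. 1 \<le> a \<Longrightarrow> g integrable_on {a..b}" and g0: "\<And>x. g x \<ge> 0" and \<rho>: "\<rho> \<ge> 0" and e: "e > 0"
    and dy: "eventually (\<lambda>X. integral {X..2 * X} g \<le> \<rho> * X powr (3 / 2)) at_top"
  shows "eventually (\<lambda>X. integral {1..X} g \<le> (\<rho> + e) * X powr (3 / 2)) at_top"
proof -
  obtain Y1 where Y1: "\<And>X. X \<ge> Y1 \<Longrightarrow> integral {X..2 * X} g \<le> \<rho> * X powr (3 / 2)"
    using dy by (auto simp: eventually_at_top_linorder)
  define Y where "Y = max 1 Y1"
  have Y: "Y \<ge> 1" "\<And>X. X \<ge> Y \<Longrightarrow> integral {X..2 * X} g \<le> \<rho> * X powr (3 / 2)"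
    using Y1 by (auto simp: Y_def)
  have main: "integral {Y..X} g \<le> \<rho> * X powr (3 / 2)" if "Y \<le> X" "X \<le> 2 ^ Suc n * Y" for n X
    using that
  proof (induction n arbitrary: X)
    case 0
    have "integral {Y..X} g \<le> integral {Y..2 * Y} g"
      using 0 Y g0 by (intro integral_subset_le gi) auto
    also have "\<dots> \<le> \<rho> * Y powr (3 / 2)" by (rule Y) simp
    also have "\<dots> \<le> \<rho> * X powr (3 / 2)" using 0 Y \<rho> by (intro mult_left_mono powr_mono2) auto
    finally show ?case .
  next
    case (Suc n)
    show ?case
    proof (cases "X \<le> 2 * Y")
      case True
      have "integral {Y..X} g \<le> integral {Y..2 * Y} g"
        using True Suc.prems Y g0 by (intro integral_subset_le gi) auto
      also have "\<dots> \<le> \<rho> * Y powr (3 / 2)" by (rule Y) simp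
      also have "\<dots> \<le> \<rho> * X powr (3 / 2)" using Suc.prems Y \<rho> by (intro mult_left_mono powr_mono2) auto
      finally show ?thesis .
    next
      case False
      have "integral {Y..X} g = integral {Y..X / 2} g + integral {X / 2..2 * (X / 2)} g"
        using False Y by (subst Henstock_Kurzweil_Integration.integral_combine) (auto intro: gi)
      also have "\<dots> \<le> \<rho> * (X / 2) powr (3 / 2) + \<rho> * (X / 2) powr (3 / 2)"
        using False Suc.prems Y by (intro add_mono Suc.IH Y(2)) auto
      also have "\<dots> = \<rho> * X powr (3 / 2) * (2 / 2 powr (3 / 2))"
        using False Y by (simp add: powr_divide)
      also have "\<dots> \<le> \<rho> * X powr (3 / 2) * 1"
      proof (rule mult_left_mono)
        have "(2 :: real) powr 1 \<le> 2 powr (3 / 2)" by (intro powr_mono) auto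
        then show "2 / 2 powr (3 / 2) \<le> (1 :: real)" by simp
      qed (use \<rho> in simp)
      finally show ?thesis by simp
    qed
  qed
  define c where "c = integral {1..Y} g"
  have "((\<lambda>X. c / X powr (3 / 2)) \<longlongrightarrow> 0) at_top" by real_asymp
  then have "eventually (\<lambda>X. c / X powr (3 / 2) < e) at_top" using e by (auto simp: order_tendsto_iff)
  then show ?thesis using eventually_ge_at_top[of Y]
  proof eventually_elim
    case (elim X)
    have X: "X > 0" "X \<ge> Y" using elim Y by auto
    obtain n where n: "X / Y < 2 ^ n" using real_arch_pow[of 2 "X / Y"] by auto
    have "X \<le> 2 ^ n * Y" using n Y by (simp add: divide_less_eq)
    also have "\<dots> \<le> 2 ^ Suc n * Y" using Y by simp
    finally have "integral {Y..X} g \<le> \<rho> * X powr (3 / 2)" using main X by blast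
    moreover have "integral {1..X} g = c + integral {Y..X} g"
      unfolding c_def using X Y by (subst Henstock_Kurzweil_Integration.integral_combine) (auto intro: gi)
    moreover have "c \<le> e * X powr (3 / 2)" using elim X by (simp add: divide_less_eq)
    ultimately show ?case by (simp add: algebra_simps)
  qed
qed

lemma integral_scale_real:
  fixes f :: "real \<Rightarrow> real"
  assumes "\<alpha> > 0" "f integrable_on {\<alpha> * a..\<alpha> * b}"
  shows "integral {a..b} (\<lambda>x. f (\<alpha> * x)) = integral {\<alpha> * a..\<alpha> * b} f / \<alpha>"
proof -
  have "(f has_integral integral {\<alpha> * a..\<alpha> * b} f) (cbox (\<alpha> * a) (\<alpha> * b))"
    using assms(2) by (simp add: integrable_integral)
  from has_integral_affinity'[OF this assms(1), of 0]
  have "((\<lambda>x. f (\<alpha> * x)) has_integral inverse \<alpha> * integral {\<alpha> * a..\<alpha> * b} f) {inverse \<alpha> * (\<alpha> * a)..inverse \<alpha> * (\<alpha> * b)}"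
    by simp
  moreover have "inverse \<alpha> * (\<alpha> * t) = t" for t
    using assms(1) by (simp only: mult.assoc[symmetric] left_inverse[OF less_imp_neq[OF assms(1), symmetric]] mult_1_left)
  ultimately have "((\<lambda>x. f (\<alpha> * x)) has_integral integral {\<alpha> * a..\<alpha> * b} f / \<alpha>) {a..b}"
    by (simp only: divide_inverse_commute)
  then show ?thesis by (rule integral_unique)
qed

definition Delta_remainder :: "real \<Rightarrow> nat \<Rightarrow> real \<Rightarrow> real" where
  "Delta_remainder \<phi> K x = Delta x + tau_const * tau_approx \<phi> K x"

lemma locally_bounded_borel_remainder:
  "\<alpha> > 0 \<Longrightarrow> locally_bounded_borel (\<lambda>x. Delta_remainder \<phi> K (\<alpha> * x))"
  unfolding Delta_remainder_def
  by (intro locally_bounded_borel_add locally_bounded_borel_mult locally_bounded_borel_const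
      locally_bounded_borel_Delta locally_bounded_borel_tau_approx)

text \<open>Substituting \<alpha> x multiplies the bound by \<alpha>^(3/2) and the measure by
  1/\<alpha>, hence the factor sqrt \<alpha>. A single phase serves all scales and all
  \<open>K\<close>, as the correlation of two scales demands.\<close>

lemma Delta_remainder_mean_square:
  "\<exists>\<phi>. \<forall>\<alpha>>0. \<forall>K. \<forall>e>0. eventually (\<lambda>X. integral {1..X} (\<lambda>x. (Delta_remainder \<phi> K (\<alpha> * x))\<^sup>2)
     \<le> (sqrt \<alpha> * (360 * tau_const\<^sup>2 * tau_tail K) + e) * X powr (3 / 2)) at_top"
proof -
  obtain \<phi> where \<phi>: "\<And>K e. e > 0 \<Longrightarrow> eventually (\<lambda>X. integral {X..2 * X} (\<lambda>x. (Delta x + tau_const * tau_approx \<phi> K x)\<^sup>2)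
      \<le> (360 * tau_const\<^sup>2 * tau_tail K + e) * X powr (3 / 2)) at_top"
    using Delta_mean_square_dyadic by blast
  have "eventually (\<lambda>X. integral {1..X} (\<lambda>x. (Delta_remainder \<phi> K (\<alpha> * x))\<^sup>2)
     \<le> (sqrt \<alpha> * (360 * tau_const\<^sup>2 * tau_tail K) + e) * X powr (3 / 2)) at_top" if \<alpha>: "\<alpha> > 0" and e: "e > 0" for \<alpha> K e
  proof -
    define e' where "e' = e / 2 / sqrt \<alpha>"
    have e': "e' > 0" using e \<alpha> by (simp add: e'_def)
    define \<rho> where "\<rho> = sqrt \<alpha> * (360 * tau_const\<^sup>2 * tau_tail K + e')"
    have \<rho>: "\<rho> \<ge> 0" using \<alpha> e' tau_tail_nonneg[of K] by (simp add: \<rho>_def)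
    have sq_lb: "locally_bounded_borel (\<lambda>x. (Delta_remainder \<phi> K (\<beta> * x))\<^sup>2)" if "\<beta> > 0" for \<beta>
      unfolding power2_eq_square using locally_bounded_borel_remainder[OF that] by (intro locally_bounded_borel_mult)
    have "filterlim (\<lambda>X. \<alpha> * X) at_top at_top" using \<alpha>
      by (intro filterlim_tendsto_pos_mult_at_top[OF tendsto_const]) (auto intro: filterlim_ident)
    from eventually_compose_filterlim[OF \<phi>[OF e', of K] this]
    have "eventually (\<lambda>X. integral {\<alpha> * X..2 * (\<alpha> * X)} (\<lambda>x. (Delta_remainder \<phi> K x)\<^sup>2)
      \<le> (360 * tau_const\<^sup>2 * tau_tail K + e') * (\<alpha> * X) powr (3 / 2)) at_top"
      unfolding Delta_remainder_def .
    then have "eventually (\<lambda>X. integral {X..2 * X} (\<lambda>x. (Delta_remainder \<phi> K (\<alpha> * x))\<^sup>2) \<le> \<rho> * X powr (3 / 2)) at_top"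
      using eventually_ge_at_top[of "max 1 (1 / \<alpha>)"]
    proof eventually_elim
      case (elim X)
      have X: "X \<ge> 1" "\<alpha> * X \<ge> 1" using elim \<alpha> by (auto simp: field_simps)
      have "(\<lambda>x. (Delta_remainder \<phi> K x)\<^sup>2) integrable_on {\<alpha> * X..\<alpha> * (2 * X)}"
        using locally_bounded_borel_integrable[OF sq_lb[of 1] X(2)] by simp
      from integral_scale_real[OF \<alpha> this]
      have "integral {X..2 * X} (\<lambda>x. (Delta_remainder \<phi> K (\<alpha> * x))\<^sup>2) = integral {\<alpha> * X..2 * (\<alpha> * X)} (\<lambda>x. (Delta_remainder \<phi> K x)\<^sup>2) / \<alpha>"
        by (simp add: mult_ac)
      also have "\<dots> \<le> (360 * tau_const\<^sup>2 * tau_tail K + e') * (\<alpha> * X) powr (3 / 2) / \<alpha>"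
        using elim \<alpha> by (intro divide_right_mono) auto
      also have "\<dots> = (360 * tau_const\<^sup>2 * tau_tail K + e') * (\<alpha> powr (3 / 2) / \<alpha>) * X powr (3 / 2)"
        using \<alpha> X by (simp add: powr_mult)
      also have "\<alpha> powr (3 / 2) / \<alpha> = sqrt \<alpha>"
        using \<alpha> powr_diff[of \<alpha> "3 / 2" 1] by (simp add: powr_half_sqrt)
      finally show ?case by (simp add: \<rho>_def mult_ac)
    qed
    from dyadic_integral_bound[OF locally_bounded_borel_integrable[OF sq_lb[OF \<alpha>]] _ \<rho> _ this, of "e / 2"]
    have "eventually (\<lambda>X. integral {1..X} (\<lambda>x. (Delta_remainder \<phi> K (\<alpha> * x))\<^sup>2) \<le> (\<rho> + e / 2) * X powr (3 / 2)) at_top"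
      using e by simp
    moreover have "\<rho> + e / 2 = sqrt \<alpha> * (360 * tau_const\<^sup>2 * tau_tail K) + e"
      using \<alpha> by (simp add: \<rho>_def e'_def distrib_left)
    ultimately show ?thesis by simp
  qed
  then show ?thesis by blast
qed

text \<open>Without oscillation the integral of sqrt x is 2/3 X^(3/2) up to a constant; with
  oscillation there is an explicit primitive of size O(X).\<close>

lemma sqrt_cos_mean:
  "((\<lambda>X. integral {1..X} (\<lambda>x. sqrt x * cos (c * sqrt x + d)) / X powr (3 / 2)) \<longlongrightarrow> (if c = 0 then 2 / 3 * cos d else 0)) at_top"
proof (cases "c = 0")
  case True
  have "eventually (\<lambda>X. (2 / 3 * X powr (3 / 2) - 2 / 3) * cos d / X powr (3 / 2) = integral {1..X} (\<lambda>x. sqrt x * cos (c * sqrt x + d)) / X powr (3 / 2)) at_top"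
    using eventually_ge_at_top[of 1]
  proof eventually_elim
    case (elim X)
    have "((\<lambda>x. sqrt x * cos (c * sqrt x + d)) has_integral (2 / 3 * X powr (3 / 2) * cos d - 2 / 3 * 1 powr (3 / 2) * cos d)) {1..X}"
    proof (rule fundamental_theorem_of_calculus[OF elim])
      fix x assume x: "x \<in> {1..X}"
      have "((\<lambda>x. 2 / 3 * x powr (3 / 2) * cos d) has_real_derivative (2 / 3 * (3 / 2 * x powr (3 / 2 - 1)) * cos d)) (at x within {1..X})"
        using x by (auto intro!: derivative_eq_intros)
      moreover have "2 / 3 * (3 / 2 * x powr (3 / 2 - 1)) * cos d = sqrt x * cos (c * sqrt x + d)"
        using True x by (simp add: powr_half_sqrt)
      ultimately show "((\<lambda>x. 2 / 3 * x powr (3 / 2) * cos d) has_vector_derivative (sqrt x * cos (c * sqrt x + d))) (at x within {1..X})"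
        by (simp add: has_real_derivative_iff_has_vector_derivative)
    qed
    then show ?case by (simp add: integral_unique algebra_simps)
  qed
  moreover have "((\<lambda>X. (2 / 3 * X powr (3 / 2) - 2 / 3) * cos d / X powr (3 / 2)) \<longlongrightarrow> 2 / 3 * cos d) at_top" by real_asymp
  ultimately show ?thesis using True by (simp add: Lim_transform_eventually)
next
  case False
  \<comment> \<open>The coefficients of repeated integration by parts. They are determined by
    \<open>A1 * c = 2\<close>, \<open>A2 * c = 2 * A1\<close> and \<open>A3 * c = A2\<close>, which
    make all lower order terms in the derivative of \<open>F\<close> cancel.\<close>
  define A1 where "A1 = 2 / c"
  define A2 where "A2 = 4 / c ^ 2"
  define A3 where "A3 = 4 / c ^ 3"
  have A: "A1 * c = 2" "A2 * c = 2 * A1" "A3 * c = A2"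
    using False by (auto simp: A1_def A2_def A3_def power2_eq_square power3_eq_cube)
  define F where "F = (\<lambda>x. A1 * x * sin (c * sqrt x + d) + A2 * sqrt x * cos (c * sqrt x + d) - A3 * sin (c * sqrt x + d))"
  have I: "integral {1..X} (\<lambda>x. sqrt x * cos (c * sqrt x + d)) = F X - F 1" if X: "X \<ge> 1" for X
  proof (rule integral_unique, rule fundamental_theorem_of_calculus[OF X])
    fix x assume "x \<in> {1..X}"
    then have x: "x > 0" by simp
    define i where "i = inverse (sqrt x)"
    have i: "sqrt x * i = 1" "x * i = sqrt x" using x by (auto simp: i_def real_div_sqrt divide_inverse[symmetric])
    have "(F has_real_derivative (A1 * sin (c * sqrt x + d) + A1 * x * (cos (c * sqrt x + d) * (c * (i / 2)))
       + (A2 * (i / 2) * cos (c * sqrt x + d) + A2 * sqrt x * (- sin (c * sqrt x + d) * (c * (i / 2))))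
       - A3 * (cos (c * sqrt x + d) * (c * (i / 2))))) (at x within {1..X})"
      unfolding F_def i_def using x by (auto intro!: derivative_eq_intros simp: algebra_simps)
    also have "(A1 * sin (c * sqrt x + d) + A1 * x * (cos (c * sqrt x + d) * (c * (i / 2)))
       + (A2 * (i / 2) * cos (c * sqrt x + d) + A2 * sqrt x * (- sin (c * sqrt x + d) * (c * (i / 2))))
       - A3 * (cos (c * sqrt x + d) * (c * (i / 2)))) =
       A1 * sin (c * sqrt x + d) + (A1 * c) * (x * i) / 2 * cos (c * sqrt x + d)
       + (A2 * (i / 2) * cos (c * sqrt x + d) - (A2 * c) * (sqrt x * i) / 2 * sin (c * sqrt x + d))
       - (A3 * c) * (i / 2) * cos (c * sqrt x + d)" by (simp add: algebra_simps)
    also have "\<dots> = sqrt x * cos (c * sqrt x + d)" unfolding A i by simp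
    finally show "(F has_vector_derivative sqrt x * cos (c * sqrt x + d)) (at x within {1..X})"
      by (simp add: has_real_derivative_iff_has_vector_derivative)
  qed
  have Fb: "\<bar>F X\<bar> \<le> (\<bar>A1\<bar> + \<bar>A2\<bar> + \<bar>A3\<bar>) * X" if X: "X \<ge> 1" for X
  proof -
    have sX: "sqrt X \<le> X" using X by (simp add: real_sqrt_le_iff' real_le_lsqrt self_le_power sqrt_le_D)
    have "\<bar>A1 * X * sin (c * sqrt X + d)\<bar> \<le> \<bar>A1\<bar> * X * 1"
      unfolding abs_mult using X by (intro mult_mono) auto
    moreover have "\<bar>A2 * sqrt X * cos (c * sqrt X + d)\<bar> \<le> \<bar>A2\<bar> * X * 1"
      unfolding abs_mult using X sX by (intro mult_mono mult_left_mono) auto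
    moreover have "\<bar>A3 * sin (c * sqrt X + d)\<bar> \<le> \<bar>A3\<bar> * X"
      unfolding abs_mult using X order_trans[OF abs_sin_le_one X] by (intro mult_left_mono) auto
    ultimately show ?thesis unfolding F_def distrib_right
      by (simp only: abs_le_iff mult_1_right) linarith
  qed
  define C where "C = \<bar>A1\<bar> + \<bar>A2\<bar> + \<bar>A3\<bar>"
  have "((\<lambda>X. integral {1..X} (\<lambda>x. sqrt x * cos (c * sqrt x + d)) / X powr (3 / 2)) \<longlongrightarrow> 0) at_top"
  proof (rule Lim_null_comparison)
    show "((\<lambda>X. (C * X + \<bar>F 1\<bar>) / X powr (3 / 2)) \<longlongrightarrow> 0) at_top" by real_asymp
    show "eventually (\<lambda>X. norm (integral {1..X} (\<lambda>x. sqrt x * cos (c * sqrt x + d)) / X powr (3 / 2)) \<le> (C * X + \<bar>F 1\<bar>) / X powr (3 / 2)) at_top"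
      using eventually_ge_at_top[of 1]
    proof eventually_elim
      case (elim X)
      have "\<bar>F X - F 1\<bar> \<le> C * X + \<bar>F 1\<bar>"
        using abs_triangle_ineq4[of "F X" "F 1"] Fb[OF elim] by (simp add: C_def)
      then show ?case using I[OF elim] elim by (simp add: abs_divide divide_right_mono)
    qed
  qed
  then show ?thesis using False by simp
qed

text \<open>The common phase cancels in the cosine of the difference of the arguments, so the limit
  at equal frequencies is 1/3 for every \<open>\<phi>\<close>. The cosine of the sum keeps the phase
  but always oscillates.\<close>

lemma sqrt_sin_sin_mean:
  assumes "u > 0" "v > 0"
  shows "((\<lambda>X. integral {1..X} (\<lambda>x. sqrt x * (sin (4 * pi * sqrt (u * x) + \<phi>) * sin (4 * pi * sqrt (v * x) + \<phi>))) / X powr (3 / 2))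
    \<longlongrightarrow> (if u = v then 1 / 3 else 0)) at_top"
proof -
  define c1 where "c1 = 4 * pi * (sqrt u - sqrt v)"
  define c2 where "c2 = 4 * pi * (sqrt u + sqrt v)"
  have "sqrt u + sqrt v > 0" using assms by (intro add_pos_pos) auto
  then have c2: "c2 \<noteq> 0" by (simp add: c2_def)
  have c1: "c1 = 0 \<longleftrightarrow> u = v" by (simp add: c1_def)
  have ii: "(\<lambda>x. sqrt x * cos (c * sqrt x + d)) integrable_on {1..X}" for c d X
    by (intro integrable_continuous_real continuous_intros)
  have eq: "sqrt x * (sin (4 * pi * sqrt (u * x) + \<phi>) * sin (4 * pi * sqrt (v * x) + \<phi>)) =
      (sqrt x * cos (c1 * sqrt x + 0) - sqrt x * cos (c2 * sqrt x + 2 * \<phi>)) / 2" for x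
  proof -
    have "sin (4 * pi * sqrt (u * x) + \<phi>) * sin (4 * pi * sqrt (v * x) + \<phi>) = (cos (c1 * sqrt x + 0) - cos (c2 * sqrt x + 2 * \<phi>)) / 2"
      by (simp add: sin_times_sin real_sqrt_mult c1_def c2_def algebra_simps)
    then show ?thesis by (simp only: right_diff_distrib times_divide_eq_right)
  qed
  have I: "integral {1..X} (\<lambda>x. sqrt x * (sin (4 * pi * sqrt (u * x) + \<phi>) * sin (4 * pi * sqrt (v * x) + \<phi>))) / X powr (3 / 2) =
     (integral {1..X} (\<lambda>x. sqrt x * cos (c1 * sqrt x + 0)) / X powr (3 / 2) - integral {1..X} (\<lambda>x. sqrt x * cos (c2 * sqrt x + 2 * \<phi>)) / X powr (3 / 2)) / 2" for X
    unfolding eq integral_divide Henstock_Kurzweil_Integration.integral_diff[OF ii ii] by (simp add: diff_divide_distrib)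
  have "((\<lambda>X. (integral {1..X} (\<lambda>x. sqrt x * cos (c1 * sqrt x + 0)) / X powr (3 / 2) - integral {1..X} (\<lambda>x. sqrt x * cos (c2 * sqrt x + 2 * \<phi>)) / X powr (3 / 2)) / 2)
     \<longlongrightarrow> ((if c1 = 0 then 2 / 3 * cos 0 else 0) - (if c2 = 0 then 2 / 3 * cos (2 * \<phi>) else 0)) / 2) at_top"
    by (intro tendsto_intros sqrt_cos_mean) auto
  moreover have "((if c1 = 0 then 2 / 3 * cos 0 else 0) - (if c2 = 0 then 2 / 3 * cos (2 * \<phi>) else 0)) / 2 = (if u = v then 1 / 3 else 0 :: real)"
    using c1 c2 by simp
  ultimately show ?thesis unfolding I by (simp only:)
qed

section \<open>Resonant pairs of frequencies and the final limit\<close>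

definition diagonal_sum :: "real \<Rightarrow> real \<Rightarrow> nat \<Rightarrow> real" where
  "diagonal_sum \<alpha> \<beta> K = (\<Sum>m=1..K. \<Sum>n=1..K. if real m * \<alpha> = real n * \<beta> then tau_coeff m * tau_coeff n else 0)"

lemma tau_approx_correlation:
  assumes \<alpha>: "\<alpha> > 0" and \<beta>: "\<beta> > 0"
  shows "((\<lambda>X. integral {1..X} (\<lambda>x. tau_approx \<phi> K (\<alpha> * x) * tau_approx \<phi> K (\<beta> * x)) / X powr (3 / 2))
    \<longlongrightarrow> (\<alpha> * \<beta>) powr (1 / 4) / 3 * diagonal_sum \<alpha> \<beta> K) at_top"
proof -
  define f where "f = (\<lambda>m n x. sqrt x * (sin (4 * pi * sqrt (real m * \<alpha> * x) + \<phi>) * sin (4 * pi * sqrt (real n * \<beta> * x) + \<phi>)))"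
  define q where "q = (\<alpha> * \<beta>) powr (1 / 4)"
  have fi: "f m n integrable_on {1..X}" for m n X
    unfolding f_def by (intro integrable_continuous_real continuous_intros)
  have "integral {1..X} (\<lambda>x. tau_approx \<phi> K (\<alpha> * x) * tau_approx \<phi> K (\<beta> * x)) / X powr (3 / 2) =
     q * (\<Sum>m=1..K. \<Sum>n=1..K. tau_coeff m * tau_coeff n * (integral {1..X} (f m n) / X powr (3 / 2)))" for X
  proof -
    have pt: "tau_approx \<phi> K (\<alpha> * x) * tau_approx \<phi> K (\<beta> * x) = q * (\<Sum>m=1..K. \<Sum>n=1..K. tau_coeff m * tau_coeff n * f m n x)"
      if x: "x \<in> {1..X}" for x
    proof -
      have "(\<alpha> * x) powr (1 / 4) * (\<beta> * x) powr (1 / 4) = q * (x powr (1 / 4) * x powr (1 / 4))"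
        by (simp add: q_def powr_mult mult_ac)
      also have "x powr (1 / 4) * x powr (1 / 4) = sqrt x" using x by (simp add: powr_half_sqrt flip: powr_add)
      finally have pw: "(\<alpha> * x) powr (1 / 4) * (\<beta> * x) powr (1 / 4) = q * sqrt x" .
      have "tau_approx \<phi> K (\<alpha> * x) * tau_approx \<phi> K (\<beta> * x) =
         ((\<alpha> * x) powr (1 / 4) * (\<beta> * x) powr (1 / 4)) * (tau_sine_sum \<phi> {1..K} (\<alpha> * x) * tau_sine_sum \<phi> {1..K} (\<beta> * x))"
        by (simp add: tau_approx_def)
      also have "\<dots> = q * (sqrt x * (tau_sine_sum \<phi> {1..K} (\<alpha> * x) * tau_sine_sum \<phi> {1..K} (\<beta> * x)))"
        unfolding pw by (rule mult.assoc)
      also have "sqrt x * (tau_sine_sum \<phi> {1..K} (\<alpha> * x) * tau_sine_sum \<phi> {1..K} (\<beta> * x)) =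
          (\<Sum>m=1..K. \<Sum>n=1..K. tau_coeff m * tau_coeff n * f m n x)"
        unfolding sqrt_sine_sum_def sum_product unfolding sum_distrib_left
      proof (intro sum.cong refl)
        fix m n
        have "sqrt x * ((t * s) * (t' * s')) = t * t' * (sqrt x * (s * s'))" for t s t' s' :: real
          by (simp only: mult_ac)
        then show "sqrt x * (tau_coeff m * sin (4 * pi * sqrt (real m * (\<alpha> * x)) + \<phi>) *
           (tau_coeff n * sin (4 * pi * sqrt (real n * (\<beta> * x)) + \<phi>))) = tau_coeff m * tau_coeff n * f m n x"
          unfolding f_def mult.assoc[of "real m" \<alpha> x] mult.assoc[of "real n" \<beta> x] .
      qed
      finally show ?thesis .
    qed
    have "((\<lambda>x. q * (\<Sum>m=1..K. \<Sum>n=1..K. tau_coeff m * tau_coeff n * f m n x)) has_integral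
        q * (\<Sum>m=1..K. \<Sum>n=1..K. tau_coeff m * tau_coeff n * integral {1..X} (f m n))) {1..X}"
      by (intro has_integral_mult_right has_integral_sum integrable_integral fi) auto
    then have "((\<lambda>x. tau_approx \<phi> K (\<alpha> * x) * tau_approx \<phi> K (\<beta> * x)) has_integral
        q * (\<Sum>m=1..K. \<Sum>n=1..K. tau_coeff m * tau_coeff n * integral {1..X} (f m n))) {1..X}"
      by (rule has_integral_eq[rotated]) (simp add: pt)
    then have "integral {1..X} (\<lambda>x. tau_approx \<phi> K (\<alpha> * x) * tau_approx \<phi> K (\<beta> * x)) =
        q * (\<Sum>m=1..K. \<Sum>n=1..K. tau_coeff m * tau_coeff n * integral {1..X} (f m n))" by (rule integral_unique)
    then show ?thesis by (simp only: times_divide_eq_right[symmetric] sum_divide_distrib)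
  qed
  moreover have "((\<lambda>X. q * (\<Sum>m=1..K. \<Sum>n=1..K. tau_coeff m * tau_coeff n * (integral {1..X} (f m n) / X powr (3 / 2)))) \<longlongrightarrow>
      q * (\<Sum>m=1..K. \<Sum>n=1..K. tau_coeff m * tau_coeff n * (if real m * \<alpha> = real n * \<beta> then 1 / 3 else 0))) at_top"
    unfolding f_def using \<alpha> \<beta> by (intro tendsto_intros sqrt_sin_sin_mean) auto
  moreover have "q * (\<Sum>m=1..K. \<Sum>n=1..K. tau_coeff m * tau_coeff n * (if real m * \<alpha> = real n * \<beta> then 1 / 3 else 0)) =
     (\<alpha> * \<beta>) powr (1 / 4) / 3 * diagonal_sum \<alpha> \<beta> K"
    unfolding q_def diagonal_sum_def sum_distrib_left by (intro sum.cong refl) simp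
  ultimately show ?thesis by (simp only:)
qed

lemma diagonal_sum_same:
  assumes "\<alpha> > 0"
  shows "diagonal_sum \<alpha> \<alpha> K \<le> tau_square_total"
proof -
  have "diagonal_sum \<alpha> \<alpha> K = (\<Sum>m=1..K. (tau_coeff m)\<^sup>2)"
    unfolding diagonal_sum_def
  proof (intro sum.cong refl)
    fix m assume m: "m \<in> {1..K}"
    have "(\<Sum>n=1..K. if real m * \<alpha> = real n * \<alpha> then tau_coeff m * tau_coeff n else 0) =
       (\<Sum>n=1..K. if n = m then tau_coeff m * tau_coeff n else 0)"
      using assms by (intro sum.cong refl) auto
    also have "\<dots> = (tau_coeff m)\<^sup>2" using m by (simp add: power2_eq_square)
    finally show "(\<Sum>n=1..K. if real m * \<alpha> = real n * \<alpha> then tau_coeff m * tau_coeff n else 0) = (tau_coeff m)\<^sup>2" .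
  qed
  then show ?thesis using tau_tail_nonneg[of K] by (simp add: tau_tail_def)
qed

text \<open>\<open>Delta\<close> is split into its sine part \<open>p\<close> and the remainder
  \<open>r\<close>. Products containing \<open>r\<close> are controlled by AM-GM with weight
  \<open>\<eta>\<close>, and the parameters are chosen in the order \<open>\<eta>\<close>,
  \<open>K\<close>, \<open>X\<close>. The denominator 6 pi^2 is the product of 1/3 from the mean of
  a squared sine with weight sqrt x and of the square 1/(2 pi^2) of
  \<open>tau_const\<close>.\<close>

lemma Delta_correlation:
  assumes \<alpha>: "\<alpha> > 0" and \<beta>: "\<beta> > 0" and S: "diagonal_sum \<alpha> \<beta> \<longlonglongrightarrow> S"
  shows "((\<lambda>X. 1 / X powr (3 / 2) * integral {1..X} (\<lambda>x. Delta (\<alpha> * x) * Delta (\<beta> * x)))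
    \<longlongrightarrow> (\<alpha> * \<beta>) powr (1 / 4) / (6 * pi\<^sup>2) * S) at_top"
proof -
  obtain \<phi> where rem: "\<And>\<gamma> K e. \<gamma> > 0 \<Longrightarrow> e > 0 \<Longrightarrow> eventually (\<lambda>X. integral {1..X} (\<lambda>x. (Delta_remainder \<phi> K (\<gamma> * x))\<^sup>2)
     \<le> (sqrt \<gamma> * (360 * tau_const\<^sup>2 * tau_tail K) + e) * X powr (3 / 2)) at_top"
    using Delta_remainder_mean_square by blast
  define B where "B = tau_const"
  have B2: "B\<^sup>2 = 1 / (2 * pi\<^sup>2)"
    by (simp add: B_def tau_const_def voronoi_const_def power_divide power_mult_distrib power2_eq_square)
  define q where "q = (\<alpha> * \<beta>) powr (1 / 4) / 3"
  define l where "l = B\<^sup>2 * (q * S)"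
  \<comment> \<open>A bound for the limiting mean squares of the sine parts at both scales, valid
    for every \<open>K\<close> by \<open>diagonal_sum_same\<close>; this is why
    \<open>\<eta>\<close> can be fixed before \<open>K\<close>. The summand 1 makes the inequality
    strict, so that it holds for all large X.\<close>
  define M where "M = B\<^sup>2 * (((\<alpha> * \<alpha>) powr (1 / 4) + (\<beta> * \<beta>) powr (1 / 4)) / 3 * tau_square_total) + 1"
  have T0: "tau_square_total \<ge> 0" using tau_tail_nonneg[of 0] by (simp add: tau_tail_def)
  have M: "M \<ge> 1" unfolding M_def using T0 by simp
  define I where "I = (\<lambda>X f. integral {1..X} f / X powr (3 / 2) :: real)"
  have "((\<lambda>X. I X (\<lambda>x. Delta (\<alpha> * x) * Delta (\<beta> * x))) \<longlongrightarrow> l) at_top"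
  proof (rule tendstoI)
    fix e :: real assume e: "e > 0"
    \<comment> \<open>The sine parts enter with weight \<open>\<eta>\<close> and contribute at most
      e/4; the remainders enter with weight \<open>1 / \<eta>\<close>, which
      \<open>\<epsilon> = \<eta> * e / 8\<close> turns into e/4 as well. The cap at 1 lets the
      product of both remainders be estimated by the same quantities.\<close>
    define \<eta> where "\<eta> = min 1 (e / (4 * M))"
    have \<eta>: "\<eta> > 0" "\<eta> \<le> 1" "\<eta> * M \<le> e / 4" using e M by (auto simp: \<eta>_def min_def field_simps)
    define \<epsilon> where "\<epsilon> = \<eta> * e / 8"
    have \<epsilon>: "\<epsilon> > 0" using \<eta> e by (simp add: \<epsilon>_def)
    have "(\<lambda>K. (sqrt \<alpha> + sqrt \<beta>) * (360 * tau_const\<^sup>2 * tau_tail K)) \<longlonglongrightarrow> (sqrt \<alpha> + sqrt \<beta>) * (360 * tau_const\<^sup>2 * 0)"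
      by (intro tendsto_intros tau_tail_tendsto)
    then have "eventually (\<lambda>K. (sqrt \<alpha> + sqrt \<beta>) * (360 * tau_const\<^sup>2 * tau_tail K) < \<epsilon>) sequentially"
      using \<epsilon> by (auto simp: order_tendsto_iff)
    moreover have "eventually (\<lambda>K. dist (B\<^sup>2 * (q * diagonal_sum \<alpha> \<beta> K)) l < e / 8) sequentially"
      unfolding l_def using e by (intro tendstoD tendsto_intros S) auto
    ultimately obtain K where K: "(sqrt \<alpha> + sqrt \<beta>) * (360 * tau_const\<^sup>2 * tau_tail K) < \<epsilon>"
      "dist (B\<^sup>2 * (q * diagonal_sum \<alpha> \<beta> K)) l < e / 8"
      using eventually_happens[OF eventually_conj] by (metis (no_types, lifting) trivial_limit_sequentially)
    define p where "p = (\<lambda>\<gamma> x. - B * tau_approx \<phi> K (\<gamma> * x))"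
    define r where "r = (\<lambda>\<gamma> x. Delta_remainder \<phi> K (\<gamma> * x))"
    have D: "Delta (\<gamma> * x) = p \<gamma> x + r \<gamma> x" for \<gamma> x by (simp add: p_def r_def Delta_remainder_def B_def)
    have lb: "locally_bounded_borel (p \<gamma>)" "locally_bounded_borel (r \<gamma>)" if "\<gamma> > 0" for \<gamma>
      unfolding p_def r_def
      by (intro locally_bounded_borel_mult locally_bounded_borel_const locally_bounded_borel_tau_approx locally_bounded_borel_remainder that)+
    have pp: "((\<lambda>X. I X (\<lambda>x. p \<gamma> x * p \<delta> x)) \<longlongrightarrow> B\<^sup>2 * ((\<gamma> * \<delta>) powr (1 / 4) / 3 * diagonal_sum \<gamma> \<delta> K)) at_top" if "\<gamma> > 0" "\<delta> > 0" for \<gamma> \<delta>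
    proof -
      have "I X (\<lambda>x. p \<gamma> x * p \<delta> x) = B\<^sup>2 * (integral {1..X} (\<lambda>x. tau_approx \<phi> K (\<gamma> * x) * tau_approx \<phi> K (\<delta> * x)) / X powr (3 / 2))" for X
      proof -
        have "(\<lambda>x. p \<gamma> x * p \<delta> x) = (\<lambda>x. B\<^sup>2 * (tau_approx \<phi> K (\<gamma> * x) * tau_approx \<phi> K (\<delta> * x)))"
          by (simp add: p_def fun_eq_iff power2_eq_square)
        then show ?thesis by (simp add: I_def)
      qed
      then show ?thesis using tendsto_mult_left[OF tau_approx_correlation[OF that, of \<phi> K], of "B\<^sup>2"] by (simp only:)
    qed
    have ev_pp: "eventually (\<lambda>X. dist (I X (\<lambda>x. p \<alpha> x * p \<beta> x)) (B\<^sup>2 * (q * diagonal_sum \<alpha> \<beta> K)) < e / 8) at_top"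
      unfolding q_def using e \<alpha> \<beta> by (intro tendstoD pp) auto
    have ev_sq: "eventually (\<lambda>X. I X (\<lambda>x. p \<alpha> x * p \<alpha> x) + I X (\<lambda>x. p \<beta> x * p \<beta> x) < M) at_top"
    proof -
      have L: "((\<lambda>X. I X (\<lambda>x. p \<alpha> x * p \<alpha> x) + I X (\<lambda>x. p \<beta> x * p \<beta> x)) \<longlongrightarrow>
         B\<^sup>2 * ((\<alpha> * \<alpha>) powr (1 / 4) / 3 * diagonal_sum \<alpha> \<alpha> K) + B\<^sup>2 * ((\<beta> * \<beta>) powr (1 / 4) / 3 * diagonal_sum \<beta> \<beta> K)) at_top"
        using \<alpha> \<beta> by (intro tendsto_add pp)
      have "B\<^sup>2 * ((\<alpha> * \<alpha>) powr (1 / 4) / 3 * diagonal_sum \<alpha> \<alpha> K) + B\<^sup>2 * ((\<beta> * \<beta>) powr (1 / 4) / 3 * diagonal_sum \<beta> \<beta> K) \<le>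
         B\<^sup>2 * ((\<alpha> * \<alpha>) powr (1 / 4) / 3 * tau_square_total) + B\<^sup>2 * ((\<beta> * \<beta>) powr (1 / 4) / 3 * tau_square_total)"
        using \<alpha> \<beta> by (intro add_mono mult_left_mono diagonal_sum_same) auto
      also have "\<dots> < M" by (simp add: M_def algebra_simps add_divide_distrib)
      finally show ?thesis by (rule order_tendstoD(2)[OF L])
    qed
    have ev_r: "eventually (\<lambda>X. I X (\<lambda>x. r \<gamma> x * r \<gamma> x) \<le> sqrt \<gamma> * (360 * tau_const\<^sup>2 * tau_tail K) + \<epsilon> / 2) at_top" if "\<gamma> > 0" for \<gamma>
    proof -
      have "eventually (\<lambda>X. integral {1..X} (\<lambda>x. (Delta_remainder \<phi> K (\<gamma> * x))\<^sup>2)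
         \<le> (sqrt \<gamma> * (360 * tau_const\<^sup>2 * tau_tail K) + \<epsilon> / 2) * X powr (3 / 2)) at_top"
        using rem[OF that, of "\<epsilon> / 2" K] \<epsilon> by simp
      then show ?thesis using eventually_gt_at_top[of 0]
        by eventually_elim (simp add: I_def r_def power2_eq_square divide_le_eq)
    qed
    show "eventually (\<lambda>X. dist (I X (\<lambda>x. Delta (\<alpha> * x) * Delta (\<beta> * x))) l < e) at_top"
      using ev_pp ev_sq ev_r[OF \<alpha>] ev_r[OF \<beta>] eventually_ge_at_top[of 1]
    proof eventually_elim
      case (elim X)
      note lbs = lb[OF \<alpha>] lb[OF \<beta>]
      have ii: "(\<lambda>x. f x * g x) integrable_on {1..X}" if "locally_bounded_borel f" "locally_bounded_borel g" for f g
        using that by (intro locally_bounded_borel_integrable locally_bounded_borel_mult) auto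
      have amgm: "\<bar>I X (\<lambda>x. f x * g x)\<bar> \<le> (I X (\<lambda>x. f x * f x) / \<eta> + \<eta> * I X (\<lambda>x. g x * g x)) / 2"
        if fg: "locally_bounded_borel f" "locally_bounded_borel g" for f g
      proof -
        have hi: "((\<lambda>x. (f x * f x / \<eta> + \<eta> * (g x * g x)) / 2) has_integral
           (integral {1..X} (\<lambda>x. f x * f x) / \<eta> + \<eta> * integral {1..X} (\<lambda>x. g x * g x)) / 2) {1..X}"
          by (intro has_integral_divide has_integral_add has_integral_mult_right integrable_integral ii fg)
        have "norm (integral {1..X} (\<lambda>x. f x * g x)) \<le> integral {1..X} (\<lambda>x. (f x * f x / \<eta> + \<eta> * (g x * g x)) / 2)"
        proof (rule integral_norm_bound_integral)
          fix x
          define a where "a = \<bar>f x\<bar>"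
          define b where "b = \<bar>g x\<bar>"
          have "0 \<le> (a - \<eta> * b)\<^sup>2 / \<eta>" using \<eta> by simp
          also have "\<dots> = a * a / \<eta> + \<eta> * (b * b) - 2 * (a * b)"
            using \<eta> by (simp add: power2_eq_square field_simps)
          finally have "a * b \<le> (a * a / \<eta> + \<eta> * (b * b)) / 2" by simp
          then show "norm (f x * g x) \<le> (f x * f x / \<eta> + \<eta> * (g x * g x)) / 2"
            by (simp add: a_def b_def abs_mult)
        qed (use hi ii fg in \<open>auto intro: has_integral_integrable\<close>)
        then have "\<bar>integral {1..X} (\<lambda>x. f x * g x)\<bar> \<le> (integral {1..X} (\<lambda>x. f x * f x) / \<eta> + \<eta> * integral {1..X} (\<lambda>x. g x * g x)) / 2"
          unfolding integral_unique[OF hi] by simp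
        then have "\<bar>integral {1..X} (\<lambda>x. f x * g x)\<bar> / X powr (3 / 2) \<le>
            ((integral {1..X} (\<lambda>x. f x * f x) / \<eta> + \<eta> * integral {1..X} (\<lambda>x. g x * g x)) / 2) / X powr (3 / 2)"
          by (intro divide_right_mono) auto
        then show ?thesis by (simp add: I_def abs_divide add_divide_distrib mult.commute)
      qed
      have Inn: "I X (\<lambda>x. f x * f x) \<ge> 0" if "locally_bounded_borel f" for f
        unfolding I_def using ii[OF that that] by (intro divide_nonneg_nonneg integral_nonneg) auto
      have exp: "I X (\<lambda>x. Delta (\<alpha> * x) * Delta (\<beta> * x)) =
         I X (\<lambda>x. p \<alpha> x * p \<beta> x) + I X (\<lambda>x. r \<beta> x * p \<alpha> x) + I X (\<lambda>x. r \<alpha> x * p \<beta> x) + I X (\<lambda>x. r \<alpha> x * r \<beta> x)"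
      proof -
        have "((\<lambda>x. p \<alpha> x * p \<beta> x + r \<beta> x * p \<alpha> x + r \<alpha> x * p \<beta> x + r \<alpha> x * r \<beta> x) has_integral
           (integral {1..X} (\<lambda>x. p \<alpha> x * p \<beta> x) + integral {1..X} (\<lambda>x. r \<beta> x * p \<alpha> x)
            + integral {1..X} (\<lambda>x. r \<alpha> x * p \<beta> x) + integral {1..X} (\<lambda>x. r \<alpha> x * r \<beta> x))) {1..X}"
          by (intro has_integral_add integrable_integral ii lbs)
        moreover have "(\<lambda>x. Delta (\<alpha> * x) * Delta (\<beta> * x)) = (\<lambda>x. p \<alpha> x * p \<beta> x + r \<beta> x * p \<alpha> x + r \<alpha> x * p \<beta> x + r \<alpha> x * r \<beta> x)"
          unfolding D by (simp add: fun_eq_iff algebra_simps)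
        ultimately show ?thesis unfolding I_def by (simp add: integral_unique add_divide_distrib)
      qed
      define Ra where "Ra = I X (\<lambda>x. r \<alpha> x * r \<alpha> x)"
      define Rb where "Rb = I X (\<lambda>x. r \<beta> x * r \<beta> x)"
      define Pa where "Pa = I X (\<lambda>x. p \<alpha> x * p \<alpha> x)"
      define Pb where "Pb = I X (\<lambda>x. p \<beta> x * p \<beta> x)"
      have R: "Ra + Rb < 2 * \<epsilon>" "Ra \<ge> 0" "Rb \<ge> 0" using elim K Inn lbs by (auto simp: Ra_def Rb_def algebra_simps)
      have P: "Pa + Pb < M" "Pa \<ge> 0" "Pb \<ge> 0" using elim Inn lbs by (auto simp: Pa_def Pb_def)
      have t1: "\<bar>I X (\<lambda>x. r \<beta> x * p \<alpha> x)\<bar> \<le> (Rb / \<eta> + \<eta> * Pa) / 2" unfolding Rb_def Pa_def by (intro amgm lbs)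
      have t2: "\<bar>I X (\<lambda>x. r \<alpha> x * p \<beta> x)\<bar> \<le> (Ra / \<eta> + \<eta> * Pb) / 2" unfolding Ra_def Pb_def by (intro amgm lbs)
      have t3: "\<bar>I X (\<lambda>x. r \<alpha> x * r \<beta> x)\<bar> \<le> (Ra / \<eta> + \<eta> * Rb) / 2" unfolding Ra_def Rb_def by (intro amgm lbs)
      have \<eta>Rb: "\<eta> * Rb \<le> Rb / \<eta>"
      proof -
        have "\<eta> * Rb \<le> 1 * Rb" using \<eta> R by (intro mult_right_mono) auto
        also have "\<dots> \<le> Rb / \<eta>" using \<eta> R by (simp add: le_divide_eq mult_left_le)
        finally show ?thesis .
      qed
      have Rbound: "(Ra + Rb) / \<eta> \<le> e / 4"
      proof -
        have "(Ra + Rb) / \<eta> \<le> 2 * \<epsilon> / \<eta>" using R \<eta> by (intro divide_right_mono) auto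
        also have "\<dots> = e / 4" using \<eta> by (simp add: \<epsilon>_def)
        finally show ?thesis .
      qed
      have "\<eta> * (Pa + Pb) \<le> \<eta> * M" using P \<eta> by (intro mult_left_mono) auto
      then have Pbound: "\<eta> * Pa + \<eta> * Pb \<le> e / 4" using \<eta> by (simp add: distrib_left)
      have tot: "(Rb / \<eta> + \<eta> * Pa) / 2 + (Ra / \<eta> + \<eta> * Pb) / 2 + (Ra / \<eta> + \<eta> * Rb) / 2 \<le> e / 2"
      proof -
        have "(B + C) / 2 + (A + D) / 2 + (A + E) / 2 \<le> e / 2" if "A + B \<le> e / 4" "C + D \<le> e / 4" "E \<le> B" for A B C D E :: real
          using that e by (simp add: field_simps)
        from this[OF _ Pbound \<eta>Rb] show ?thesis using Rbound by (simp only: add_divide_distrib)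
      qed
      have d1: "\<bar>I X (\<lambda>x. p \<alpha> x * p \<beta> x) - B\<^sup>2 * (q * diagonal_sum \<alpha> \<beta> K)\<bar> < e / 8" using elim by (simp add: dist_real_def)
      have d2: "\<bar>B\<^sup>2 * (q * diagonal_sum \<alpha> \<beta> K) - l\<bar> < e / 8" using K by (simp add: dist_real_def)
      show "dist (I X (\<lambda>x. Delta (\<alpha> * x) * Delta (\<beta> * x))) l < e"
        unfolding exp dist_real_def using t1 t2 t3 tot d1 d2 e by (simp only: abs_less_iff abs_le_iff) linarith
    qed
  qed
  moreover have "l = (\<alpha> * \<beta>) powr (1 / 4) / (6 * pi\<^sup>2) * S" by (simp add: l_def B2 q_def)
  ultimately show ?thesis by (simp add: I_def)
qed

text \<open>Resonance means m d = n c, and coprimality forces m = c k, n = d k. Both indices are at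
  most K exactly when k is at most K div max(c, d), so the truncated diagonal is exactly a partial
  sum of the correlation series.\<close>

lemma diagonal_sum_rational:
  assumes a: "a > 0" and b: "b > 0"
  defines "l \<equiv> gcd a b"
  defines "c \<equiv> a div l" and "d \<equiv> b div l"
  assumes T: "(tau_corr_term (3 / 2) c d has_sum T) {1..}"
  shows "diagonal_sum (1 / real a) (1 / real b) \<longlonglongrightarrow> real (c * d) powr (- 3 / 4) * T"
proof -
  have l: "l > 0" using a by (simp add: l_def)
  have ac: "a = l * c" and bd: "b = l * d" by (simp_all add: l_def c_def d_def)
  have cd: "c > 0" "d > 0" using a b ac bd by (auto intro!: Nat.gr0I)
  have cop: "coprime c d" unfolding c_def d_def l_def using a by (intro div_gcd_coprime) auto
  define M where "M = max c d"
  have M: "M > 0" using cd by (simp add: M_def)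
  have iff: "real m * (1 / real a) = real n * (1 / real b) \<longleftrightarrow> m * d = n * c" for m n
  proof -
    have "real m * (1 / real a) = real n * (1 / real b) \<longleftrightarrow> real (m * b) = real (n * a)"
      using a b by (simp add: field_simps)
    also have "\<dots> \<longleftrightarrow> m * b = n * a" by (rule of_nat_eq_iff)
    also have "\<dots> \<longleftrightarrow> l * (m * d) = l * (n * c)" unfolding ac bd by (simp only: mult_ac)
    also have "\<dots> \<longleftrightarrow> m * d = n * c" using l by simp
    finally show ?thesis .
  qed
  have t: "tau_coeff (c * k) * tau_coeff (d * k) = real (c * d) powr (- 3 / 4) * tau_corr_term (3 / 2) c d k" for k
  proof -
    have "real k powr (- 3 / 4) * real k powr (- 3 / 4) = real k powr - (3 / 2)" by (simp flip: powr_add)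
    moreover have "tau_coeff (c * k) * tau_coeff (d * k) = real (divisor_tau (c * k)) * real (divisor_tau (d * k)) *
        ((real c powr (- 3 / 4) * real d powr (- 3 / 4)) * (real k powr (- 3 / 4) * real k powr (- 3 / 4)))"
      by (simp add: tau_coeff_def powr_mult)
    ultimately show ?thesis by (simp add: tau_corr_term_def powr_mult)
  qed
  have diag: "diagonal_sum (1 / real a) (1 / real b) K = (\<Sum>k=1..K div M. real (c * d) powr (- 3 / 4) * tau_corr_term (3 / 2) c d k)" for K
  proof -
    have "diagonal_sum (1 / real a) (1 / real b) K = (\<Sum>(m,n)\<in>{1..K}\<times>{1..K}. if m * d = n * c then tau_coeff m * tau_coeff n else 0)"
      unfolding diagonal_sum_def iff by (rule sum.cartesian_product)
    also have "\<dots> = (\<Sum>(m,n)\<in>{p\<in>{1..K}\<times>{1..K}. fst p * d = snd p * c}. tau_coeff m * tau_coeff n)"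
      unfolding case_prod_unfold by (rule sum.inter_filter[symmetric]) simp
    also have "\<dots> = (\<Sum>k=1..K div M. tau_coeff (c * k) * tau_coeff (d * k))"
    proof (rule sum.reindex_bij_witness[where i = "\<lambda>k. (c * k, d * k)" and j = "\<lambda>p. fst p div c"])
      fix p assume "p \<in> {p\<in>{1..K}\<times>{1..K}. fst p * d = snd p * c}"
      then obtain m n where p: "p = (m, n)" "m \<in> {1..K}" "n \<in> {1..K}" "m * d = n * c" by (cases p) auto
      have "c dvd m * d" using p by simp
      then have "c dvd m" using cop by (simp add: coprime_dvd_mult_left_iff)
      then obtain k where k: "m = c * k" by (auto elim: dvdE)
      then have "c * (k * d) = c * n" using p(4) by (simp add: mult_ac)
      then have n: "n = d * k" using cd by (simp add: mult.commute)
      show "(c * (fst p div c), d * (fst p div c)) = p" using p k n cd by simp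
      have "c * k \<le> K" "d * k \<le> K" "k \<ge> 1" using p k n by (auto simp: Suc_le_eq intro!: Nat.gr0I)
      then have "k * M \<le> K" by (simp add: M_def max_def mult.commute)
      then have "k \<le> K div M" using M by (simp add: less_eq_div_iff_mult_less_eq)
      then show "fst p div c \<in> {1..K div M}" using p k cd \<open>k \<ge> 1\<close> by simp
      show "tau_coeff (c * (fst p div c)) * tau_coeff (d * (fst p div c)) = (case p of (m, n) \<Rightarrow> tau_coeff m * tau_coeff n)"
        using p k n cd by simp
    next
      fix k assume k: "k \<in> {1..K div M}"
      then have "k * M \<le> K" using M by (simp add: less_eq_div_iff_mult_less_eq)
      moreover have "c * k \<le> k * M" "d * k \<le> k * M" by (auto simp: M_def mult.commute)
      ultimately have "c * k \<le> K" "d * k \<le> K" by (blast intro: order_trans)+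
      then show "(c * k, d * k) \<in> {p\<in>{1..K}\<times>{1..K}. fst p * d = snd p * c}"
        using k cd by (auto simp: Suc_le_eq mult_ac)
      show "fst (c * k, d * k) div c = k" using cd by simp
    qed
    also have "\<dots> = (\<Sum>k=1..K div M. real (c * d) powr (- 3 / 4) * tau_corr_term (3 / 2) c d k)" by (simp only: t)
    finally show ?thesis .
  qed
  have "((\<lambda>n. tau_corr_term (3 / 2) c d (Suc n)) has_sum T) UNIV"
    using T by (subst has_sum_reindex_bij_witness[where i = "\<lambda>n. n - 1" and j = Suc and T = "{1..}" and h = "tau_corr_term (3 / 2) c d"]) auto
  then have "(\<lambda>K. \<Sum>n<K. tau_corr_term (3 / 2) c d (Suc n)) \<longlonglongrightarrow> T"
    using has_sum_imp_sums by (auto simp: sums_def)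
  moreover have "(\<Sum>n<K. tau_corr_term (3 / 2) c d (Suc n)) = (\<Sum>k=1..K. tau_corr_term (3 / 2) c d k)" for K
    by (rule sum.reindex_bij_witness[where i = "\<lambda>n. n - 1" and j = Suc]) auto
  ultimately have "(\<lambda>K. real (c * d) powr (- 3 / 4) * (\<Sum>k=1..K. tau_corr_term (3 / 2) c d k)) \<longlonglongrightarrow> real (c * d) powr (- 3 / 4) * T"
    by (intro tendsto_intros) simp
  moreover have "filterlim (\<lambda>K. K div M) at_top sequentially"
    unfolding filterlim_at_top
  proof
    fix Z show "eventually (\<lambda>K. Z \<le> K div M) sequentially"
      using eventually_ge_at_top[of "Z * M"] by eventually_elim (use M in \<open>simp add: less_eq_div_iff_mult_less_eq\<close>)
  qed
  ultimately show ?thesis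
    unfolding diag[abs_def] sum_distrib_left[symmetric] by (rule filterlim_compose)
qed

lemma diagonal_sum_irrational:
  assumes "\<theta> > 0" "\<theta> \<notin> \<rat>"
  shows "diagonal_sum 1 \<theta> K = 0"
proof -
  have "real m * 1 \<noteq> real n * \<theta>" if "n \<in> {1..K}" for m n
  proof
    assume "real m * 1 = real n * \<theta>"
    then have "\<theta> = real m / real n" using that by (simp add: field_simps)
    then show False using assms by simp
  qed
  then show ?thesis unfolding diagonal_sum_def by (intro sum.neutral ballI) auto
qed

theorem theorem1p2:
  shows "(\<forall>a b :: nat. a > 0 \<and> b > 0 \<longrightarrow>
      (let l = gcd a b; c = a div l; d = b div l in
        ((\<lambda>X :: real. 1 / X powr (3/2) *
            integral {1..X} (\<lambda>x. Delta (x / real a) * Delta (x / real b)))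
          \<longlongrightarrow>
            real (divisor_tau (c * d)) / (6 * pi\<^sup>2 * sqrt (real l) * real (c * d))
            * (zeta_real (3/2) ^ 4 / zeta_real 3)
            * (\<Prod>p\<in>prime_factors (c * d).
                let k = real (multiplicity p (c * d)) in
                  (1 - (k - 1) / ((k + 1) * real p powr (3/2)))
                  / (1 + 1 / real p powr (3/2)))) at_top))
    \<and> (\<forall>\<theta> :: real. \<theta> > 0 \<and> \<theta> \<notin> \<rat> \<longrightarrow>
        ((\<lambda>X :: real. 1 / X powr (3/2) *
            integral {1..X} (\<lambda>x. Delta x * Delta (\<theta> * x)))
          \<longlongrightarrow> 0) at_top)"
proof (intro conjI allI impI)
  fix a b :: nat assume ab: "a > 0 \<and> b > 0"
  define l where "l = gcd a b"
  define c where "c = a div l"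
  define d where "d = b div l"
  define P where "P = (\<Prod>p\<in>prime_factors (c * d). let k = real (multiplicity p (c * d)) in
      (1 - (k - 1) / ((k + 1) * real p powr (3/2))) / (1 + 1 / real p powr (3/2)))"
  define Z where "Z = zeta_real (3/2) ^ 4 / zeta_real 3"
  have l: "l > 0" using ab by (simp add: l_def)
  have ac: "a = l * c" and bd: "b = l * d" by (simp_all add: l_def c_def d_def)
  have cd: "c > 0" "d > 0" using ab ac bd by (auto intro!: Nat.gr0I)
  have cop: "coprime c d" unfolding c_def d_def l_def using ab by (intro div_gcd_coprime) auto
  have T: "(tau_corr_term (3 / 2) c d has_sum (real (divisor_tau (c * d)) * Z * P)) {1..}"
    using tau_corr_has_sum[of "3 / 2" c d] cd cop by (simp add: P_def Z_def)
  have "diagonal_sum (1 / real a) (1 / real b) \<longlonglongrightarrow> real (c * d) powr (- 3 / 4) * (real (divisor_tau (c * d)) * Z * P)"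
    using diagonal_sum_rational[of a b] ab T unfolding c_def d_def l_def by simp
  from Delta_correlation[OF _ _ this]
  have "((\<lambda>X. 1 / X powr (3 / 2) * integral {1..X} (\<lambda>x. Delta (x / real a) * Delta (x / real b))) \<longlongrightarrow>
     (1 / real a * (1 / real b)) powr (1 / 4) / (6 * pi\<^sup>2) * (real (c * d) powr (- 3 / 4) * (real (divisor_tau (c * d)) * Z * P))) at_top"
    using ab by simp
  \<comment> \<open>Since a b = l^2 c d, the factor (a b)^(-1/4) is l^(-1/2) (c d)^(-1/4); it meets
    (c d)^(-3/4) from the coefficients and yields 1 / (sqrt l c d).\<close>
  moreover have "(1 / real a * (1 / real b)) powr (1 / 4) / (6 * pi\<^sup>2) * (real (c * d) powr (- 3 / 4) * (real (divisor_tau (c * d)) * Z * P))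
     = real (divisor_tau (c * d)) / (6 * pi\<^sup>2 * sqrt (real l) * real (c * d)) * Z * P"
  proof -
    define N where "N = real (c * d)"
    have N: "N > 0" using cd by (simp add: N_def)
    have "1 / real a * (1 / real b) = 1 / (real l powr 2 * N)"
      using l by (simp add: ac bd N_def power2_eq_square)
    then have "(1 / real a * (1 / real b)) powr (1 / 4) = 1 / ((real l powr 2) powr (1 / 4) * N powr (1 / 4))"
      using N l by (simp add: powr_divide powr_mult)
    also have "(real l powr 2) powr (1 / 4) = sqrt (real l)" by (simp only: powr_powr) (simp add: powr_half_sqrt)
    finally have 1: "(1 / real a * (1 / real b)) powr (1 / 4) = 1 / (sqrt (real l) * N powr (1 / 4))" .
    have "N powr (1 / 4) * N powr (3 / 4) = N powr 1" by (simp flip: powr_add)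
    then have "N powr (1 / 4) * N powr (3 / 4) = N" using N by simp
    moreover have "N powr (- 3 / 4) = 1 / N powr (3 / 4)" by (simp add: powr_minus field_simps)
    ultimately have 2: "1 / (sqrt (real l) * N powr (1 / 4)) * N powr (- 3 / 4) = 1 / (sqrt (real l) * N)"
      by (simp add: mult.assoc)
    have "(1 / real a * (1 / real b)) powr (1 / 4) / (6 * pi\<^sup>2) * (N powr (- 3 / 4) * (real (divisor_tau (c * d)) * Z * P)) =
       (1 / (sqrt (real l) * N powr (1 / 4)) * N powr (- 3 / 4)) * (real (divisor_tau (c * d)) * Z * P / (6 * pi\<^sup>2))"
      unfolding 1 by simp
    also have "\<dots> = real (divisor_tau (c * d)) / (6 * pi\<^sup>2 * sqrt (real l) * N) * Z * P"
      unfolding 2 by simp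
    finally show ?thesis unfolding N_def .
  qed
  ultimately show "let l = gcd a b; c = a div l; d = b div l in
        ((\<lambda>X :: real. 1 / X powr (3/2) *
            integral {1..X} (\<lambda>x. Delta (x / real a) * Delta (x / real b)))
          \<longlongrightarrow>
            real (divisor_tau (c * d)) / (6 * pi\<^sup>2 * sqrt (real l) * real (c * d))
            * (zeta_real (3/2) ^ 4 / zeta_real 3)
            * (\<Prod>p\<in>prime_factors (c * d).
                let k = real (multiplicity p (c * d)) in
                  (1 - (k - 1) / ((k + 1) * real p powr (3/2)))
                  / (1 + 1 / real p powr (3/2)))) at_top"
    unfolding Let_def l_def[symmetric] c_def[symmetric] d_def[symmetric] Z_def[symmetric] P_def[unfolded Let_def, symmetric]
    by (simp only:)
next
  fix \<theta> :: real assume \<theta>: "\<theta> > 0 \<and> \<theta> \<notin> \<rat>"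
  \<comment> \<open>A resonance m = n \<theta> with positive n would make \<theta> rational, so
    every finite diagonal is empty and the limit S is 0.\<close>
  have "diagonal_sum 1 \<theta> = (\<lambda>_. 0)" using diagonal_sum_irrational[of \<theta>] \<theta> by (simp add: fun_eq_iff)
  then have "diagonal_sum 1 \<theta> \<longlonglongrightarrow> 0" by simp
  from Delta_correlation[OF _ _ this]
  show "((\<lambda>X :: real. 1 / X powr (3/2) * integral {1..X} (\<lambda>x. Delta x * Delta (\<theta> * x))) \<longlongrightarrow> 0) at_top"
    using \<theta> by simp
qed

end
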